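(* Let $(A,\mathbf{T},\alpha)$ be a C*-dynamical system with $sp(\alpha)\neq\{0\}$. The following conditions are equivalent: (i) There exists a non-zero closed two-sided ideal $J\subset A^{\alpha}$ which is a simple C*-algebra and such that $\overline{A_{n}A_{-n}}=J$ for every $n\in sp(\alpha)$ with $n\geq 1$. (ii) Either (ii1) there is a positive integer $n_0$ such that $sp(\alpha)=\{-n_0,0,n_0\}$ and $J_{n_0}=\overline{A_{n_0}A_{-n_0}}$ is a simple C*-subalgebra of $A^{\alpha}$; or (ii2) there exists a non-zero $\alpha$-invariant hereditary C*-subalgebra $C$ of $A$ such that the following hold: (a) $A_n=C_n$ for every $n\in sp(\alpha)$ with $n\neq 0$ (hence $sp(\alpha)=sp(\alpha|_C)$); (b) $C$ is $\alpha$-simple; (c) $sp(\alpha|_C)=\widetilde{\Gamma}(\alpha|_C)$.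
   Context: $\mathbf{T}=\{z\in\mathbf{C}: |z|=1\}$. A C*-dynamical system $(A,\mathbf{T},\alpha)$ consists of a C*-algebra $A$ (not assumed unital) and a homomorphism $\alpha:\mathbf{T}\to \mathrm{Aut}(A)$ such that $z\mapsto\alpha_z(x)$ is norm-continuous for every $x\in A$. For an $\alpha$-invariant C*-subalgebra $D\subset A$ (including $D=A$) and $n\in\mathbf{Z}$, put $D_n=\{x\in D: \alpha_z(x)=z^n x \text{ for all } z\in\mathbf{T}\}$, and $D^{\alpha}=D_0$ (fixed point algebra). The Arveson spectrum is $sp(\alpha)=\{n\in\mathbf{Z}: A_n\neq\{0\}\}$, and $sp(\alpha|_D)=\{n\in\mathbf{Z}: D_n\neq\{0\}\}$. For subspaces $X,Y$, $XY$ denotes the set of finite sums of products $xy$ with $x\in X$, $y\in Y$, and the bar denotes norm closure. An $\alpha$-invariant C*-subalgebra $C$ is called $\alpha$-simple if every non-zero norm-closed $\alpha$-invariant two-sided ideal of $C$ equals $C$. For an $\alpha$-invariant C*-algebra $C$, $\mathcal{H}^{\alpha}(C)$ denotes the set of all non-zero $\alpha$-invariant hereditary C*-subalgebras of $C$, and the strong Connes spectrum (in the sense of Kishimoto) is $\widetilde{\Gamma}(\alpha|_C)=\{n\in\mathbf{Z}: \overline{D_nD_n^{*}}=D^{\alpha}\text{ for all } D\in\mathcal{H}^{\alpha}(C)\}$, where $D_n^*=\{x^*:x\in D_n\}$. *)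

theory Defs
  imports "HOL-Analysis.Analysis"
begin

text \<open>
  The library has no C*-algebras, nor complex normed algebras. A C*-algebra (not assumed
  unital, possibly zero) is a type of the following class. The complex scalar multiplication
  extends the real one that is inherited from \<^class>\<open>banach\<close>.
\<close>

class cstar_algebra = real_normed_algebra + banach +
  fixes scaleC :: "complex \<Rightarrow> 'a \<Rightarrow> 'a" (infixr "*\<^sub>C" 75)
    and star :: "'a \<Rightarrow> 'a"
  assumes scaleC_add_right: "c *\<^sub>C (x + y) = c *\<^sub>C x + c *\<^sub>C y"
    and scaleC_add_left: "(c + d) *\<^sub>C x = c *\<^sub>C x + d *\<^sub>C x"
    and scaleC_scaleC: "c *\<^sub>C d *\<^sub>C x = (c * d) *\<^sub>C x"
    and scaleR_scaleC: "scaleR r x = complex_of_real r *\<^sub>C x"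
    and norm_scaleC: "norm (c *\<^sub>C x) = cmod c * norm x"
    and mult_scaleC_left: "(c *\<^sub>C x) * y = c *\<^sub>C (x * y)"
    and mult_scaleC_right: "x * (c *\<^sub>C y) = c *\<^sub>C (x * y)"
    and star_add: "star (x + y) = star x + star y"
    and star_scaleC: "star (c *\<^sub>C x) = cnj c *\<^sub>C star x"
    and star_mult: "star (x * y) = star y * star x"
    and star_star: "star (star x) = x"
    and norm_star_mult_self: "norm (star x * x) = (norm x)\<^sup>2"

definition complex_subspace :: "'a::cstar_algebra set \<Rightarrow> bool" where
  "complex_subspace V \<longleftrightarrow>
     0 \<in> V \<and> (\<forall>x\<in>V. \<forall>y\<in>V. x + y \<in> V) \<and> (\<forall>c. \<forall>x\<in>V. c *\<^sub>C x \<in> V)"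

definition cstar_subalgebra :: "'a::cstar_algebra set \<Rightarrow> bool" where
  "cstar_subalgebra B \<longleftrightarrow>
     complex_subspace B \<and> closed B \<and>
     (\<forall>x\<in>B. \<forall>y\<in>B. x * y \<in> B) \<and> (\<forall>x\<in>B. star x \<in> B)"

text \<open>Closed two-sided ideals of a C*-subalgebra \<open>B\<close>; the ambient algebra is \<open>B = UNIV\<close>.\<close>

definition closed_ideal :: "'a::cstar_algebra set \<Rightarrow> 'a set \<Rightarrow> bool" where
  "closed_ideal I B \<longleftrightarrow>
     I \<subseteq> B \<and> complex_subspace I \<and> closed I \<and>
     (\<forall>b\<in>B. \<forall>x\<in>I. b * x \<in> I \<and> x * b \<in> I)"

definition simple_cstar_algebra :: "'a::cstar_algebra set \<Rightarrow> bool" where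
  "simple_cstar_algebra B \<longleftrightarrow>
     cstar_subalgebra B \<and> B \<noteq> {0} \<and> (\<forall>I. closed_ideal I B \<longrightarrow> I = {0} \<or> I = B)"

definition positive_elements :: "'a::cstar_algebra set \<Rightarrow> 'a set" where
  "positive_elements B = {star b * b |b. b \<in> B}"

text \<open>\<open>D\<close> is a hereditary C*-subalgebra of \<open>B\<close>: if \<open>0 \<le> a \<le> d\<close> in \<open>B\<close> with \<open>d\<close> positive in
  \<open>D\<close>, then \<open>a\<close> lies in \<open>D\<close>.\<close>

definition hereditary_subalgebra :: "'a::cstar_algebra set \<Rightarrow> 'a set \<Rightarrow> bool" where
  "hereditary_subalgebra D B \<longleftrightarrow>
     cstar_subalgebra D \<and> D \<subseteq> B \<and>
     (\<forall>a\<in>positive_elements B. \<forall>d\<in>positive_elements D.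
        d - a \<in> positive_elements B \<longrightarrow> a \<in> D)"

definition closed_product :: "'a::cstar_algebra set \<Rightarrow> 'a set \<Rightarrow> 'a set" where
  "closed_product X Y =
     closure {\<Sum>i<k. x i * y i |(k::nat) x y. \<forall>i<k. x i \<in> X \<and> y i \<in> Y}"

definition star_automorphism :: "('a::cstar_algebra \<Rightarrow> 'a) \<Rightarrow> bool" where
  "star_automorphism f \<longleftrightarrow>
     bij f \<and> (\<forall>x y. f (x + y) = f x + f y) \<and> (\<forall>c x. f (c *\<^sub>C x) = c *\<^sub>C f x) \<and>
     (\<forall>x y. f (x * y) = f x * f y) \<and> (\<forall>x. f (star x) = star (f x))"

abbreviation unit_circle :: "complex set" where
  "unit_circle \<equiv> sphere 0 1"

text \<open>An action of the circle group; the values \<open>\<alpha> z\<close> for \<open>z\<close> off the unit circle are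
  irrelevant here and in all that follows.\<close>

definition circle_action :: "(complex \<Rightarrow> 'a::cstar_algebra \<Rightarrow> 'a) \<Rightarrow> bool" where
  "circle_action \<alpha> \<longleftrightarrow>
     (\<forall>z\<in>unit_circle. star_automorphism (\<alpha> z)) \<and>
     (\<forall>z\<in>unit_circle. \<forall>w\<in>unit_circle. \<alpha> (z * w) = \<alpha> z \<circ> \<alpha> w) \<and>
     (\<forall>x. continuous_on unit_circle (\<lambda>z. \<alpha> z x))"

definition invariant :: "(complex \<Rightarrow> 'a::cstar_algebra \<Rightarrow> 'a) \<Rightarrow> 'a set \<Rightarrow> bool" where
  "invariant \<alpha> D \<longleftrightarrow> (\<forall>z\<in>unit_circle. \<alpha> z ` D \<subseteq> D)"

definition spectral_subspace ::
    "(complex \<Rightarrow> 'a::cstar_algebra \<Rightarrow> 'a) \<Rightarrow> 'a set \<Rightarrow> int \<Rightarrow> 'a set" where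
  "spectral_subspace \<alpha> D n = {x\<in>D. \<forall>z\<in>unit_circle. \<alpha> z x = (z powi n) *\<^sub>C x}"

abbreviation fixed_points :: "(complex \<Rightarrow> 'a::cstar_algebra \<Rightarrow> 'a) \<Rightarrow> 'a set \<Rightarrow> 'a set" where
  "fixed_points \<alpha> D \<equiv> spectral_subspace \<alpha> D 0"

definition arveson_spectrum ::
    "(complex \<Rightarrow> 'a::cstar_algebra \<Rightarrow> 'a) \<Rightarrow> 'a set \<Rightarrow> int set" where
  "arveson_spectrum \<alpha> D = {n. spectral_subspace \<alpha> D n \<noteq> {0}}"

definition invariant_hereditary ::
    "(complex \<Rightarrow> 'a::cstar_algebra \<Rightarrow> 'a) \<Rightarrow> 'a set \<Rightarrow> 'a set set" where
  "invariant_hereditary \<alpha> C = {D. D \<noteq> {0} \<and> invariant \<alpha> D \<and> hereditary_subalgebra D C}"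

definition invariantly_simple ::
    "(complex \<Rightarrow> 'a::cstar_algebra \<Rightarrow> 'a) \<Rightarrow> 'a set \<Rightarrow> bool" where
  "invariantly_simple \<alpha> C \<longleftrightarrow>
     (\<forall>I. closed_ideal I C \<and> invariant \<alpha> I \<and> I \<noteq> {0} \<longrightarrow> I = C)"

definition strong_Connes_spectrum ::
    "(complex \<Rightarrow> 'a::cstar_algebra \<Rightarrow> 'a) \<Rightarrow> 'a set \<Rightarrow> int set" where
  "strong_Connes_spectrum \<alpha> C =
     {n. \<forall>D\<in>invariant_hereditary \<alpha> C.
           closed_product (spectral_subspace \<alpha> D n) (star ` spectral_subspace \<alpha> D n)
             = fixed_points \<alpha> D}"

end

theory Submission
  imports Defs "HOL-Computational_Algebra.Fundamental_Theorem_Algebra"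
begin

text \<open>
  Write \<open>A\<^sub>n\<close> for the spectral subspaces and \<open>X Y\<close> for closed products. The theorem is
  about the ideals \<open>A\<^sub>n A\<^sub>-\<^sub>n\<close> of the fixed point algebra \<open>A\<^sub>0\<close>. Two facts do most of the
  work: \<open>A\<^sub>n = (A\<^sub>n A\<^sub>-\<^sub>n) A\<^sub>n\<close> (\<open>spectral_subspace_factor_left\<close>), and
  \<open>hereditary_hull B I\<close>, which turns an ideal \<open>I\<close> of the fixed points of \<open>B\<close> into an invariant
  hereditary subalgebra of \<open>B\<close> with fixed points \<open>I\<close> (\<open>hereditary_hull_of_ideal\<close>).

  Assume that all \<open>A\<^sub>n A\<^sub>-\<^sub>n\<close> with \<open>n \<ge> 1\<close> in the spectrum are the same simple ideal \<open>J\<close>.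
  If there is only one such \<open>n\<close>, then the spectrum has three elements. Otherwise let \<open>n\<close> be
  the least one and \<open>m\<close> another one. Then \<open>A\<^sub>m = A\<^sub>n A\<^sub>m\<^sub>-\<^sub>n\<close> does not vanish, and since \<open>A\<^sub>n\<close>
  absorbs \<open>A\<^sub>-\<^sub>n A\<^sub>n\<close> on the right and \<open>A\<^sub>m\<^sub>-\<^sub>n\<close> absorbs \<open>J\<close> on the left, the ideals
  \<open>A\<^sub>-\<^sub>n A\<^sub>n\<close> and \<open>J\<close> are not orthogonal, so they are equal by simplicity. Induction on the
  degree gives \<open>A\<^sub>-\<^sub>k A\<^sub>k = J\<close> for all \<open>k \<noteq> 0\<close> in the spectrum. The hereditary hull \<open>C\<close> of \<open>J\<close>
  then contains all these \<open>A\<^sub>k\<close> and has the simple fixed point algebra \<open>J\<close>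
  (\<open>exists_hereditary_of_two_positive_degrees\<close>). A simple fixed point algebra makes \<open>C\<close> simple
  with respect to the action (\<open>invariantly_simple_of_simple_fixed_points\<close>), and it makes the
  products \<open>D\<^sub>k D\<^sub>-\<^sub>k\<close> as large as possible for every invariant hereditary \<open>D\<close>
  (\<open>strong_Connes_spectrum_of_simple_fixed_points\<close>).

  Conversely, if \<open>C\<close> is simple with respect to the action and its spectrum is its strong Connes
  spectrum, then the definition of the latter, applied to \<open>C\<close> itself, says that \<open>A\<^sub>n A\<^sub>-\<^sub>n\<close> is the
  fixed point algebra of \<open>C\<close> for each \<open>n \<noteq> 0\<close> in the spectrum. Applied to the hereditary hulls
  of the ideals of the fixed point algebra, it says that they are stable under conjugation by
  the spectral subspaces. So they are the fixed points of invariant ideals of \<open>C\<close>, and the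
  fixed point algebra is simple (\<open>simple_fixed_points\<close>).

  These arguments rest on three analytic facts. First, approximate units can be chosen inside
  any C*-subalgebra that contains \<open>star x * x\<close> (\<open>approximate_right_unit\<close>). Second, dropping a
  summand from a sum of two elements \<open>star x * x\<close> does not increase the norm
  (\<open>norm_le_norm_sum_of_positives\<close>). Third, an element is determined by its Fourier
  coefficients under the action (\<open>mem_closed_subspace_of_fourier_coefficients\<close>). The first two
  come from a functional calculus for self-adjoint elements. It is developed in the
  multiplier algebra, which supplies a unit, and it is elementary: \<open>h - \<mu>\<close> is invertible for \<open>\<mu>\<close>
  off the interval \<open>[-1, 1]\<close> if \<open>h\<close> is self-adjoint with \<open>norm h \<le> 1\<close>, hence so is \<open>p(h)\<close> if
  the polynomial \<open>p\<close> has no zero in that interval. The norm of a self-adjoint element is visible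
  from invertibility, and this bounds \<open>norm p(h)\<close> by the supremum of \<open>p\<close> on the interval
  (\<open>norm_poly_at_le\<close>).
\<close>

section \<open>C*-algebras and their multipliers\<close>

lemma bounded_linear_scaleC: "bounded_linear ((*\<^sub>C) c :: 'a::cstar_algebra \<Rightarrow> 'a)"
  by (rule bounded_linear_intro[where K = "cmod c"])
     (simp_all add: scaleC_add_right scaleR_scaleC scaleC_scaleC norm_scaleC mult.commute)

lemma scaleC_one [simp]: "1 *\<^sub>C x = (x::'a::cstar_algebra)"
  using scaleR_scaleC[of 1 x] by simp

lemma scaleC_zero_left [simp]: "0 *\<^sub>C x = (0::'a::cstar_algebra)"
  using scaleR_scaleC[of 0 x] by simp

lemma scaleC_zero_right [simp]: "c *\<^sub>C 0 = (0::'a::cstar_algebra)"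
  using norm_scaleC[of c 0] by simp

lemma scaleC_minus1: "(-1) *\<^sub>C x = - (x::'a::cstar_algebra)"
  using scaleR_scaleC[of "-1" x] by simp

lemma star_zero [simp]: "star 0 = (0::'a::cstar_algebra)"
  using star_scaleC[of 0 0] by simp

lemma star_minus: "star (- x) = - star (x::'a::cstar_algebra)"
  using star_scaleC[of "-1" x] by (simp add: scaleC_minus1)

lemma star_diff: "star (x - y) = star x - star (y::'a::cstar_algebra)"
  using star_add[of x "- y"] by (simp add: star_minus)

lemma star_scaleR: "star (r *\<^sub>R x) = r *\<^sub>R star (x::'a::cstar_algebra)"
  by (simp add: scaleR_scaleC star_scaleC)

lemma norm_star [simp]: "norm (star x) = norm (x::'a::cstar_algebra)"
proof -
  have le: "norm y \<le> norm (star y)" for y :: 'a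
  proof (cases "y = 0")
    case False
    have "norm y * norm y = norm (star y * y)"
      by (simp add: norm_star_mult_self power2_eq_square)
    also have "\<dots> \<le> norm (star y) * norm y" by (rule norm_mult_ineq)
    finally show ?thesis using False by simp
  qed simp
  show ?thesis using le[of x] le[of "star x"] by (simp add: star_star)
qed

lemma norm_mult_star_self: "norm (x * star x) = (norm (x::'a::cstar_algebra))\<^sup>2"
  using norm_star_mult_self[of "star x"] by (simp add: star_star)

lemma bounded_linear_star: "bounded_linear (star :: 'a::cstar_algebra \<Rightarrow> 'a)"
  by (rule bounded_linear_intro[where K = 1]) (simp_all add: star_add star_scaleR)

lemma star_mult_self_eq_0_iff [simp]: "star x * x = 0 \<longleftrightarrow> x = (0::'a::cstar_algebra)"
  using norm_star_mult_self[of x] by auto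

text \<open>
  A monoid rather than a ring with unit, because the latter demands \<open>0 \<noteq> 1\<close>: the multiplier
  algebra of the zero algebra is zero.
\<close>

class unital_cstar_algebra = cstar_algebra + monoid_mult

text \<open>
  Positivity is a matter of comparing an element with multiples of a unit, and there may be
  none in a C*-algebra. The multiplier algebra provides one. It consists of the operators on the algebra, viewed as a
  Hilbert module over itself, that have an adjoint. The adjoint is carried along, so that the
  involution is a swap. This is again a C*-algebra, now with a unit, and it contains the
  given algebra through left multiplication.
\<close>

typedef (overloaded) 'a multiplier =
  "{p :: ('a::cstar_algebra \<Rightarrow>\<^sub>L 'a) \<times> ('a \<Rightarrow>\<^sub>L 'a).
      \<forall>x y. star (blinfun_apply (fst p) x) * y = star x * blinfun_apply (snd p) y}"
  by (rule exI[of _ "(0, 0)"]) auto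

setup_lifting type_definition_multiplier

lemma adjoint_swap:
  fixes S T :: "'a::cstar_algebra \<Rightarrow>\<^sub>L 'a"
  assumes "\<forall>x y. star (S x) * y = star x * T y"
  shows "star (T x) * y = star x * S y"
proof -
  have "star (star (S y) * x) = star (star y * T x)" using assms by simp
  thus ?thesis by (simp add: star_mult star_star)
qed

lemma norm_adjoint_le:
  fixes S T :: "'a::cstar_algebra \<Rightarrow>\<^sub>L 'a"
  assumes "\<forall>x y. star (S x) * y = star x * T y"
  shows "norm T \<le> norm S"
proof (rule norm_blinfun_bound)
  fix x
  show "norm (T x) \<le> norm S * norm x"
  proof (cases "T x = 0")
    case False
    have "norm (T x) * norm (T x) = norm (star (T x) * T x)"
      by (simp add: norm_star_mult_self power2_eq_square)
    also have "\<dots> = norm (star x * S (T x))"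
      by (simp add: adjoint_swap[OF assms])
    also have "\<dots> \<le> norm x * (norm S * norm (T x))"
      by (rule order_trans[OF norm_mult_ineq]) (simp add: mult_left_mono norm_blinfun)
    finally show ?thesis using False by (simp add: mult_ac)
  qed simp
qed simp

lemma norm_adjoint_eq:
  fixes S T :: "'a::cstar_algebra \<Rightarrow>\<^sub>L 'a"
  assumes "\<forall>x y. star (S x) * y = star x * T y"
  shows "norm T = norm S"
  by (intro antisym norm_adjoint_le) (use assms adjoint_swap[OF assms] in auto)

text \<open>The existence of an adjoint forces complex linearity.\<close>

lemma adjointable_scaleC:
  fixes S T :: "'a::cstar_algebra \<Rightarrow>\<^sub>L 'a"
  assumes "\<forall>x y. star (S x) * y = star x * T y"
  shows "S (c *\<^sub>C x) = c *\<^sub>C S x"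
proof -
  let ?d = "S (c *\<^sub>C x) - c *\<^sub>C S x"
  have "star ?d * ?d = 0"
    using assms by (simp add: star_diff star_scaleC mult_scaleC_left left_diff_distrib)
  thus ?thesis by simp
qed

lift_definition blinfun_scaleC :: "complex \<Rightarrow> ('a::cstar_algebra \<Rightarrow>\<^sub>L 'a) \<Rightarrow> 'a \<Rightarrow>\<^sub>L 'a"
  is "\<lambda>c f x. c *\<^sub>C f x"
  by (rule bounded_linear_compose[OF bounded_linear_scaleC])

lemma norm_blinfun_scaleC: "norm (blinfun_scaleC c f) = cmod c * norm f"
proof -
  have le: "norm (blinfun_scaleC c f) \<le> cmod c * norm f" for c and f :: "'a::cstar_algebra \<Rightarrow>\<^sub>L 'a"
    by (rule norm_blinfun_bound)
       (simp_all add: blinfun_scaleC.rep_eq norm_scaleC norm_blinfun mult_left_mono mult.assoc)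
  show ?thesis
  proof (cases "c = 0")
    case True
    thus ?thesis using le[of 0 f] by simp
  next
    case False
    have "f = blinfun_scaleC (1 / c) (blinfun_scaleC c f)"
      using False by (intro blinfun_eqI) (simp add: blinfun_scaleC.rep_eq scaleC_scaleC)
    hence "norm f \<le> cmod (1 / c) * norm (blinfun_scaleC c f)" using le by metis
    hence "cmod c * norm f \<le> norm (blinfun_scaleC c f)"
      using False by (simp add: norm_divide field_simps)
    thus ?thesis using le[of c f] by simp
  qed
qed

instantiation multiplier :: (cstar_algebra) "{real_normed_algebra, monoid_mult}"
begin

lift_definition zero_multiplier :: "'a multiplier" is "(0, 0)" by auto
lift_definition one_multiplier :: "'a multiplier" is "(id_blinfun, id_blinfun)" by auto

lift_definition plus_multiplier :: "'a multiplier \<Rightarrow> 'a multiplier \<Rightarrow> 'a multiplier"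
  is "\<lambda>p q. (fst p + fst q, snd p + snd q)"
  by (simp add: blinfun.add_left star_add algebra_simps)

lift_definition minus_multiplier :: "'a multiplier \<Rightarrow> 'a multiplier \<Rightarrow> 'a multiplier"
  is "\<lambda>p q. (fst p - fst q, snd p - snd q)"
  by (simp add: blinfun.diff_left star_diff algebra_simps)

lift_definition uminus_multiplier :: "'a multiplier \<Rightarrow> 'a multiplier"
  is "\<lambda>p. (- fst p, - snd p)"
  by (simp add: blinfun.minus_left star_minus)

lift_definition times_multiplier :: "'a multiplier \<Rightarrow> 'a multiplier \<Rightarrow> 'a multiplier"
  is "\<lambda>p q. (fst p o\<^sub>L fst q, snd q o\<^sub>L snd p)"
  by simp

lift_definition scaleR_multiplier :: "real \<Rightarrow> 'a multiplier \<Rightarrow> 'a multiplier"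
  is "\<lambda>r p. (r *\<^sub>R fst p, r *\<^sub>R snd p)"
  by (simp add: blinfun.scaleR_left star_scaleR)

lift_definition norm_multiplier :: "'a multiplier \<Rightarrow> real" is "\<lambda>p. norm (fst p)" .

definition dist_multiplier :: "'a multiplier \<Rightarrow> 'a multiplier \<Rightarrow> real"
  where "dist_multiplier x y = norm (x - y)"

definition uniformity_multiplier :: "('a multiplier \<times> 'a multiplier) filter"
  where "uniformity_multiplier = (INF e\<in>{0<..}. principal {(x, y). dist x y < e})"

definition open_multiplier :: "'a multiplier set \<Rightarrow> bool"
  where "open_multiplier U = (\<forall>x\<in>U. \<forall>\<^sub>F (x', y) in uniformity. x' = x \<longrightarrow> y \<in> U)"

definition sgn_multiplier :: "'a multiplier \<Rightarrow> 'a multiplier"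
  where "sgn_multiplier x = scaleR (inverse (norm x)) x"

instance
proof
  fix x y z :: "'a multiplier" and a b :: real
  show "x + y + z = x + (y + z)" by transfer (simp add: add.assoc)
  show "x + y = y + x" by transfer (simp add: add.commute)
  show "0 + x = x" by transfer simp
  show "- x + x = 0" by transfer simp
  show "x - y = x + - y" by transfer simp
  show "x * y * z = x * (y * z)" by transfer (auto intro!: blinfun_eqI)
  show "1 * x = x" by transfer (auto intro!: prod_eqI blinfun_eqI)
  show "x * 1 = x" by transfer (auto intro!: prod_eqI blinfun_eqI)
  show "(x + y) * z = x * z + y * z"
    by transfer (auto intro!: blinfun_eqI simp: blinfun.add_left blinfun.add_right)
  show "x * (y + z) = x * y + x * z"
    by transfer (auto intro!: blinfun_eqI simp: blinfun.add_left blinfun.add_right)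
  show "a *\<^sub>R (x + y) = a *\<^sub>R x + a *\<^sub>R y" by transfer (simp add: scaleR_add_right)
  show "(a + b) *\<^sub>R x = a *\<^sub>R x + b *\<^sub>R x" by transfer (simp add: scaleR_add_left)
  show "a *\<^sub>R b *\<^sub>R x = (a * b) *\<^sub>R x" by transfer simp
  show "1 *\<^sub>R x = x" by transfer simp
  show "(a *\<^sub>R x) * y = a *\<^sub>R (x * y)"
    by transfer (auto intro!: blinfun_eqI simp: blinfun.scaleR_left blinfun.scaleR_right)
  show "x * (a *\<^sub>R y) = a *\<^sub>R (x * y)"
    by transfer (auto intro!: blinfun_eqI simp: blinfun.scaleR_left blinfun.scaleR_right)
  show "dist x y = norm (x - y)" by (rule dist_multiplier_def)
  show "(uniformity :: ('a multiplier \<times> 'a multiplier) filter)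
      = (INF e\<in>{0<..}. principal {(x, y). dist x y < e})"
    by (rule uniformity_multiplier_def)
  show "open U \<longleftrightarrow> (\<forall>x\<in>U. \<forall>\<^sub>F (x', y) in uniformity. x' = x \<longrightarrow> y \<in> U)"
    for U :: "'a multiplier set" by (rule open_multiplier_def)
  show "sgn x = scaleR (inverse (norm x)) x" by (rule sgn_multiplier_def)
  show "norm x = 0 \<longleftrightarrow> x = 0"
  proof (transfer, goal_cases)
    case (1 p)
    show ?case using norm_adjoint_eq[OF 1] by (auto simp: prod_eq_iff)
  qed
  show "norm (x + y) \<le> norm x + norm y" by transfer (simp add: norm_triangle_ineq)
  show "norm (a *\<^sub>R x) = \<bar>a\<bar> * norm x" by transfer simp
  show "norm (x * y) \<le> norm x * norm y" by transfer (simp add: norm_blinfun_compose)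
qed

end

instance multiplier :: (cstar_algebra) banach
proof
  show "convergent X" if "Cauchy X" for X :: "nat \<Rightarrow> 'a multiplier"
  proof -
    define S T where "S n = fst (Rep_multiplier (X n))" and "T n = snd (Rep_multiplier (X n))" for n
    have adj: "star (S n x) * y = star x * T n y" for n x y
      using Rep_multiplier[of "X n"] by (simp add: S_def T_def)
    have nS: "norm (S m - S n) = norm (X m - X n)" for m n
      by (simp add: S_def norm_multiplier.rep_eq minus_multiplier.rep_eq)
    have nT: "norm (T m - T n) = norm (S m - S n)" for m n
      by (rule norm_adjoint_eq)
         (simp add: adj blinfun.diff_left star_diff left_diff_distrib right_diff_distrib)
    have "Cauchy S" "Cauchy T"
      using that by (simp_all add: Cauchy_def dist_norm nS nT)
    then obtain S' T' where lim: "S \<longlonglongrightarrow> S'" "T \<longlonglongrightarrow> T'"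
      by (meson Cauchy_convergent convergentD)
    have "star (S' x) * y = star x * T' y" for x y
    proof (rule LIMSEQ_unique)
      show "(\<lambda>n. star (S n x) * y) \<longlonglongrightarrow> star (S' x) * y"
        by (intro tendsto_intros bounded_linear.tendsto[OF bounded_linear_star] lim)
      show "(\<lambda>n. star (S n x) * y) \<longlonglongrightarrow> star x * T' y"
        unfolding adj by (intro tendsto_intros lim)
    qed
    hence rep: "Rep_multiplier (Abs_multiplier (S', T')) = (S', T')"
      by (intro Abs_multiplier_inverse) simp
    have "norm (X n - Abs_multiplier (S', T')) = norm (S n - S')" for n
      by (simp add: norm_multiplier.rep_eq minus_multiplier.rep_eq rep S_def)
    hence "X \<longlonglongrightarrow> Abs_multiplier (S', T')"
      using lim(1) by (simp add: LIMSEQ_iff)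
    thus "convergent X" by (rule convergentI)
  qed
qed

instantiation multiplier :: (cstar_algebra) cstar_algebra
begin

lift_definition scaleC_multiplier :: "complex \<Rightarrow> 'a multiplier \<Rightarrow> 'a multiplier"
  is "\<lambda>c p. (blinfun_scaleC c (fst p), blinfun_scaleC (cnj c) (snd p))"
  by (simp add: blinfun_scaleC.rep_eq star_scaleC mult_scaleC_left mult_scaleC_right)

lift_definition star_multiplier :: "'a multiplier \<Rightarrow> 'a multiplier"
  is "\<lambda>p. (snd p, fst p)"
  using adjoint_swap by fastforce

instance
proof
  fix x y z :: "'a multiplier" and a :: real and c d :: complex
  show "c *\<^sub>C (x + y) = c *\<^sub>C x + c *\<^sub>C y"
    by transfer (auto intro!: blinfun_eqI
        simp: blinfun_scaleC.rep_eq blinfun.add_left scaleC_add_right)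
  show "(c + d) *\<^sub>C x = c *\<^sub>C x + d *\<^sub>C x"
    by transfer (auto intro!: blinfun_eqI
        simp: blinfun_scaleC.rep_eq blinfun.add_left scaleC_add_left)
  show "c *\<^sub>C d *\<^sub>C x = (c * d) *\<^sub>C x"
    by transfer (auto intro!: blinfun_eqI simp: blinfun_scaleC.rep_eq scaleC_scaleC)
  show "(c *\<^sub>C x) * y = c *\<^sub>C (x * y)"
  proof (transfer, goal_cases)
    case (1 c p q)
    have "snd q (cnj c *\<^sub>C x) = cnj c *\<^sub>C snd q x" for x
      by (rule adjointable_scaleC[of _ "fst q"]) (use 1 adjoint_swap in blast)
    thus ?case by (auto intro!: blinfun_eqI simp: blinfun_scaleC.rep_eq)
  qed
  show "x * (c *\<^sub>C y) = c *\<^sub>C (x * y)"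
  proof (transfer, goal_cases)
    case (1 p c q)
    have "fst p (c *\<^sub>C x) = c *\<^sub>C fst p x" for x
      by (rule adjointable_scaleC[of _ "snd p"]) (use 1 in blast)
    thus ?case by (auto intro!: blinfun_eqI simp: blinfun_scaleC.rep_eq)
  qed
  show "a *\<^sub>R x = complex_of_real a *\<^sub>C x"
    by transfer (auto intro!: blinfun_eqI
        simp: blinfun_scaleC.rep_eq blinfun.scaleR_left scaleR_scaleC)
  show "norm (c *\<^sub>C x) = cmod c * norm x" by transfer (simp add: norm_blinfun_scaleC)
  show "star (x + y) = star x + star y" by transfer simp
  show "star (c *\<^sub>C x) = cnj c *\<^sub>C star x" by transfer simp
  show "star (x * y) = star y * star x" by transfer simp
  show "star (star x) = x" by transfer simp
  show "norm (star x * x) = (norm x)\<^sup>2"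
  proof (transfer, goal_cases)
    case (1 p)
    define S T where "S = fst p" and "T = snd p"
    have adj: "\<forall>x y. star (S x) * y = star x * T y" using 1 by (simp add: S_def T_def)
    have "norm (T o\<^sub>L S) \<le> norm T * norm S" by (rule norm_blinfun_compose)
    hence le: "norm (T o\<^sub>L S) \<le> (norm S)\<^sup>2"
      by (simp add: norm_adjoint_eq[OF adj] power2_eq_square)
    have "norm S \<le> sqrt (norm (T o\<^sub>L S))"
    proof (rule norm_blinfun_bound)
      fix x
      have "(norm (S x))\<^sup>2 = norm (star x * (T o\<^sub>L S) x)"
        using adj by (simp flip: norm_star_mult_self)
      also have "\<dots> \<le> norm x * (norm (T o\<^sub>L S) * norm x)"
        by (rule order_trans[OF norm_mult_ineq], subst norm_star)
           (intro mult_left_mono norm_blinfun norm_ge_zero)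
      also have "\<dots> = (sqrt (norm (T o\<^sub>L S)) * norm x)\<^sup>2"
        by (simp add: power_mult_distrib power2_eq_square)
      finally show "norm (S x) \<le> sqrt (norm (T o\<^sub>L S)) * norm x"
        by (rule power2_le_imp_le) simp
    qed simp
    hence "(norm S)\<^sup>2 \<le> norm (T o\<^sub>L S)"
      using power_mono[of "norm S" "sqrt (norm (T o\<^sub>L S))" 2] by simp
    with le show ?case by (simp add: S_def T_def)
  qed
qed

end

instance multiplier :: (cstar_algebra) unital_cstar_algebra ..

lift_definition multiplier_of :: "'a::cstar_algebra \<Rightarrow> 'a multiplier"
  is "\<lambda>a. (blinfun_mult_right a, blinfun_mult_right (star a))"
  by (simp add: star_mult mult.assoc)

lemma multiplier_eqI:
  assumes "\<And>z. fst (Rep_multiplier x) z = fst (Rep_multiplier y) z"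
  shows "x = y"
proof -
  have "norm (x - y) = 0"
    using assms by (auto simp: norm_multiplier.rep_eq minus_multiplier.rep_eq intro: blinfun_eqI)
  thus ?thesis by simp
qed

lemma multiplier_of_add: "multiplier_of (x + y) = multiplier_of x + multiplier_of y"
  by (rule multiplier_eqI) (simp add: multiplier_of.rep_eq plus_multiplier.rep_eq
      blinfun.add_left distrib_right)

lemma multiplier_of_mult: "multiplier_of (x * y) = multiplier_of x * multiplier_of y"
  by (rule multiplier_eqI) (simp add: multiplier_of.rep_eq times_multiplier.rep_eq mult.assoc)

lemma multiplier_of_scaleC: "multiplier_of (c *\<^sub>C x) = c *\<^sub>C multiplier_of x"
  by (rule multiplier_eqI) (simp add: multiplier_of.rep_eq scaleC_multiplier.rep_eq
      blinfun_scaleC.rep_eq mult_scaleC_left)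

lemma multiplier_of_diff: "multiplier_of (x - y) = multiplier_of x - multiplier_of y"
  using multiplier_of_add[of x "(-1) *\<^sub>C y"] by (simp only: multiplier_of_scaleC)
     (simp add: scaleC_minus1)

lemma multiplier_of_star: "multiplier_of (star x) = star (multiplier_of x)"
  by (rule multiplier_eqI) (simp add: multiplier_of.rep_eq star_multiplier.rep_eq)

lemma multiplier_of_scaleR: "multiplier_of (r *\<^sub>R x) = r *\<^sub>R multiplier_of x"
  by (simp add: scaleR_scaleC multiplier_of_scaleC)

lemma norm_multiplier_of [simp]: "norm (multiplier_of x) = norm x"
proof (transfer, simp, rule antisym)
  fix x :: 'a
  show "norm (blinfun_mult_right x) \<le> norm x"
    by (rule norm_blinfun_bound) (simp_all add: norm_mult_ineq)
  have "norm x * norm x \<le> norm (blinfun_mult_right x) * norm x"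
    using norm_blinfun[of "blinfun_mult_right x" "star x"] norm_mult_star_self[of x]
    by (simp add: power2_eq_square)
  thus "norm x \<le> norm (blinfun_mult_right x)" by (cases "x = 0") auto
qed

lemmas multiplier_of_simps = multiplier_of_add multiplier_of_diff multiplier_of_mult
  multiplier_of_scaleC multiplier_of_scaleR multiplier_of_star

section \<open>Square roots and inverses\<close>

lemma scaleC_diff_right: "c *\<^sub>C (x - y) = c *\<^sub>C x - c *\<^sub>C (y::'a::cstar_algebra)"
  by (rule linear_diff[OF bounded_linear.linear[OF bounded_linear_scaleC]])

lemma scaleC_minus_right: "c *\<^sub>C (- x) = - (c *\<^sub>C (x::'a::cstar_algebra))"
  using scaleC_diff_right[of c 0 x] by simp

lemma scaleC_minus_left: "(- c) *\<^sub>C x = - (c *\<^sub>C (x::'a::cstar_algebra))"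
  using scaleC_scaleC[of "-1" c x] by (simp add: scaleC_minus1)

lemma complex_subspaceD:
  assumes "complex_subspace V"
  shows "0 \<in> V" "\<And>x y. \<lbrakk>x \<in> V; y \<in> V\<rbrakk> \<Longrightarrow> x + y \<in> V" "\<And>c x. x \<in> V \<Longrightarrow> c *\<^sub>C x \<in> V"
    "\<And>x y. \<lbrakk>x \<in> V; y \<in> V\<rbrakk> \<Longrightarrow> x - y \<in> V" "\<And>r x. x \<in> V \<Longrightarrow> r *\<^sub>R x \<in> V"
proof -
  show 1: "0 \<in> V" "\<And>x y. \<lbrakk>x \<in> V; y \<in> V\<rbrakk> \<Longrightarrow> x + y \<in> V" "\<And>c x. x \<in> V \<Longrightarrow> c *\<^sub>C x \<in> V"
    using assms by (auto simp: complex_subspace_def)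
  show "r *\<^sub>R x \<in> V" if "x \<in> V" for r x using 1(3)[OF that] by (simp add: scaleR_scaleC)
  show "x - y \<in> V" if "x \<in> V" "y \<in> V" for x y
    using 1(2)[OF that(1) 1(3)[OF that(2), of "-1"]] by (simp add: scaleC_minus1)
qed

lemma cstar_subalgebraD:
  assumes "cstar_subalgebra B"
  shows "complex_subspace B" "closed B" "\<And>x y. \<lbrakk>x \<in> B; y \<in> B\<rbrakk> \<Longrightarrow> x * y \<in> B"
    "\<And>x. x \<in> B \<Longrightarrow> star x \<in> B"
  using assms by (auto simp: cstar_subalgebra_def)

lemma cstar_subalgebra_UNIV: "cstar_subalgebra (UNIV :: 'a::cstar_algebra set)"
  by (simp add: cstar_subalgebra_def complex_subspace_def)

lemma closed_self_adjoint: "closed {x::'a::cstar_algebra. star x = x}"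
  by (intro closed_Collect_eq continuous_intros linear_continuous_on bounded_linear_star)

lemma closed_commutant: "closed {x::'a::cstar_algebra. x * y = y * x}"
  by (intro closed_Collect_eq continuous_intros)

text \<open>
  If there is a unit, then \<open>1 - r\<close> is a square root of \<open>1 - x\<close>. The number \<open>r\<close> solves
  \<open>r = (x + r\<^sup>2) / 2\<close>, and the right side is a contraction of the ball of radius
  \<open>norm x < 1\<close>. Running the iteration inside a suitable closed set gives the properties
  of \<open>r\<close> for free.
\<close>

lemma quasi_square_root:
  fixes x :: "'a::cstar_algebra"
  assumes B: "cstar_subalgebra B" and x: "x \<in> B" "star x = x" "norm x < 1"
  obtains r where "r \<in> B" "star r = r" "r + r - r * r = x"
    "\<And>y. x * y = y * x \<Longrightarrow> r * y = y * r"
proof -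
  define \<rho> where "\<rho> = norm x"
  have \<rho>: "0 \<le> \<rho>" "\<rho> < 1" using x by (auto simp: \<rho>_def)
  define S where "S = B \<inter> cball 0 \<rho> \<inter> {r. star r = r} \<inter>
    (\<Inter>y\<in>{y. x * y = y * x}. {r. r * y = y * r})"
  define f where "f r = (1/2) *\<^sub>R (x + r * r)" for r
  have S_iff: "r \<in> S \<longleftrightarrow> r \<in> B \<and> norm r \<le> \<rho> \<and> star r = r \<and> (\<forall>y. x * y = y * x \<longrightarrow> r * y = y * r)"
    for r unfolding S_def by (simp only: Int_iff INT_iff mem_Collect_eq mem_cball_0 conj_assoc) blast
  note BD = cstar_subalgebraD[OF B]
  note VD = complex_subspaceD[OF BD(1)]
  have "\<exists>!r\<in>S. f r = r"
  proof (rule Banach_fix[where c = \<rho>])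
    show "complete S"
      unfolding S_def
      by (intro closed_Int closed_INT ballI closed_commutant closed_self_adjoint BD(2)
          closed_cball complete_eq_closed[THEN iffD2])
    have "0 \<in> S" using \<rho> VD(1) by (simp add: S_iff)
    thus "S \<noteq> {}" by blast
    show "f ` S \<subseteq> S"
    proof clarify
      fix r assume r: "r \<in> S"
      have r': "r \<in> B" "norm r \<le> \<rho>" "star r = r" using r by (simp_all only: S_iff)
      have "norm (r * r) \<le> norm r * norm r" by (rule norm_mult_ineq)
      also have "\<dots> \<le> \<rho> * 1" using r' \<rho> by (intro mult_mono) auto
      finally have "norm (x + r * r) \<le> \<rho> + \<rho>"
        by (intro norm_triangle_mono) (auto simp: \<rho>_def)
      hence "norm (f r) \<le> \<rho>" by (simp add: f_def)
      moreover have "r * r * y = y * (r * r)" if "x * y = y * x" for y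
      proof -
        have "r * y = y * r" using r that by (simp add: S_iff)
        thus ?thesis by (metis mult.assoc)
      qed
      hence "\<forall>y. x * y = y * x \<longrightarrow> f r * y = y * f r"
        unfolding f_def by (simp add: distrib_left distrib_right)
      moreover have "f r \<in> B" using r'(1) x(1) VD(2,5) BD(3) by (simp add: f_def)
      moreover have "star (f r) = f r"
        by (simp add: f_def star_scaleR star_add star_mult r'(3) x(2))
      ultimately show "f r \<in> S" by (simp only: S_iff)
    qed
    show "dist (f r) (f r') \<le> \<rho> * dist r r'" if "r \<in> S" "r' \<in> S" for r r'
    proof -
      have "f r - f r' = (1/2) *\<^sub>R (r * (r - r') + (r - r') * r')"
        by (simp add: f_def algebra_simps)
      also have "norm \<dots> \<le> (1/2) * (norm r * norm (r - r') + norm (r - r') * norm r')"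
        by (simp, intro norm_triangle_mono norm_mult_ineq)
      also have "\<dots> \<le> (1/2) * (\<rho> * norm (r - r') + norm (r - r') * \<rho>)"
        using that[unfolded S_iff] by (intro mult_left_mono add_mono mult_right_mono) auto
      finally show ?thesis by (simp add: dist_norm mult_ac)
    qed
  qed (use \<rho> in auto)
  then obtain r where r: "r \<in> S" "f r = r" by blast
  have "r + r - r * r = x"
    using arg_cong[OF r(2), of "\<lambda>t. 2 *\<^sub>R t"] by (simp add: f_def scaleR_2 diff_eq_eq)
  with r(1)[unfolded S_iff] that show ?thesis by blast
qed

lemma norm_one_le: "norm (1::'a::unital_cstar_algebra) \<le> 1"
proof -
  have "norm (1::'a) = 0 \<or> norm (1::'a) = 1"
  proof -
    have "star (1::'a) = star 1 * star (star 1)"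
      by (simp add: star_star)
    hence "star (1::'a) = 1" using star_mult[of "star 1" "1::'a"] by (simp add: star_star)
    thus ?thesis using norm_star_mult_self[of "1::'a"] by (simp add: power2_eq_square)
  qed
  thus ?thesis by auto
qed

lemma star_one [simp]: "star 1 = (1::'a::unital_cstar_algebra)"
  using star_mult[of "star 1" "1::'a"] by (simp add: star_star)

lemma norm_scaleR_one_le: "0 \<le> c \<Longrightarrow> norm (c *\<^sub>R (1::'a::unital_cstar_algebra)) \<le> c"
  using mult_left_mono[OF norm_one_le, of c] by simp

text \<open>
  The element \<open>u = a + \<i> s\<close> is a multiple of a unitary, so its norm is known, and \<open>a\<close> is the
  mean of \<open>u\<close> and \<open>star u\<close>.
\<close>

lemma norm_le_of_sum_of_squares:
  fixes a s :: "'a::unital_cstar_algebra"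
  assumes sa: "star a = a" "star s = s" and comm: "a * s = s * a"
    and sum: "a * a + s * s = c *\<^sub>R 1" and c: "0 \<le> c"
  shows "(norm a)\<^sup>2 \<le> c"
proof -
  define u where "u = a + \<i> *\<^sub>C s"
  have su: "star u = a - \<i> *\<^sub>C s"
    by (simp add: u_def star_add star_scaleC sa flip: scaleC_minus1) (simp add: scaleC_scaleC)
  have "star u * u = a * a + s * s"
    by (subst su)
       (simp add: u_def algebra_simps mult_scaleC_left mult_scaleC_right comm scaleC_scaleC
         scaleC_diff_right scaleC_minus1)
  hence "(norm u)\<^sup>2 \<le> c"
    using norm_scaleR_one_le[OF c] sum by (metis norm_star_mult_self)
  hence u: "norm u \<le> sqrt c" by (simp add: real_le_rsqrt)
  have "a = (1/2) *\<^sub>R (u + star u)"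
    by (subst su) (simp add: u_def flip: scaleR_2)
  also have "norm \<dots> \<le> (1/2) * (norm u + norm (star u))"
    using norm_triangle_ineq[of u "star u"] by simp
  also have "\<dots> \<le> sqrt c" using u by simp
  finally show ?thesis using c by (simp add: real_sqrt_ge_abs1 sqrt_ge_absD)
qed

definition has_inverse :: "'a::monoid_mult \<Rightarrow> bool" where
  "has_inverse x \<longleftrightarrow> (\<exists>y. x * y = 1 \<and> y * x = 1)"

lemma has_inverse_mult: "has_inverse x \<Longrightarrow> has_inverse y \<Longrightarrow> has_inverse (x * y)"
  unfolding has_inverse_def by (metis mult.assoc mult_1_left)

lemma has_inverse_factor:
  assumes "has_inverse (x * y)" "x * y = y * x"
  shows "has_inverse x"
proof -
  obtain w where w: "x * y * w = 1" "w * (x * y) = 1" using assms by (auto simp: has_inverse_def)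
  have "x * (y * w) = 1" "w * y * x = 1"
    using w assms(2) by (metis mult.assoc)+
  moreover from this have "w * y = y * w" by (metis mult.assoc mult_1_left mult_1_right)
  ultimately show ?thesis by (auto simp: has_inverse_def)
qed

lemma has_inverse_scaleC:
  fixes x :: "'a::unital_cstar_algebra"
  assumes "has_inverse x" "c \<noteq> 0"
  shows "has_inverse (c *\<^sub>C x)"
proof -
  obtain y where "x * y = 1" "y * x = 1" using assms by (auto simp: has_inverse_def)
  hence "(c *\<^sub>C x) * ((1 / c) *\<^sub>C y) = 1" "((1 / c) *\<^sub>C y) * (c *\<^sub>C x) = 1"
    using assms(2) by (simp_all add: mult_scaleC_left mult_scaleC_right scaleC_scaleC)
  thus ?thesis by (auto simp: has_inverse_def)
qed

text \<open>The two one-sided inverses are fixed points of the contractions \<open>1 + z y\<close> and \<open>1 + y z\<close>.\<close>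

lemma has_inverse_one_minus:
  fixes z :: "'a::unital_cstar_algebra"
  assumes "norm z < 1"
  shows "has_inverse (1 - z)"
proof -
  have "\<exists>!y. 1 + z * y = y"
  proof (rule banach_fix_type[where c = "norm z"])
    show "\<forall>x y. dist (1 + z * x) (1 + z * y) \<le> norm z * dist x y"
      by (simp add: dist_norm norm_mult_ineq flip: right_diff_distrib)
  qed (use assms in auto)
  then obtain y where y: "1 + z * y = y" by blast
  have "\<exists>!y. 1 + y * z = y"
  proof (rule banach_fix_type[where c = "norm z"])
    show "\<forall>x y. dist (1 + x * z) (1 + y * z) \<le> norm z * dist x y"
      using norm_mult_ineq[of "_ - _" z]
      by (simp add: dist_norm mult.commute flip: left_diff_distrib)
  qed (use assms in auto)
  then obtain w where w: "1 + w * z = w" by blast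
  have "(1 - z) * y = 1" "w * (1 - z) = 1"
    using y w by (simp_all add: algebra_simps)
  moreover from this have "w = y" by (metis mult.assoc mult_1_left mult_1_right)
  ultimately show ?thesis by (auto simp: has_inverse_def)
qed

lemma square_root_one_minus:
  fixes x :: "'a::unital_cstar_algebra"
  assumes "star x = x" "norm x < 1"
  obtains s where "star s = s" "s * s = 1 - x" "\<And>y. x * y = y * x \<Longrightarrow> s * y = y * s"
proof -
  obtain r where r: "star r = r" "r + r - r * r = x" "\<And>y. x * y = y * x \<Longrightarrow> r * y = y * r"
    using quasi_square_root[OF cstar_subalgebra_UNIV _ assms] by (metis UNIV_I)
  show ?thesis
  proof (rule that[of "1 - r"])
    show "(1 - r) * (1 - r) = 1 - x" by (simp add: r(2)[symmetric] algebra_simps)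
    show "(1 - r) * y = y * (1 - r)" if "x * y = y * x" for y
      using r(3)[OF that] by (simp add: left_diff_distrib right_diff_distrib)
  qed (simp add: star_diff r(1))
qed

lemma norm_one_minus_square_le:
  fixes a :: "'a::unital_cstar_algebra"
  assumes "star a = a" "norm a < 1"
  shows "norm (1 - a * a) \<le> 1"
proof -
  have "norm (a * a) \<le> norm a * norm a" by (rule norm_mult_ineq)
  also have "\<dots> < 1" using assms(2) mult_strict_mono[of "norm a" 1 "norm a" 1] by auto
  finally obtain s where s: "star s = s" "s * s = 1 - a * a"
    "\<And>y. a * a * y = y * (a * a) \<Longrightarrow> s * y = y * s"
    using square_root_one_minus[of "a * a"] assms(1) by (metis star_mult)
  have "(norm s)\<^sup>2 \<le> 1"
  proof (rule norm_le_of_sum_of_squares[of s a])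
    show "s * a = a * s" by (rule s(3)) (simp add: mult.assoc)
  qed (simp_all add: assms s)
  moreover have "norm (1 - a * a) = (norm s)\<^sup>2"
    using s(1,2) norm_star_mult_self[of s] by simp
  ultimately show ?thesis by simp
qed

text \<open>
  With \<open>a = k / N\<close> for large \<open>N\<close>, the element \<open>1 + k\<^sup>2\<close> is \<open>1 + N\<^sup>2\<close> times \<open>1 - z\<close>, where
  \<open>z\<close> is \<open>1 - a\<^sup>2\<close> scaled by a factor below 1.
\<close>

lemma has_inverse_one_plus_square:
  fixes k :: "'a::unital_cstar_algebra"
  assumes k: "star k = k"
  shows "has_inverse (1 + k * k)"
proof -
  define N where "N = norm k + 1"
  have N: "N > norm k" "N > 0" by (auto simp: N_def add_nonneg_pos)
  define a where "a = (1 / N) *\<^sub>R k"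
  define z where "z = (N\<^sup>2 / (1 + N\<^sup>2)) *\<^sub>R (1 - a * a)"
  have "norm (1 - a * a) \<le> 1"
    using k N by (intro norm_one_minus_square_le) (auto simp: a_def star_scaleR)
  hence "norm z \<le> N\<^sup>2 / (1 + N\<^sup>2) * 1"
    unfolding z_def norm_scaleR by (intro mult_mono) auto
  also have "\<dots> < 1" by (simp add: add_pos_nonneg)
  finally have "has_inverse (complex_of_real (1 + N\<^sup>2) *\<^sub>C (1 - z))"
  proof (intro has_inverse_scaleC has_inverse_one_minus)
    have "1 + N\<^sup>2 \<noteq> 0" using zero_le_power2[of N] by linarith
    thus "complex_of_real (1 + N\<^sup>2) \<noteq> 0" by (simp only: of_real_eq_0_iff not_False_eq_True)
  qed
  also have "complex_of_real (1 + N\<^sup>2) *\<^sub>C (1 - z) = 1 + k * k"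
  proof -
    have "(1 + N\<^sup>2) *\<^sub>R z = N\<^sup>2 *\<^sub>R (1 - a * a)"
      by (simp add: z_def add_nonneg_eq_0_iff)
    hence "(1 + N\<^sup>2) *\<^sub>R (1 - z) = 1 + N\<^sup>2 *\<^sub>R (a * a)"
      unfolding scaleR_right_diff_distrib by (simp add: scaleR_left_distrib scaleR_right_diff_distrib)
    moreover have "N\<^sup>2 *\<^sub>R (a * a) = k * k"
      using N by (simp add: a_def power2_eq_square)
    ultimately show ?thesis unfolding scaleR_scaleC[symmetric] by simp
  qed
  finally show ?thesis .
qed

text \<open>
  Real \<open>\<mu>\<close> off the interval have modulus above the norm of \<open>h\<close>. For the others, \<open>h - \<mu>\<close> is a multiple of
  \<open>k - \<i>\<close> with self-adjoint \<open>k\<close>, a factor of \<open>1 + k\<^sup>2\<close>.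
\<close>

lemma has_inverse_off_interval:
  fixes h :: "'a::unital_cstar_algebra"
  assumes h: "star h = h" "norm h \<le> 1" and \<mu>: "\<mu> \<notin> complex_of_real ` {-1..1}"
  shows "has_inverse (h - \<mu> *\<^sub>C 1)"
proof (cases "Im \<mu> = 0")
  case True
  hence \<mu>': "\<mu> = of_real (Re \<mu>)" by (simp add: complex_eq_iff)
  hence "cmod \<mu> > 1" using \<mu> by (metis abs_le_iff atLeastAtMost_iff image_eqI minus_le_iff norm_of_real not_le)
  hence "norm ((1 / \<mu>) *\<^sub>C h) < 1"
    using h(2) unfolding norm_scaleC norm_divide by (simp add: divide_less_eq)
  hence "has_inverse ((- \<mu>) *\<^sub>C (1 - (1 / \<mu>) *\<^sub>C h))"
    using \<open>cmod \<mu> > 1\<close> by (intro has_inverse_scaleC has_inverse_one_minus) auto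
  also have "(- \<mu>) *\<^sub>C (1 - (1 / \<mu>) *\<^sub>C h) = h - \<mu> *\<^sub>C 1"
    using \<open>cmod \<mu> > 1\<close> by (auto simp: scaleC_diff_right scaleC_scaleC scaleC_minus_left)
  finally show ?thesis .
next
  case False
  define b where "b = Im \<mu>"
  define k where "k = (1 / b) *\<^sub>R (h - Re \<mu> *\<^sub>R 1)"
  have b: "b \<noteq> 0" using False by (simp add: b_def)
  have "star k = k" by (simp add: k_def star_scaleR star_diff h)
  have f: "(k - \<i> *\<^sub>C 1) * (k + \<i> *\<^sub>C 1) = 1 + k * k" "(k + \<i> *\<^sub>C 1) * (k - \<i> *\<^sub>C 1) = 1 + k * k"
    by (simp_all add: algebra_simps mult_scaleC_left mult_scaleC_right scaleC_scaleC scaleC_minus1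
        scaleC_add_right scaleC_diff_right)
  have "has_inverse (k - \<i> *\<^sub>C 1)"
    by (rule has_inverse_factor[where y = "k + \<i> *\<^sub>C 1"])
       (simp_all add: f has_inverse_one_plus_square \<open>star k = k\<close>)
  hence "has_inverse (complex_of_real b *\<^sub>C (k - \<i> *\<^sub>C 1))"
    by (rule has_inverse_scaleC) (use b in simp)
  also have "complex_of_real b *\<^sub>C (k - \<i> *\<^sub>C 1) = h - Re \<mu> *\<^sub>R 1 - (\<i> * complex_of_real b) *\<^sub>C 1"
    using b by (simp add: scaleC_diff_right scaleC_scaleC k_def mult.commute flip: scaleR_scaleC)
  also have "\<dots> = h - \<mu> *\<^sub>C 1"
    using scaleC_add_left[of "of_real (Re \<mu>)" "\<i> * of_real b" "1::'a"]
    by (simp add: scaleR_scaleC b_def flip: complex_eq)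
  finally show ?thesis .
qed

text \<open>
  The spectral radius of a self-adjoint element is its norm. If \<open>1 - x\<^sup>2\<close> had an
  inverse, then so would \<open>1 - \<delta> x\<^sup>2\<close> for \<open>\<delta> < 1\<close> close to 1, with inverses bounded
  independently of \<open>\<delta>\<close>. Then a fixed \<open>\<epsilon>\<close> could be subtracted from
  \<open>1 - \<delta> x\<^sup>2\<close> such that a square remains, and \<open>norm x < 1\<close> would follow.
\<close>

lemma not_has_inverse_one_minus_square:
  fixes x :: "'a::unital_cstar_algebra"
  assumes x: "star x = x" "norm x = 1"
  shows "\<not> has_inverse (1 - x * x)"
proof
  assume "has_inverse (1 - x * x)"
  then obtain c where c: "(1 - x * x) * c = 1" "c * (1 - x * x) = 1"
    by (auto simp: has_inverse_def)
  define K where "K = norm c + 1"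
  have K: "norm c \<le> K" "K \<ge> 1" by (auto simp: K_def)
  define \<delta> where "\<delta> = 1 - 1 / (8 * K)"
  define \<epsilon> where "\<epsilon> = 1 / (4 * K)"
  have \<delta>: "0 < \<delta>" "\<delta> < 1" "1 - \<delta> < \<epsilon>" "(1 - \<delta>) * K \<le> 1 / 2" "\<epsilon> \<le> 1 / 4"
    using K by (auto simp: \<delta>_def \<epsilon>_def field_simps)
  have nxx: "norm (x * x) = 1" using norm_star_mult_self[of x] x by simp
  have n\<delta>: "norm (\<delta> *\<^sub>R (x * x)) < 1" using \<delta> nxx by simp
  have s\<delta>: "star (\<delta> *\<^sub>R (x * x)) = \<delta> *\<^sub>R (x * x)" by (simp add: star_scaleR star_mult x)
  obtain d where d: "(1 - \<delta> *\<^sub>R (x * x)) * d = 1" "d * (1 - \<delta> *\<^sub>R (x * x)) = 1"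
    using has_inverse_one_minus[OF n\<delta>] by (auto simp: has_inverse_def)
  have sd: "star d = d"
  proof -
    have "star d * (1 - \<delta> *\<^sub>R (x * x)) = 1"
      using arg_cong[OF d(1), of star] s\<delta> by (simp add: star_mult star_diff)
    thus ?thesis using d by (metis mult.assoc mult_1_left mult_1_right)
  qed
  have comm: "x * x * d = d * (x * x)"
  proof -
    have "(1 - \<delta> *\<^sub>R (x * x)) * (x * x) = x * x * (1 - \<delta> *\<^sub>R (x * x))"
      by (simp add: algebra_simps)
    thus ?thesis by (metis d mult.assoc mult_1_left mult_1_right)
  qed
  have "norm d \<le> 2 * K"
  proof -
    have "d = c - (1 - \<delta>) *\<^sub>R (c * (x * x) * d)"
    proof -
      have "(1 - x * x) * d = 1 - (1 - \<delta>) *\<^sub>R (x * x * d)"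
        using d(1) by (simp add: algebra_simps)
      hence "c * ((1 - x * x) * d) = c * (1 - (1 - \<delta>) *\<^sub>R (x * x * d))"
        by (simp only:)
      also have "\<dots> = c - (1 - \<delta>) *\<^sub>R (c * (x * x) * d)"
        by (simp add: right_diff_distrib mult.assoc)
      finally have "c * ((1 - x * x) * d) = c - (1 - \<delta>) *\<^sub>R (c * (x * x) * d)" .
      thus ?thesis by (simp add: c(2) flip: mult.assoc)
    qed
    also have "norm \<dots> \<le> norm c + (1 - \<delta>) * (norm c * 1 * norm d)"
    proof (rule norm_triangle_le_diff, rule add_mono)
      have "norm (c * (x * x) * d) \<le> norm c * norm (x * x) * norm d"
        by (rule order_trans[OF norm_mult_ineq]) (intro mult_right_mono norm_mult_ineq norm_ge_zero)
      thus "norm ((1 - \<delta>) *\<^sub>R (c * (x * x) * d)) \<le> (1 - \<delta>) * (norm c * 1 * norm d)"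
        using \<delta> nxx by (simp add: mult_left_mono)
    qed simp
    also have "\<dots> \<le> K + ((1 - \<delta>) * K) * norm d"
      using K \<delta> by (intro add_mono) (auto simp: mult.assoc intro!: mult_left_mono mult_right_mono)
    also have "\<dots> \<le> K + (1 / 2) * norm d"
      using \<delta> by (intro add_left_mono mult_right_mono) auto
    finally show ?thesis by simp
  qed
  hence "norm (\<epsilon> *\<^sub>R d) < 1" using K by (simp add: \<epsilon>_def field_simps)
  then obtain q where q: "star q = q" "q * q = 1 - \<epsilon> *\<^sub>R d"
    "\<And>y. \<epsilon> *\<^sub>R d * y = y * \<epsilon> *\<^sub>R d \<Longrightarrow> q * y = y * q"
    using square_root_one_minus[of "\<epsilon> *\<^sub>R d"] by (metis star_scaleR sd)
  obtain s where s: "star s = s" "s * s = 1 - \<delta> *\<^sub>R (x * x)"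
    "\<And>y. \<delta> *\<^sub>R (x * x) * y = y * \<delta> *\<^sub>R (x * x) \<Longrightarrow> s * y = y * s"
    using square_root_one_minus[OF s\<delta> n\<delta>] by metis
  have qxx: "q * (x * x) = x * x * q"
    by (rule q(3)) (simp add: comm)
  have sq: "s * q = q * s" by (rule s(3)) (simp add: qxx)
  have sx: "s * x = x * s" by (rule s(3)) (simp add: mult.assoc)
  have dx: "d * x = x * d"
  proof -
    have "(1 - \<delta> *\<^sub>R (x * x)) * x = x * (1 - \<delta> *\<^sub>R (x * x))"
      by (simp add: algebra_simps)
    thus ?thesis by (metis d mult.assoc mult_1_left mult_1_right)
  qed
  have qx: "q * x = x * q" by (rule q(3)) (simp add: dx)
  have "(norm (sqrt \<delta> *\<^sub>R x))\<^sup>2 \<le> 1 - \<epsilon>"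
  proof (rule norm_le_of_sum_of_squares[where s = "s * q"])
    have "(s * q) * (s * q) = (s * s) * (q * q)" by (metis sq mult.assoc)
    also have "\<dots> = 1 - \<delta> *\<^sub>R (x * x) - \<epsilon> *\<^sub>R 1"
      using d(1) by (simp add: s(2) q(2) right_diff_distrib)
    finally show "sqrt \<delta> *\<^sub>R x * (sqrt \<delta> *\<^sub>R x) + s * q * (s * q) = (1 - \<epsilon>) *\<^sub>R 1"
      using \<delta> by (simp add: algebra_simps)
    show "sqrt \<delta> *\<^sub>R x * (s * q) = s * q * sqrt \<delta> *\<^sub>R x"
      by (simp add: mult.assoc qx) (simp add: sx flip: mult.assoc)
  qed (use \<delta> in \<open>auto simp: star_scaleR star_mult x(1) q(1) s(1) sq\<close>)
  thus False using x \<delta> by simp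
qed

section \<open>Functional calculus for self-adjoint elements\<close>

text \<open>
  Horner evaluation of a complex polynomial. The evaluation \<open>poly\<close> would demand commutative
  multiplication.
\<close>

definition poly_at :: "'a::unital_cstar_algebra \<Rightarrow> complex poly \<Rightarrow> 'a" where
  "poly_at h p = fold_coeffs (\<lambda>a y. a *\<^sub>C 1 + h * y) p 0"

lemma poly_at_0 [simp]: "poly_at h 0 = 0"
  by (simp add: poly_at_def)

lemma poly_at_pCons [simp]: "poly_at h (pCons a p) = a *\<^sub>C 1 + h * poly_at h p"
  by (cases "a = 0 \<and> p = 0") (auto simp: poly_at_def)

lemma poly_at_add [simp]: "poly_at h (p + q) = poly_at h p + poly_at h q"
  by (induction p q rule: poly_induct2) (simp_all add: scaleC_add_left algebra_simps)

lemma poly_at_smult [simp]: "poly_at h (smult c p) = c *\<^sub>C poly_at h p"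
  by (induction p) (simp_all add: scaleC_add_right scaleC_scaleC mult_scaleC_right)

lemma poly_at_diff [simp]: "poly_at h (p - q) = poly_at h p - poly_at h q"
  using poly_at_add[of h p "smult (-1) q"] by (simp only: poly_at_smult) (simp add: scaleC_minus1)

lemma poly_at_commute: "h * y = y * h \<Longrightarrow> poly_at h p * y = y * poly_at h p"
  by (induction p) (simp_all add: algebra_simps mult_scaleC_left mult_scaleC_right, metis mult.assoc)

lemma poly_at_mult [simp]: "poly_at h (p * q) = poly_at h p * poly_at h q"
  by (induction p) (simp_all add: mult_scaleC_left distrib_right mult.assoc)

lemma poly_at_1 [simp]: "poly_at h 1 = 1"
  by (simp add: one_pCons)

lemma poly_at_power [simp]: "poly_at h (p ^ n) = poly_at h p ^ n"
  by (induction n) simp_all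

lemma star_poly_at: "star h = h \<Longrightarrow> star (poly_at h p) = poly_at h (map_poly cnj p)"
  by (induction p)
     (simp_all add: map_poly_pCons star_add star_scaleC star_mult poly_at_commute)

lemma has_inverse_poly_at:
  fixes h :: "'a::unital_cstar_algebra"
  assumes h: "star h = h" "norm h \<le> 1" and p: "\<And>t. t \<in> {-1..1} \<Longrightarrow> poly p (of_real t) \<noteq> 0"
  shows "has_inverse (poly_at h p)"
proof -
  have "p \<noteq> 0" using p[of 0] by auto
  then obtain A where A: "p = smult (lead_coeff p) (\<Prod>x\<in>#A. [:-x, 1:])"
    using alg_closed_imp_factorization[OF \<open>p \<noteq> 0\<close>] by (elim exE conjE) (rule that)
  have notin: "x \<notin> complex_of_real ` {-1..1}" if "x \<in># A" for x
  proof
    assume "x \<in> complex_of_real ` {-1..1}"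
    moreover have "poly p x = 0"
      using that by (subst A) (auto simp: poly_prod_mset prod_mset_zero_iff)
    ultimately show False using p by auto
  qed
  have "has_inverse (poly_at h (\<Prod>x\<in>#A. [:-x, 1:]))"
    using notin
  proof (induction A)
    case empty
    have "has_inverse (1::'a)" by (auto simp: has_inverse_def)
    thus ?case by simp
  next
    case (add x A)
    have "(- x) *\<^sub>C 1 + h = h - x *\<^sub>C 1"
      by (simp add: scaleC_minus_left)
    hence "has_inverse (poly_at h [:-x, 1:])"
      using has_inverse_off_interval[OF h, of x] add.prems by simp
    moreover have "has_inverse (poly_at h (\<Prod>x\<in>#A. [:-x, 1:]))" using add by simp
    ultimately show ?case
      unfolding image_mset_add_mset prod_mset.add_mset poly_at_mult by (rule has_inverse_mult)
  qed
  thus ?thesis using \<open>p \<noteq> 0\<close> by (subst A) (simp add: has_inverse_scaleC)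
qed

text \<open>
  The self-adjoint element \<open>y = star p(h) * p(h)\<close> has norm \<open>N = (norm p(h))\<^sup>2\<close>, so
  \<open>1 - (y / N)\<^sup>2\<close> has no inverse. But if \<open>N\<close> exceeded \<open>M\<^sup>2\<close>, then this would be a polynomial
  in \<open>h\<close> without zeros in the interval.
\<close>

theorem norm_poly_at_le:
  fixes h :: "'a::unital_cstar_algebra"
  assumes h: "star h = h" "norm h \<le> 1"
    and M: "\<And>t. t \<in> {-1..1} \<Longrightarrow> cmod (poly p (of_real t)) \<le> M"
  shows "norm (poly_at h p) \<le> M"
proof (rule ccontr)
  assume "\<not> ?thesis"
  hence gt: "norm (poly_at h p) > M" by simp
  have M0: "M \<ge> 0" using M[of 0] order_trans[OF norm_ge_zero] by auto
  define N where "N = (norm (poly_at h p))\<^sup>2"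
  define q where "q = map_poly cnj p * p"
  define y where "y = poly_at h q"
  have N: "N > M\<^sup>2" "N > 0"
    using gt M0 by (auto simp: N_def power_strict_mono)
  have y: "y = star (poly_at h p) * poly_at h p"
    by (simp add: y_def q_def star_poly_at h)
  hence "star y = y" "norm y = N"
    by (simp_all add: star_mult star_star N_def norm_star_mult_self)
  hence "\<not> has_inverse (1 - ((1 / N) *\<^sub>R y) * ((1 / N) *\<^sub>R y))"
    using N by (intro not_has_inverse_one_minus_square) (auto simp: star_scaleR)
  moreover have "has_inverse (poly_at h (1 - smult (of_real (1 / N\<^sup>2)) (q * q)))"
  proof (rule has_inverse_poly_at[OF h])
    fix t :: real assume t: "t \<in> {-1..1}"
    have "poly q (of_real t) = cnj (poly p (of_real t)) * poly p (of_real t)"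
      unfolding q_def poly_mult poly_cnj complex_cnj_complex_of_real ..
    hence "cmod (poly q (of_real t)) = (cmod (poly p (of_real t)))\<^sup>2"
      by (simp add: norm_mult power2_eq_square)
    also have "\<dots> \<le> M\<^sup>2" using M[OF t] by (intro power_mono) auto
    finally have "cmod (poly q (of_real t)) < N" using N by simp
    hence "cmod (poly q (of_real t) * poly q (of_real t)) < N\<^sup>2"
      by (auto simp: norm_mult power2_eq_square intro!: mult_strict_mono')
    hence "cmod (of_real (1 / N\<^sup>2) * (poly q (of_real t) * poly q (of_real t))) < 1"
      using N by (simp add: norm_mult norm_divide norm_power field_simps)
    thus "poly (1 - smult (of_real (1 / N\<^sup>2)) (q * q)) (of_real t) \<noteq> 0" by auto
  qed
  moreover have "poly_at h (1 - smult (of_real (1 / N\<^sup>2)) (q * q)) = 1 - ((1 / N) *\<^sub>R y) * ((1 / N) *\<^sub>R y)"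
    by (simp add: y_def power2_eq_square scaleR_scaleC mult_scaleC_left mult_scaleC_right scaleC_scaleC)
  ultimately show False by simp
qed

section \<open>Approximate units and *-homomorphisms\<close>

lemma multiplier_of_eq_iff [simp]: "multiplier_of x = multiplier_of y \<longleftrightarrow> x = y"
  using norm_multiplier_of[of "x - y"] by (auto simp: multiplier_of_diff)

lemma star_power: "star (x ^ n) = star (x::'a::unital_cstar_algebra) ^ n"
  by (induction n) (simp_all add: star_mult power_commutes)

lemma poly_at_mem_subalgebra:
  fixes h :: "'a::cstar_algebra"
  assumes B: "cstar_subalgebra B" and h: "h \<in> B" and p: "poly p 0 = 0"
  obtains u where "u \<in> B" "multiplier_of u = poly_at (multiplier_of h) p"
proof -
  note BD = cstar_subalgebraD[OF B]
  note VD = complex_subspaceD[OF BD(1)]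
  have "\<exists>u\<in>B. multiplier_of u = multiplier_of h * poly_at (multiplier_of h) q" for q
  proof (induction q)
    case 0
    have "multiplier_of 0 = (0::'a multiplier)" using multiplier_of_diff[of 0 0] by simp
    thus ?case using VD(1) by auto
  next
    case (pCons a q)
    then obtain u where u: "u \<in> B" "multiplier_of u = multiplier_of h * poly_at (multiplier_of h) q"
      by blast
    have "a *\<^sub>C h + h * u \<in> B" by (intro VD(2,3) BD(3) h u(1))
    moreover have "multiplier_of (a *\<^sub>C h + h * u)
        = multiplier_of h * poly_at (multiplier_of h) (pCons a q)"
      by (simp add: multiplier_of_simps u(2) distrib_left mult_scaleC_right)
    ultimately show ?case by blast
  qed
  moreover obtain q where "p = pCons 0 q" using p by (cases p) auto
  ultimately show ?thesis using that by auto
qed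

text \<open>By the inequality of Bernoulli, \<open>n s \<le> (1 + s)\<^sup>n\<close>.\<close>

lemma mult_power_one_minus_le:
  fixes s :: real
  assumes "0 \<le> s" "s \<le> 1"
  shows "real n * (s * (1 - s) ^ n) \<le> 1"
proof -
  have "real n * (s * (1 - s) ^ n) \<le> (1 + s) ^ n * (1 - s) ^ n"
  proof -
    have "real n * s \<le> (1 + s) ^ n"
      using Bernoulli_inequality[of s n] assms by simp
    thus ?thesis using assms mult_right_mono[of "real n * s" "(1 + s) ^ n" "(1 - s) ^ n"]
      by (simp add: mult_ac)
  qed
  also have "\<dots> = (1 - s * s) ^ n" by (simp add: algebra_simps flip: power_mult_distrib)
  also have "\<dots> \<le> 1" using assms by (intro power_le_one) (auto simp: mult_le_one)
  finally show ?thesis .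
qed

text \<open>
  The approximate unit is built from \<open>h = star x * x\<close> alone: up to scaling it is
  \<open>u = 1 - (1 - h\<^sup>2)\<^sup>n\<close> for large \<open>n\<close>, so it lies in every C*-subalgebra that
  contains \<open>h\<close>. The last conclusion says that the multiplier \<open>1 - u\<close> is a contraction.
\<close>

lemma approximate_right_unit:
  fixes x :: "'a::cstar_algebra"
  assumes B: "cstar_subalgebra B" and x: "star x * x \<in> B" and e: "e > 0"
  obtains u where "u \<in> B" "star u = u" "norm (x - x * u) < e"
    "\<And>z. norm (z - z * u) \<le> norm z"
proof -
  define c where "c = 1 / ((norm x)\<^sup>2 + 1)"
  have c: "c > 0" by (auto simp: c_def add_nonneg_pos)
  define h where "h = c *\<^sub>R (star x * x)"
  define H where "H = multiplier_of h"
  have hB: "h \<in> B" using x complex_subspaceD(5)[OF cstar_subalgebraD(1)[OF B]] by (simp add: h_def)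
  have sH: "star H = H"
    by (simp add: H_def h_def star_scaleR star_mult star_star flip: multiplier_of_star)
  have nH: "norm H \<le> 1"
    by (simp add: H_def h_def norm_star_mult_self c_def add_nonneg_pos divide_le_eq)
  define d where "d = c * e\<^sup>2 / 2"
  have d: "d > 0" using c e by (simp add: d_def)
  obtain n :: nat where n: "1 / d\<^sup>2 < real n" using reals_Archimedean2 by blast
  hence n0: "real n > 0" using d by (meson less_trans zero_less_divide_1_iff zero_less_power)
  define Q :: "complex poly" where "Q = [:1, 0, -1:] ^ n"
  have polyQ: "poly Q (of_real t) = of_real ((1 - t\<^sup>2) ^ n)" for t
    by (simp add: Q_def power2_eq_square)
  define W where "W = poly_at H Q"
  have "poly (1 - Q) 0 = 0" by (simp add: Q_def)
  then obtain u where u: "u \<in> B" "multiplier_of u = poly_at H (1 - Q)"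
    using poly_at_mem_subalgebra[OF B hB, of "1 - Q"] unfolding H_def by metis
  have u': "multiplier_of u = 1 - W" using u(2) by (simp add: W_def)
  have W: "W = (1 - H * H) ^ n"
    by (simp add: W_def Q_def scaleC_minus1)
  have sW: "star W = W" by (simp add: W star_power star_diff star_mult sH)
  have t2: "0 \<le> 1 - t\<^sup>2" "1 - t\<^sup>2 \<le> 1" if "t \<in> {-1..1}" for t :: real
    using that by (auto simp: abs_square_le_1 abs_le_iff)
  have nW: "norm W \<le> 1"
    unfolding W_def
  proof (rule norm_poly_at_le[OF sH nH])
    fix t :: real assume "t \<in> {-1..1}"
    thus "cmod (poly Q (of_real t)) \<le> 1"
      unfolding polyQ using t2[of t] by (simp add: power_le_one norm_power del: of_real_power of_real_diff)
  qed
  have nz: "norm (z - z * u) \<le> norm z" for z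
  proof -
    have "norm (z - z * u) = norm (multiplier_of (z - z * u))" by simp
    also have "multiplier_of (z - z * u) = multiplier_of z * W"
      by (simp add: multiplier_of_simps u' algebra_simps)
    also have "norm \<dots> \<le> norm z * 1"
      using norm_mult_ineq[of "multiplier_of z" W] mult_left_mono[OF nW, of "norm z"] by simp
    finally show ?thesis by simp
  qed
  have "c * (norm (x - x * u))\<^sup>2 = norm (poly_at H (Q * [:0, 1:] * Q))"
  proof -
    have "multiplier_of (x - x * u) = multiplier_of x * W"
      by (simp add: multiplier_of_simps u' algebra_simps)
    hence "(norm (x - x * u))\<^sup>2 = norm (star (multiplier_of x * W) * (multiplier_of x * W))"
      by (metis norm_multiplier_of norm_star_mult_self)
    also have "\<dots> = norm (W * multiplier_of (star x * x) * W)"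
      by (simp add: star_mult sW multiplier_of_simps mult.assoc)
    finally have "c * (norm (x - x * u))\<^sup>2 = norm (W * (c *\<^sub>R multiplier_of (star x * x)) * W)"
      using c by simp
    also have "c *\<^sub>R multiplier_of (star x * x) = H"
      by (simp add: H_def h_def multiplier_of_scaleR)
    also have "W * H * W = poly_at H (Q * [:0, 1:] * Q)"
      unfolding poly_at_mult W_def by simp
    finally show ?thesis .
  qed
  also have "\<dots> \<le> d"
  proof (rule norm_poly_at_le[OF sH nH])
    fix t :: real assume t: "t \<in> {-1..1}"
    define b where "b = \<bar>t\<bar> * (1 - t\<^sup>2) ^ (2 * n)"
    have b0: "b \<ge> 0" using t2[OF t] by (simp add: b_def)
    have "b\<^sup>2 \<le> t\<^sup>2 * (1 - t\<^sup>2) ^ n"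
    proof -
      have "((1 - t\<^sup>2) ^ (2 * n))\<^sup>2 = (1 - t\<^sup>2) ^ (4 * n)" by (simp flip: power_mult)
      also have "\<dots> \<le> (1 - t\<^sup>2) ^ n" using t2[OF t] by (intro power_decreasing) auto
      finally show ?thesis by (simp add: b_def power_mult_distrib mult_left_mono)
    qed
    hence "real n * b\<^sup>2 \<le> 1"
      using mult_power_one_minus_le[of "t\<^sup>2" n] t2[OF t] n0
      by (smt (verit) mult_left_mono zero_le_power2)
    hence "b\<^sup>2 \<le> d\<^sup>2" using n n0 d by (smt (verit, ccfv_SIG) divide_less_eq mult.commute mult_less_cancel_left_pos zero_less_power)
    hence "b \<le> d" by (rule power2_le_imp_le) (use d in simp)
    moreover have "cmod (poly (Q * [:0, 1:] * Q) (of_real t)) = b"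
    proof -
      have "poly (Q * [:0, 1:] * Q) (of_real t) = of_real (t * (1 - t\<^sup>2) ^ (2 * n))"
        by (simp only: poly_mult polyQ) (simp add: mult_2 power_add)
      hence "cmod (poly (Q * [:0, 1:] * Q) (of_real t)) = \<bar>t * (1 - t\<^sup>2) ^ (2 * n)\<bar>"
        by (simp only: norm_of_real)
      thus ?thesis using t2[OF t] by (simp add: b_def abs_mult)
    qed
    ultimately show "cmod (poly (Q * [:0, 1:] * Q) (of_real t)) \<le> d" by simp
  qed
  also have "\<dots> < c * e\<^sup>2" using c e by (simp add: d_def)
  finally have "norm (x - x * u) < e" using c e by (simp add: power2_less_imp_less)
  moreover have "star u = u"
    using u' sW by (metis multiplier_of_eq_iff multiplier_of_star star_diff star_one)
  ultimately show ?thesis using that u(1) nz by blast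
qed

text \<open>
  A *-homomorphism preserves the algebraic relation between a self-adjoint \<open>h\<close> of norm below 1
  and the square root of \<open>1 - h\<^sup>2\<close>, and that relation in turn bounds the norm.
\<close>

lemma norm_star_automorphism_le:
  fixes f :: "'a::cstar_algebra \<Rightarrow> 'a"
  assumes f: "star_automorphism f"
  shows "norm (f x) \<le> norm x"
proof -
  have fs: "f (x + y) = f x + f y" "f (c *\<^sub>C x) = c *\<^sub>C f x" "f (x * y) = f x * f y"
    "f (star x) = star (f x)" for x y c
    using f by (auto simp: star_automorphism_def)
  have fR: "f (r *\<^sub>R x) = r *\<^sub>R f x" for r x by (simp add: scaleR_scaleC fs)
  have fd: "f (x - y) = f x - f y" for x y
    using fs(1)[of "x - y" y] by (simp add: eq_diff_eq)
  have lt1: "norm (f h) \<le> 1" if h: "star h = h" "norm h < 1" for h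
  proof -
    have "norm (h * h) \<le> norm h * norm h" by (rule norm_mult_ineq)
    also have "\<dots> < 1" using h(2) mult_strict_mono[of "norm h" 1 "norm h" 1] by auto
    finally obtain r where r: "star r = r" "r + r - r * r = h * h"
        "\<And>y. h * h * y = y * (h * h) \<Longrightarrow> r * y = y * r"
      using quasi_square_root[OF cstar_subalgebra_UNIV, of "h * h"] h(1)
      by (metis UNIV_I star_mult)
    have "f (r + r - r * r) = f (h * h)" by (simp only: r(2))
    hence eq: "f r + f r - f r * f r = f h * f h" by (simp add: fs fd)
    have comm: "f r * f h = f h * f r"
      using r(3)[of h] by (simp add: mult.assoc flip: fs(3))
    let ?a = "multiplier_of (f h)" and ?s = "1 - multiplier_of (f r)"
    have "(norm ?a)\<^sup>2 \<le> 1"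
    proof (rule norm_le_of_sum_of_squares)
      show "star ?a = ?a" "star ?s = ?s"
        by (simp_all add: star_diff h(1) r(1) flip: multiplier_of_star fs(4))
      show "?a * ?s = ?s * ?a"
        by (simp add: right_diff_distrib left_diff_distrib comm flip: multiplier_of_mult)
      have "?a * ?a = multiplier_of (f r) + multiplier_of (f r) - multiplier_of (f r) * multiplier_of (f r)"
        by (simp flip: multiplier_of_mult multiplier_of_add multiplier_of_diff eq)
      thus "?a * ?a + ?s * ?s = 1 *\<^sub>R 1" by (simp add: algebra_simps)
    qed simp
    thus ?thesis by (simp add: abs_square_le_1)
  qed
  have sa: "norm (f h) \<le> norm h" if h: "star h = h" for h
  proof (rule dense_ge)
    fix t assume t: "norm h < t"
    hence "t > 0" using norm_ge_zero[of h] by linarith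
    have "norm (f ((1 / t) *\<^sub>R h)) \<le> 1"
      using t \<open>t > 0\<close> h by (intro lt1) (auto simp: star_scaleR)
    thus "norm (f h) \<le> t" using \<open>t > 0\<close> by (simp add: fR divide_le_eq)
  qed
  have "(norm (f x))\<^sup>2 = norm (f (star x * x))"
    by (simp add: fs norm_star_mult_self)
  also have "\<dots> \<le> norm (star x * x)" by (rule sa) (simp add: star_mult star_star)
  finally show ?thesis unfolding norm_star_mult_self by (rule power2_le_imp_le) simp
qed

section \<open>Positivity\<close>

lemma real_Weierstrass_complex_poly:
  assumes f: "continuous_on {-1..1} f" and e: "e > 0"
  obtains p where "\<And>t. t \<in> {-1..1} \<Longrightarrow> cmod (of_real (f t) - poly p (of_real t)) \<le> e"
proof -
  obtain g where g: "real_polynomial_function g" "\<And>t. t \<in> {-1..1} \<Longrightarrow> \<bar>f t - g t\<bar> < e"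
    using Stone_Weierstrass_real_polynomial_function[OF compact_Icc f e] by blast
  then obtain a n where a: "g = (\<lambda>x. \<Sum>i\<le>n. a i * x ^ i)"
    using real_polynomial_function_iff_sum by blast
  define p where "p = (\<Sum>i\<le>n. monom (complex_of_real (a i)) i)"
  have "poly p (of_real t) = of_real (g t)" for t
    by (simp add: p_def a poly_sum poly_monom)
  hence "cmod (of_real (f t) - poly p (of_real t)) = \<bar>f t - g t\<bar>" for t
    by (metis norm_of_real of_real_diff)
  thus ?thesis using that g(2) by (metis less_imp_le)
qed

text \<open>
  The continuous functional calculus on \<open>[-1, 1]\<close>: the element that is as close to each
  polynomial in \<open>h\<close> as the function is to that polynomial.
\<close>

definition approximates :: "'a::unital_cstar_algebra \<Rightarrow> (real \<Rightarrow> real) \<Rightarrow> 'a \<Rightarrow> bool" where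
  "approximates h f y \<longleftrightarrow>
     (\<forall>p e. (\<forall>t\<in>{-1..1}. cmod (of_real (f t) - poly p (of_real t)) \<le> e)
        \<longrightarrow> norm (y - poly_at h p) \<le> e)"

definition cfc :: "'a::unital_cstar_algebra \<Rightarrow> (real \<Rightarrow> real) \<Rightarrow> 'a" where
  "cfc h f = (THE y. approximates h f y)"

context
  fixes h :: "'a::unital_cstar_algebra"
  assumes sa: "star h = h" and le1: "norm h \<le> 1"
begin

lemma approximates_unique:
  assumes f: "continuous_on {-1..1} f" and y: "approximates h f y"
    and z: "\<And>e. e > 0 \<Longrightarrow> \<exists>p. (\<forall>t\<in>{-1..1}. cmod (of_real (f t) - poly p (of_real t)) \<le> e)
      \<and> norm (z - poly_at h p) \<le> e"
  shows "z = y"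
proof -
  have small: "norm (z - y) \<le> e" if e: "e > 0" for e
  proof -
    obtain p where p: "\<forall>t\<in>{-1..1}. cmod (of_real (f t) - poly p (of_real t)) \<le> e / 2"
        "norm (z - poly_at h p) \<le> e / 2"
      using z[of "e / 2"] e by auto
    have "norm (y - poly_at h p) \<le> e / 2" using y p(1) unfolding approximates_def by blast
    thus ?thesis using p(2) norm_triangle_ineq4[of "z - poly_at h p" "y - poly_at h p"] by simp
  qed
  have "norm (z - y) \<le> 0" by (rule field_le_epsilon) (simp add: small)
  thus ?thesis by simp
qed

lemma approximates_cfc:
  assumes f: "continuous_on {-1..1} f"
  shows "approximates h f (cfc h f)"
proof -
  define P where "P n p \<longleftrightarrow> (\<forall>t\<in>{-1..1}. cmod (of_real (f t) - poly p (of_real t)) \<le> inverse (real (Suc n)))"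
    for n p
  have "\<exists>p. P n p" for n
    using real_Weierstrass_complex_poly[OF f, of "inverse (real (Suc n))"] unfolding P_def
    by (metis inverse_positive_iff_positive of_nat_0_less_iff zero_less_Suc)
  then obtain p where p: "\<And>n. P n (p n)" by metis
  have dist: "norm (poly_at h (p n) - poly_at h q) \<le> inverse (real (Suc n)) + e"
    if "\<forall>t\<in>{-1..1}. cmod (of_real (f t) - poly q (of_real t)) \<le> e" for n q e
  proof -
    have "norm (poly_at h (p n - q)) \<le> inverse (real (Suc n)) + e"
    proof (rule norm_poly_at_le[OF sa le1])
      fix t :: real assume t: "t \<in> {-1..1}"
      have "cmod ((of_real (f t) - poly q (of_real t)) - (of_real (f t) - poly (p n) (of_real t)))
          \<le> e + inverse (real (Suc n))"
        by (rule order_trans[OF norm_triangle_ineq4]) (use that p[of n] t in \<open>auto simp: P_def intro!: add_mono\<close>)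
      thus "cmod (poly (p n - q) (of_real t)) \<le> inverse (real (Suc n)) + e"
        by (simp add: algebra_simps)
    qed
    thus ?thesis by simp
  qed
  have "Cauchy (\<lambda>n. poly_at h (p n))"
  proof (rule metric_CauchyI)
    fix e :: real assume "e > 0"
    then obtain N where N: "inverse (real (Suc N)) < e / 2" using reals_Archimedean[of "e / 2"] by auto
    show "\<exists>M. \<forall>m\<ge>M. \<forall>n\<ge>M. dist (poly_at h (p m)) (poly_at h (p n)) < e"
    proof (intro exI allI impI)
      fix m n assume mn: "N \<le> m" "N \<le> n"
      have "norm (poly_at h (p m) - poly_at h (p n)) \<le> inverse (real (Suc m)) + inverse (real (Suc n))"
        using p[of n] by (intro dist) (auto simp: P_def)
      also have "\<dots> \<le> inverse (real (Suc N)) + inverse (real (Suc N))"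
        using mn by (intro add_mono le_imp_inverse_le) auto
      finally show "dist (poly_at h (p m)) (poly_at h (p n)) < e" using N by (simp add: dist_norm)
    qed
  qed
  then obtain y where y: "(\<lambda>n. poly_at h (p n)) \<longlonglongrightarrow> y"
    using Cauchy_convergent convergentD by blast
  have "approximates h f y"
    unfolding approximates_def
  proof (intro allI impI)
    fix q e assume q: "\<forall>t\<in>{-1..1}. cmod (of_real (f t) - poly q (of_real t)) \<le> e"
    show "norm (y - poly_at h q) \<le> e"
    proof (rule LIMSEQ_le)
      show "(\<lambda>n. norm (poly_at h (p n) - poly_at h q)) \<longlonglongrightarrow> norm (y - poly_at h q)"
        by (intro tendsto_intros y)
      show "(\<lambda>n. inverse (real (Suc n)) + e) \<longlonglongrightarrow> e"
        using tendsto_add[OF LIMSEQ_inverse_real_of_nat tendsto_const[of e]] by simp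
    qed (use dist[OF q] in auto)
  qed
  moreover have "z = y" if "approximates h f z" for z
    by (rule approximates_unique[OF f \<open>approximates h f y\<close>])
       (metis real_Weierstrass_complex_poly[OF f] that approximates_def)
  ultimately show ?thesis unfolding cfc_def by (metis theI)
qed

lemma cfc_eqI:
  assumes f: "continuous_on {-1..1} f"
    and "\<And>e. e > 0 \<Longrightarrow> \<exists>p. (\<forall>t\<in>{-1..1}. cmod (of_real (f t) - poly p (of_real t)) \<le> e)
      \<and> norm (z - poly_at h p) \<le> e"
  shows "cfc h f = z"
  using approximates_unique[OF f approximates_cfc[OF f]] assms(2) by metis

lemma cfc_approx:
  assumes f: "continuous_on {-1..1} f" and e: "e > 0"
  obtains p where "\<And>t. t \<in> {-1..1} \<Longrightarrow> cmod (of_real (f t) - poly p (of_real t)) \<le> e"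
    "norm (cfc h f - poly_at h p) \<le> e"
proof -
  obtain p where "\<And>t. t \<in> {-1..1} \<Longrightarrow> cmod (of_real (f t) - poly p (of_real t)) \<le> e"
    using real_Weierstrass_complex_poly[OF f e] by blast
  thus ?thesis using that approximates_cfc[OF f] by (auto simp: approximates_def)
qed

lemma cfc_poly:
  assumes "\<And>t. t \<in> {-1..1} \<Longrightarrow> of_real (f t) = poly p (of_real t)" "continuous_on {-1..1} f"
  shows "cfc h f = poly_at h p"
  by (rule cfc_eqI[OF assms(2)], rule exI[of _ p]) (simp add: assms(1))

lemma cfc_const: "cfc h (\<lambda>t. c) = c *\<^sub>R 1"
  by (subst cfc_poly[where p = "[:of_real c:]"]) (auto simp: scaleR_scaleC)

lemma cfc_id: "cfc h (\<lambda>t. t) = h"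
  by (subst cfc_poly[where p = "[:0, 1:]"]) (auto simp: continuous_on_id)

lemma norm_cfc_le:
  assumes f: "continuous_on {-1..1} f" and M: "\<And>t. t \<in> {-1..1} \<Longrightarrow> \<bar>f t\<bar> \<le> M"
  shows "norm (cfc h f) \<le> M"
  using approximates_cfc[OF f] M unfolding approximates_def
  by (metis diff_zero norm_of_real poly_0 poly_at_0)

lemma star_cfc:
  assumes f: "continuous_on {-1..1} f"
  shows "star (cfc h f) = cfc h f"
proof (rule sym, rule cfc_eqI[OF f])
  fix e :: real assume "e > 0"
  then obtain p where p: "\<And>t. t \<in> {-1..1} \<Longrightarrow> cmod (of_real (f t) - poly p (of_real t)) \<le> e"
    "norm (cfc h f - poly_at h p) \<le> e" using cfc_approx[OF f] by blast
  have "cmod (of_real (f t) - poly (map_poly cnj p) (of_real t)) = cmod (of_real (f t) - poly p (of_real t))"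
    for t
  proof -
    have "of_real (f t) - poly (map_poly cnj p) (of_real t) = cnj (of_real (f t) - poly p (of_real t))"
      unfolding complex_cnj_diff poly_cnj complex_cnj_complex_of_real ..
    thus ?thesis by (simp only: complex_mod_cnj)
  qed
  moreover have "norm (star (cfc h f) - poly_at h (map_poly cnj p)) = norm (cfc h f - poly_at h p)"
    by (simp add: sa flip: star_poly_at star_diff)
  ultimately show "\<exists>p. (\<forall>t\<in>{-1..1}. cmod (of_real (f t) - poly p (of_real t)) \<le> e)
      \<and> norm (star (cfc h f) - poly_at h p) \<le> e"
    using p by (intro exI[of _ "map_poly cnj p"]) simp
qed

lemma cfc_add:
  assumes f: "continuous_on {-1..1} f" and g: "continuous_on {-1..1} g"
  shows "cfc h (\<lambda>t. f t + g t) = cfc h f + cfc h g"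
proof (rule cfc_eqI)
  show "continuous_on {-1..1} (\<lambda>t. f t + g t)" by (intro continuous_intros f g)
  fix e :: real assume e: "e > 0"
  obtain p where p: "\<And>t. t \<in> {-1..1} \<Longrightarrow> cmod (of_real (f t) - poly p (of_real t)) \<le> e / 2"
    "norm (cfc h f - poly_at h p) \<le> e / 2" using cfc_approx[OF f, of "e / 2"] e by auto
  obtain q where q: "\<And>t. t \<in> {-1..1} \<Longrightarrow> cmod (of_real (g t) - poly q (of_real t)) \<le> e / 2"
    "norm (cfc h g - poly_at h q) \<le> e / 2" using cfc_approx[OF g, of "e / 2"] e by auto
  have tri: "norm (a + b - (c + d)) \<le> e" if "norm (a - c) \<le> e / 2" "norm (b - d) \<le> e / 2"
    for a b c d :: "'b::real_normed_vector"
    using norm_triangle_mono[OF that] by (simp add: algebra_simps)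
  show "\<exists>p. (\<forall>t\<in>{-1..1}. cmod (of_real (f t + g t) - poly p (of_real t)) \<le> e)
      \<and> norm (cfc h f + cfc h g - poly_at h p) \<le> e"
    using p q by (intro exI[of _ "p + q"]) (auto intro!: tri)
qed

lemma cfc_mult:
  assumes f: "continuous_on {-1..1} f" and g: "continuous_on {-1..1} g"
  shows "cfc h (\<lambda>t. f t * g t) = cfc h f * cfc h g"
proof (rule cfc_eqI)
  show "continuous_on {-1..1} (\<lambda>t. f t * g t)" by (intro continuous_intros f g)
  fix e :: real assume e: "e > 0"
  have "bounded (f ` {-1..1})" "bounded (g ` {-1..1})"
    by (intro compact_imp_bounded compact_continuous_image f g compact_Icc)+
  then obtain M1 M2 where "\<And>t. t \<in> {-1..1} \<Longrightarrow> \<bar>f t\<bar> \<le> M1" "\<And>t. t \<in> {-1..1} \<Longrightarrow> \<bar>g t\<bar> \<le> M2"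
    by (metis bounded_iff image_eqI real_norm_def)
  hence "\<exists>M\<ge>0. (\<forall>t\<in>{-1..1}. \<bar>f t\<bar> \<le> M) \<and> (\<forall>t\<in>{-1..1}. \<bar>g t\<bar> \<le> M)"
    by (intro exI[of _ "max 0 (max M1 M2)"]) (auto simp: le_max_iff_disj)
  then obtain M where M: "M \<ge> 0" "\<And>t. t \<in> {-1..1} \<Longrightarrow> \<bar>f t\<bar> \<le> M" "\<And>t. t \<in> {-1..1} \<Longrightarrow> \<bar>g t\<bar> \<le> M"
    by blast
  define d where "d = min 1 (e / (2 * M + 1))"
  have "d \<le> e / (2 * M + 1)" by (simp add: d_def)
  hence "d * (2 * M + 1) \<le> e" using M(1) by (subst (asm) pos_le_divide_eq) auto
  moreover have "d > 0" "d \<le> 1" using e M(1) by (auto simp: d_def)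
  ultimately have d: "d > 0" "d \<le> 1" "d * (2 * M + 1) \<le> e" by blast+
  obtain p where p: "\<And>t. t \<in> {-1..1} \<Longrightarrow> cmod (of_real (f t) - poly p (of_real t)) \<le> d"
    "norm (cfc h f - poly_at h p) \<le> d" using cfc_approx[OF f, of d] d by auto
  obtain q where q: "\<And>t. t \<in> {-1..1} \<Longrightarrow> cmod (of_real (g t) - poly q (of_real t)) \<le> d"
    "norm (cfc h g - poly_at h q) \<le> d" using cfc_approx[OF g, of d] d by auto
  have tri: "norm (a * b - x * y) \<le> e" if "norm (a - x) \<le> d" "norm (b - y) \<le> d" "norm a \<le> M" "norm b \<le> M"
    for a b x y :: "'b::real_normed_algebra"
  proof -
    have "a * b - x * y = a * (b - y) + (a - x) * b - (a - x) * (b - y)"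
      by (simp add: algebra_simps)
    also have "norm \<dots> \<le> norm a * norm (b - y) + norm (a - x) * norm b + norm (a - x) * norm (b - y)"
      by (intro norm_triangle_le_diff norm_triangle_mono add_mono norm_mult_ineq)
    also have "\<dots> \<le> M * d + d * M + d * 1"
      using that d M(1) by (intro add_mono mult_mono) auto
    also have "\<dots> \<le> e" using d(3) by (simp add: algebra_simps)
    finally show ?thesis .
  qed
  have "norm (cfc h f) \<le> M" "norm (cfc h g) \<le> M"
    using norm_cfc_le[OF f] norm_cfc_le[OF g] M by blast+
  thus "\<exists>p. (\<forall>t\<in>{-1..1}. cmod (of_real (f t * g t) - poly p (of_real t)) \<le> e)
      \<and> norm (cfc h f * cfc h g - poly_at h p) \<le> e"
    using p q M by (intro exI[of _ "p * q"]) (auto intro!: tri)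
qed

lemma cfc_commute:
  assumes f: "continuous_on {-1..1} f" and y: "h * y = y * h"
  shows "cfc h f * y = y * cfc h f"
proof -
  have small: "norm (cfc h f * y - y * cfc h f) \<le> e" if "e > 0" for e
  proof -
    define d where "d = e / (2 * (norm y + 1))"
    have "norm y + 1 > 0" by (simp add: add_nonneg_pos)
    hence d: "d > 0" "2 * (d * norm y) \<le> e" using that by (auto simp: d_def field_simps)
    obtain p where p: "norm (cfc h f - poly_at h p) \<le> d" using cfc_approx[OF f d(1)] by blast
    have "cfc h f * y - y * cfc h f = (cfc h f - poly_at h p) * y - y * (cfc h f - poly_at h p)"
      using poly_at_commute[OF y, of p] by (simp add: algebra_simps)
    also have "norm \<dots> \<le> norm (cfc h f - poly_at h p) * norm y + norm y * norm (cfc h f - poly_at h p)"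
      by (intro norm_triangle_le_diff add_mono norm_mult_ineq)
    also have "\<dots> \<le> d * norm y + norm y * d"
      using p by (intro add_mono mult_right_mono mult_left_mono) auto
    finally show ?thesis using d(2) by (simp add: mult.commute)
  qed
  have "norm (cfc h f * y - y * cfc h f) \<le> 0" by (rule field_le_epsilon) (simp add: small)
  thus ?thesis by simp
qed

end

lemma poly_at_pcompose: "poly_at h (pcompose p q) = poly_at (poly_at h q) p"
  by (induction p) (simp_all add: pcompose_pCons)

lemma poly_at_intertwine:
  assumes "y * a = b * y"
  shows "y * poly_at a p = poly_at b p * y"
proof (induction p)
  case (pCons c p)
  have "y * (a * poly_at a p) = b * (y * poly_at a p)"
    using assms by (metis mult.assoc)
  thus ?case using pCons
    by (simp add: distrib_left distrib_right mult_scaleC_left mult_scaleC_right mult.assoc)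
qed simp

text \<open>
  The condition on \<open>k\<close> says that \<open>0 \<le> k \<le> 1\<close>: then \<open>1 - 2 k\<close> is in the unit ball, and its
  functional calculus is one for \<open>k\<close>.
\<close>

lemma norm_poly_at_le_unit_interval:
  fixes k :: "'a::unital_cstar_algebra"
  assumes k: "star k = k" "norm ((1/2) *\<^sub>R 1 - k) \<le> 1/2"
    and M: "\<And>t. t \<in> {0..1} \<Longrightarrow> cmod (poly p (of_real t)) \<le> M"
  shows "norm (poly_at k p) \<le> M"
proof -
  define g where "g = 1 - 2 *\<^sub>R k"
  have "g = 2 *\<^sub>R ((1/2) *\<^sub>R 1 - k)" by (simp add: g_def scaleR_right_diff_distrib)
  hence g: "star g = g" "norm g \<le> 1" using k by (auto simp: g_def star_diff star_scaleR)
  have "k = poly_at g [:1/2, -1/2:]"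
    by (simp add: g_def mult_scaleC_right scaleR_scaleC scaleC_diff_right scaleC_scaleC
        scaleC_minus_left)
  hence "poly_at k p = poly_at g (pcompose p [:1/2, -1/2:])"
    by (simp only: poly_at_pcompose)
  also have "norm \<dots> \<le> M"
  proof (rule norm_poly_at_le[OF g])
    fix t :: real assume "t \<in> {-1..1}"
    hence "cmod (poly p (of_real ((1 - t) / 2))) \<le> M" by (intro M) auto
    thus "cmod (poly (pcompose p [:1/2, -1/2:]) (of_real t)) \<le> M"
      by (simp add: poly_pcompose diff_divide_distrib)
  qed
  finally show ?thesis .
qed

text \<open>
  \<open>star y * y\<close> and \<open>y * star y\<close> have the same spectrum up to \<open>0\<close>, in the form that
  \<open>t \<bar>p(t)\<bar>\<^sup>2\<close> has the same norm at both for every polynomial \<open>p\<close>. So if one of them is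
  negative and the other one positive, then a \<open>p\<close> that is near 1 on the negative numbers and
  near 0 on the positive ones except close to \<open>0\<close> shows that both vanish.
\<close>

lemma opposite_signs_imp_zero:
  fixes y :: "'a::unital_cstar_algebra"
  assumes w: "star y * y = - w" "norm ((1/2) *\<^sub>R 1 - w) \<le> 1/2"
    and k: "norm ((1/2) *\<^sub>R 1 - y * star y) \<le> 1/2"
  shows "w = 0"
proof -
  have "star (star y * y) = star y * y" by (simp add: star_mult star_star)
  hence sw: "star w = w" unfolding w(1) by (simp add: star_minus)
  have small: "norm w \<le> 3 * e" if e: "0 < e" "e \<le> 1" for e
  proof -
    define f where "f t = max 0 (1 - max 0 t / e)" for t :: real
    have f: "continuous_on {-1..1} f" unfolding f_def by (intro continuous_intros) (use e in auto)
    have f01: "0 \<le> f t" "f t \<le> 1" for t using e by (auto simp: f_def)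
    have f_neg: "f t = 1" if "t \<le> 0" for t using that by (simp add: f_def)
    have f_pos: "\<bar>t * (f t)\<^sup>2\<bar> \<le> e" if "t \<ge> 0" for t
    proof (cases "t \<le> e")
      case True
      thus ?thesis using f01[of t] that mult_mono[of t e "(f t)\<^sup>2" 1]
        by (simp add: abs_mult power_le_one)
    next
      case False
      thus ?thesis using e by (simp add: f_def)
    qed
    obtain p where p: "\<And>t. t \<in> {-1..1} \<Longrightarrow> cmod (of_real (f t) - poly p (of_real t)) \<le> e / 3"
      using real_Weierstrass_complex_poly[OF f, of "e / 3"] e by auto
    define q where "q = [:0, 1:] * (map_poly cnj p * p)"
    have q: "poly q (of_real t) = of_real (t * (cmod (poly p (of_real t)))\<^sup>2)" for t
    proof -
      have "poly q (of_real t) = of_real t * (cnj (poly p (of_real t)) * poly p (of_real t))"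
        unfolding q_def poly_mult poly_cnj complex_cnj_complex_of_real by simp
      thus ?thesis by (simp add: complex_norm_square mult.commute del: of_real_power flip: of_real_power)
    qed
    have close: "\<bar>t * (cmod (poly p (of_real t)))\<^sup>2 - t * (f t)\<^sup>2\<bar> \<le> e" if t: "t \<in> {-1..1}" for t
    proof -
      let ?m = "cmod (poly p (of_real t))"
      have 1: "\<bar>?m - f t\<bar> \<le> e / 3"
        using norm_triangle_ineq3[of "poly p (of_real t)" "of_real (f t)"] p[OF t] f01[of t]
        by (simp add: norm_minus_commute)
      hence 2: "\<bar>?m + f t\<bar> \<le> 3" using f01[of t] e abs_ge_self[of "?m - f t"]
        by (subst abs_of_nonneg) (simp, linarith)
      have "\<bar>t * ?m\<^sup>2 - t * (f t)\<^sup>2\<bar> = \<bar>t\<bar> * (\<bar>?m - f t\<bar> * \<bar>?m + f t\<bar>)"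
        by (simp add: power2_eq_square algebra_simps flip: abs_mult)
      also have "\<dots> \<le> 1 * (e / 3 * 3)"
        using 1 2 t e by (intro mult_mono) auto
      finally show ?thesis by simp
    qed
    have "norm (poly_at w (pcompose (q - [:0, 1:]) [:0, -1:])) \<le> e"
    proof (rule norm_poly_at_le_unit_interval[OF sw w(2)])
      fix t :: real assume t: "t \<in> {0..1}"
      have "poly (pcompose (q - [:0, 1:]) [:0, -1:]) (of_real t)
          = of_real ((- t) * (cmod (poly p (of_real (- t))))\<^sup>2 - (- t) * (f (- t))\<^sup>2)"
        using q[of "- t"] t by (simp add: poly_pcompose f_neg)
      thus "cmod (poly (pcompose (q - [:0, 1:]) [:0, -1:]) (of_real t)) \<le> e"
        using close[of "- t"] t by (simp only: norm_of_real) simp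
    qed
    moreover have "poly_at w [:0, -1:] = - w" by (simp add: mult_scaleC_right scaleC_minus1)
    ultimately have 1: "norm (poly_at (- w) q + w) \<le> e"
      by (simp only: poly_at_pcompose poly_at_diff) simp
    have "norm (poly_at (y * star y) q) \<le> 2 * e"
    proof (rule norm_poly_at_le_unit_interval)
      fix t :: real assume t: "t \<in> {0..1}"
      have "\<bar>t * (cmod (poly p (of_real t)))\<^sup>2\<bar> \<le> 2 * e"
        using close[of t] f_pos[of t] t by auto
      thus "cmod (poly q (of_real t)) \<le> 2 * e" by (simp only: q norm_of_real)
    qed (use k in \<open>auto simp: star_mult star_star\<close>)
    moreover have "norm (poly_at (- w) q) = norm (poly_at (y * star y) q)"
    proof -
      define z where "z = poly_at (- w) p"
      have sz: "star z = poly_at (- w) (map_poly cnj p)"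
        by (simp add: z_def star_poly_at star_minus sw)
      have "star (y * z) * (y * z) = star z * (- w) * z"
        by (simp add: star_mult mult.assoc flip: w(1))
      also have "\<dots> = (- w) * (star z * z)"
        using poly_at_commute[of "- w" "- w"] by (simp add: sz mult.assoc)
      also have "\<dots> = poly_at (- w) q" by (simp add: q_def z_def sz[unfolded z_def])
      finally have l: "(norm (y * z))\<^sup>2 = norm (poly_at (- w) q)" by (simp flip: norm_star_mult_self)
      have c: "z * star z = poly_at (- w) (map_poly cnj p * p)"
        by (subst mult.commute, subst poly_at_mult) (simp only: sz, simp only: z_def)
      have "y * (- w) = y * star y * y" by (simp add: mult.assoc flip: w(1))
      hence "y * (z * star z) = poly_at (y * star y) (map_poly cnj p * p) * y"
        unfolding c by (rule poly_at_intertwine)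
      moreover have "(y * z) * star (y * z) = y * (z * star z) * star y"
        by (simp add: star_mult mult.assoc)
      ultimately have "(y * z) * star (y * z)
          = poly_at (y * star y) (map_poly cnj p * p) * (y * star y)"
        by (simp only: mult.assoc)
      also have "\<dots> = poly_at (y * star y) q"
        unfolding q_def poly_at_mult[of _ "[:0, 1:]"] by (simp add: poly_at_commute del: poly_at_mult)
      finally show ?thesis using l norm_mult_star_self[of "y * z"] by simp
    qed
    ultimately show ?thesis
      using 1 norm_triangle_ineq4[of "poly_at (- w) q + w" "poly_at (- w) q"] by simp
  qed
  have "norm w \<le> e" if "e > 0" for e
  proof -
    have "norm w \<le> 3 * min 1 (e / 3)" by (rule small) (use that in auto)
    also have "\<dots> \<le> e" by linarith
    finally show ?thesis .
  qed
  hence le: "norm w \<le> 0 + e" if "e > 0" for e using that by simp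
  have "norm w \<le> 0" by (rule field_le_epsilon) (rule le)
  thus ?thesis by simp
qed

text \<open>
  Positivity in terms of the norm. In contrast to the description by squares, it is visibly
  preserved by sums.
\<close>

definition norm_positive :: "'a::unital_cstar_algebra \<Rightarrow> bool" where
  "norm_positive k \<longleftrightarrow> star k = k \<and> (\<exists>T\<ge>0. norm (T *\<^sub>R 1 - k) \<le> T)"

lemma norm_positive_add:
  assumes "norm_positive j" "norm_positive k"
  shows "norm_positive (j + k)"
proof -
  obtain S T where "S \<ge> 0" "norm (S *\<^sub>R 1 - j) \<le> S" "T \<ge> 0" "norm (T *\<^sub>R 1 - k) \<le> T"
    using assms by (auto simp: norm_positive_def)
  hence "norm ((S *\<^sub>R 1 - j) + (T *\<^sub>R 1 - k)) \<le> S + T" "S + T \<ge> 0"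
    by (auto intro!: norm_triangle_mono)
  moreover have "(S *\<^sub>R 1 - j) + (T *\<^sub>R 1 - k) = (S + T) *\<^sub>R 1 - (j + k)"
    by (simp add: scaleR_left_distrib)
  ultimately show ?thesis using assms by (auto simp: norm_positive_def star_add)
qed

lemma norm_positive_square:
  assumes a: "star a = a"
  shows "norm_positive (a * a)"
proof -
  define T where "T = norm a + 1"
  have T: "T > 0" "norm a < T" by (auto simp: T_def add_nonneg_pos)
  have "norm (1 - ((1 / T) *\<^sub>R a) * ((1 / T) *\<^sub>R a)) \<le> 1"
    using T a by (intro norm_one_minus_square_le) (auto simp: star_scaleR)
  moreover have "T\<^sup>2 *\<^sub>R 1 - a * a = T\<^sup>2 *\<^sub>R (1 - ((1 / T) *\<^sub>R a) * ((1 / T) *\<^sub>R a))"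
    using T by (simp add: scaleR_right_diff_distrib power2_eq_square)
  ultimately have "norm (T\<^sup>2 *\<^sub>R 1 - a * a) \<le> T\<^sup>2"
    by (simp add: mult_left_le)
  thus ?thesis using a unfolding norm_positive_def by (metis star_mult zero_le_power2)
qed

text \<open>If \<open>norm (T - k) \<le> T\<close>, then \<open>k = T (1 - g)\<close> with \<open>g\<close> in the unit ball.\<close>

lemma norm_positive_imp_square:
  assumes "norm_positive k"
  obtains s where "star s = s" "s * s = k"
proof -
  obtain T where T: "T \<ge> 0" "norm (T *\<^sub>R 1 - k) \<le> T" and k: "star k = k"
    using assms by (auto simp: norm_positive_def)
  show ?thesis
  proof (cases "T = 0")
    case True
    thus ?thesis using T that[of 0] by simp
  next
    case False
    define g where "g = 1 - (1 / T) *\<^sub>R k"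
    have "g = (1 / T) *\<^sub>R (T *\<^sub>R 1 - k)" using False by (simp add: g_def scaleR_right_diff_distrib)
    hence g: "star g = g" "norm g \<le> 1"
      using T k False by (auto simp: g_def star_diff star_scaleR divide_le_eq)
    define f where "f t = sqrt (max 0 (1 - t))" for t :: real
    have f: "continuous_on {-1..1} f" unfolding f_def by (intro continuous_intros)
    have "cfc g f * cfc g f = cfc g (\<lambda>t. f t * f t)" by (simp add: cfc_mult[OF g f f])
    also have "\<dots> = poly_at g [:1, -1:]"
      by (rule cfc_poly[OF g]) (auto simp: f_def intro!: continuous_intros)
    also have "\<dots> = (1 / T) *\<^sub>R k"
      by (simp add: g_def mult_scaleC_right scaleC_minus1)
    finally have "(sqrt T *\<^sub>R cfc g f) * (sqrt T *\<^sub>R cfc g f) = k"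
      using T(1) False by simp
    thus ?thesis using that[of "sqrt T *\<^sub>R cfc g f"] star_cfc[OF g f] by (simp add: star_scaleR)
  qed
qed

text \<open>
  The classical argument of Kaplansky: with \<open>h = star x * x\<close> and \<open>v\<close> its negative part, the
  element \<open>y = x * v\<close> has \<open>star y * y = - v\<^sup>3\<close>. The sum \<open>star y * y + y * star y\<close> is positive
  as it is twice the sum of the squares of the real and imaginary parts of \<open>y\<close>, hence
  \<open>y * star y\<close> is positive as well. By the lemma on opposite signs \<open>v\<^sup>3 = 0\<close>, so \<open>h\<close> is its own
  positive part, which has a square root.
\<close>

lemma star_mult_self_square_of_contraction:
  fixes x :: "'a::unital_cstar_algebra"
  assumes x: "norm x \<le> 1"
  obtains s where "star s = s" "s * s = star x * x"
    "\<And>c. star x * x * c = c * (star x * x) \<Longrightarrow> s * c = c * s"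
proof -
  define h where "h = star x * x"
  have h: "star h = h" "norm h \<le> 1"
    using x by (auto simp: h_def star_mult star_star norm_star_mult_self abs_square_le_1)
  define n where "n t = max 0 (- t)" for t :: real
  have n: "continuous_on {-1..1} n" unfolding n_def by (intro continuous_intros)
  define v where "v = cfc h n"
  have n3: "continuous_on {-1..1} (\<lambda>t. n t * n t * n t)" by (intro continuous_intros n)
  define w where "w = cfc h (\<lambda>t. n t * n t * n t)"
  have wv: "w = v * v * v"
    unfolding w_def v_def by (simp add: cfc_mult[OF h] n continuous_on_mult)
  have sv: "star v = v" by (simp add: v_def star_cfc[OF h n])
  define y where "y = x * v"
  have vhv: "star y * y = - w"
  proof -
    have "star y * y = v * h * v" by (simp add: y_def star_mult sv h_def mult.assoc)
    also have "\<dots> = cfc h (\<lambda>t. n t * t * n t)"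
      unfolding v_def by (simp add: cfc_mult[OF h] n continuous_on_mult continuous_on_id cfc_id[OF h])
    also have "(\<lambda>t. n t * t * n t) = (\<lambda>t. (-1) * (n t * n t * n t))"
      by (auto simp: n_def max_def)
    also have "cfc h \<dots> = cfc h (\<lambda>t. -1) * w"
      unfolding w_def by (rule cfc_mult[OF h]) (intro continuous_intros n3)+
    finally show ?thesis by (simp add: cfc_const[OF h])
  qed
  define u where "u = cfc h (\<lambda>t. n t * sqrt (n t))"
  have n_ge0: "n t \<ge> 0" for t by (simp add: n_def)
  have u: "star u = u" "u * u = w"
  proof -
    have c: "continuous_on {-1..1} (\<lambda>t. n t * sqrt (n t))" by (intro continuous_intros n)
    show "star u = u" unfolding u_def by (rule star_cfc[OF h c])
    have "u * u = cfc h (\<lambda>t. (n t * sqrt (n t)) * (n t * sqrt (n t)))"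
      unfolding u_def by (simp add: cfc_mult[OF h c c])
    also have "(\<lambda>t. (n t * sqrt (n t)) * (n t * sqrt (n t))) = (\<lambda>t. n t * n t * n t)"
      using n_ge0 by (auto simp: algebra_simps)
    finally show "u * u = w" by (simp add: w_def)
  qed
  define k where "k = y * star y"
  have "norm_positive k"
  proof -
    define a b where "a = (1 / sqrt 2) *\<^sub>R (y + star y)" and "b = (\<i> / sqrt 2) *\<^sub>C (y - star y)"
    have "star a = a" by (simp add: a_def star_scaleR star_add star_star add.commute)
    moreover have "star b = b"
      by (simp add: b_def star_scaleC star_diff star_star scaleC_diff_right scaleC_minus_left)
    moreover have "a * a = (1/2) *\<^sub>R ((y + star y) * (y + star y))"
      by (simp add: a_def)
    moreover have "b * b = - ((1/2) *\<^sub>R ((y - star y) * (y - star y)))"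
    proof -
      have "(\<i> / sqrt 2) * (\<i> / sqrt 2) = - complex_of_real (1/2)"
        by (simp flip: of_real_mult)
      thus ?thesis
        by (simp only: b_def mult_scaleC_left mult_scaleC_right scaleC_scaleC scaleC_minus_left scaleR_scaleC)
    qed
    moreover have "(1/2) *\<^sub>R ((y + star y) * (y + star y)) + - ((1/2) *\<^sub>R ((y - star y) * (y - star y)))
        = star y * y + k"
    proof -
      have "(y + star y) * (y + star y) - (y - star y) * (y - star y) = 2 *\<^sub>R (star y * y + k)"
        by (simp add: k_def algebra_simps scaleR_2)
      thus ?thesis by (simp flip: scaleR_right_diff_distrib)
    qed
    ultimately have "a * a + b * b + u * u = k" "star a = a" "star b = b"
      by (simp_all add: vhv u)
    thus ?thesis using norm_positive_add norm_positive_square u(1) by metis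
  qed
  then obtain T where T: "T \<ge> 0" "norm (T *\<^sub>R 1 - k) \<le> T" by (auto simp: norm_positive_def)
  define S where "S = T + 1"
  have S: "S \<ge> 1" "norm (S *\<^sub>R 1 - k) \<le> S"
  proof -
    have eq: "S *\<^sub>R 1 - k = 1 + (T *\<^sub>R 1 - k)" by (simp add: S_def scaleR_left_distrib)
    have "norm (1 + (T *\<^sub>R 1 - k)) \<le> 1 + T" by (rule norm_triangle_mono[OF norm_one_le T(2)])
    moreover have "1 + T = S" by (simp add: S_def)
    ultimately show "norm (S *\<^sub>R 1 - k) \<le> S" unfolding eq by simp
  qed (use T in \<open>simp add: S_def\<close>)
  (* scaling moves both star y * y and y * star y into the interval from -1 to 1 *)
  have "(1 / (2 * S)) *\<^sub>R w = 0"
  proof (rule opposite_signs_imp_zero)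
    let ?y = "(1 / sqrt (2 * S)) *\<^sub>R y"
    show "star ?y * ?y = - ((1 / (2 * S)) *\<^sub>R w)"
      using S vhv by (simp add: star_scaleR)
    have "?y * star ?y = (1 / (2 * S)) *\<^sub>R k"
      using S by (simp add: star_scaleR k_def)
    moreover have "(1/2) *\<^sub>R 1 - (1 / (2 * S)) *\<^sub>R k = (1 / (2 * S)) *\<^sub>R (S *\<^sub>R 1 - k)"
      using S by (simp add: scaleR_right_diff_distrib)
    ultimately show "norm ((1/2) *\<^sub>R 1 - ?y * star ?y) \<le> 1/2"
      using S by (simp add: divide_le_eq)
    have "(1/2) *\<^sub>R 1 - (1 / (2 * S)) *\<^sub>R w = cfc h (\<lambda>t. 1/2 + (- 1 / (2 * S)) * (n t * n t * n t))"
    proof -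
      have "cfc h (\<lambda>t. 1/2 + (- 1 / (2 * S)) * (n t * n t * n t))
          = cfc h (\<lambda>t. 1/2) + cfc h (\<lambda>t. (- 1 / (2 * S)) * (n t * n t * n t))"
        by (rule cfc_add[OF h]) (intro continuous_intros n3)+
      also have "cfc h (\<lambda>t. (- 1 / (2 * S)) * (n t * n t * n t)) = cfc h (\<lambda>t. - 1 / (2 * S)) * w"
        unfolding w_def by (rule cfc_mult[OF h]) (intro continuous_intros n3)+
      finally show ?thesis by (simp add: cfc_const[OF h])
    qed
    also have "norm \<dots> \<le> 1/2"
    proof (rule norm_cfc_le[OF h])
      show "continuous_on {-1..1} (\<lambda>t. 1/2 + (- 1 / (2 * S)) * (n t * n t * n t))"
        by (intro continuous_intros n3)
      fix t :: real assume "t \<in> {-1..1}"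
      hence "0 \<le> n t" "n t \<le> 1" by (auto simp: n_def)
      hence "0 \<le> n t * n t * n t" "n t * n t * n t \<le> 1" by (auto intro!: mult_le_one)
      moreover from this have "n t * n t * n t / (2 * S) \<le> 1 / 2"
        using S by (auto simp: divide_le_eq)
      moreover have "0 \<le> n t * n t * n t / (2 * S)" using S \<open>0 \<le> n t * n t * n t\<close> by simp
      ultimately show "\<bar>1/2 + (- 1 / (2 * S)) * (n t * n t * n t)\<bar> \<le> 1/2" by simp
    qed
    finally show "norm ((1/2) *\<^sub>R 1 - (1 / (2 * S)) *\<^sub>R w) \<le> 1/2" .
  qed
  hence "w = 0" using S by simp
  hence "star (v * v) * (v * v) = 0" using wv sv by (simp add: star_mult mult.assoc)
  hence "star v * v = 0" using sv by (simp only: star_mult_self_eq_0_iff)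
  hence "v = 0" by simp
  define r where "r t = sqrt (max 0 t)" for t :: real
  have r: "continuous_on {-1..1} r" unfolding r_def by (intro continuous_intros)
  show ?thesis
  proof (rule that[of "cfc h r"])
    show "star (cfc h r) = cfc h r" by (rule star_cfc[OF h r])
    have "cfc h r * cfc h r = cfc h (\<lambda>t. r t * r t)" by (simp add: cfc_mult[OF h r r])
    also have "(\<lambda>t. r t * r t) = (\<lambda>t. t + n t)" by (auto simp: r_def n_def)
    also have "cfc h \<dots> = h + v"
      unfolding v_def by (simp add: cfc_add[OF h] continuous_on_id n cfc_id[OF h])
    finally show "cfc h r * cfc h r = star x * x" by (simp add: \<open>v = 0\<close> h_def)
    show "cfc h r * c = c * cfc h r" if "star x * x * c = c * (star x * x)" for c
      by (rule cfc_commute[OF h r]) (use that in \<open>simp add: h_def\<close>)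
  qed
qed

lemma star_mult_self_square:
  fixes x :: "'a::unital_cstar_algebra"
  obtains s where "star s = s" "s * s = star x * x"
    "\<And>c. star x * x * c = c * (star x * x) \<Longrightarrow> s * c = c * s"
proof (cases "x = 0")
  case True
  thus ?thesis using that[of 0] by simp
next
  case False
  let ?x = "(1 / norm x) *\<^sub>R x"
  have eq: "star ?x * ?x = (1 / (norm x)\<^sup>2) *\<^sub>R (star x * x)"
    by (simp add: star_scaleR power2_eq_square)
  show ?thesis
  proof (rule star_mult_self_square_of_contraction)
    show "norm ?x \<le> 1" using False by simp
    fix s
    assume s: "star s = s" "s * s = star ?x * ?x"
      and comm: "\<And>c. star ?x * ?x * c = c * (star ?x * ?x) \<Longrightarrow> s * c = c * s"
    show thesis
    proof (rule that[of "norm x *\<^sub>R s"])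
      show "star (norm x *\<^sub>R s) = norm x *\<^sub>R s" by (simp add: star_scaleR s(1))
      have "norm x *\<^sub>R s * norm x *\<^sub>R s = (norm x)\<^sup>2 *\<^sub>R (s * s)"
        by (simp add: power2_eq_square)
      thus "norm x *\<^sub>R s * norm x *\<^sub>R s = star x * x"
        unfolding s(2) eq using False by simp
      fix c assume "star x * x * c = c * (star x * x)"
      hence "star ?x * ?x * c = c * (star ?x * ?x)" unfolding eq by simp
      thus "norm x *\<^sub>R s * c = c * norm x *\<^sub>R s" by (simp add: comm)
    qed
  qed
qed

text \<open>
  For \<open>N\<close> above the norm of the sum, both \<open>N - (star x * x + star y * y)\<close> and \<open>star y * y\<close> are
  squares, so \<open>N - star x * x\<close> is the square of some \<open>s\<close>. With the square root \<open>r\<close> of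
  \<open>star x * x\<close>, the relation \<open>r\<^sup>2 + s\<^sup>2 = N\<close> gives the bound.
\<close>

lemma norm_le_norm_sum_unital:
  fixes x y :: "'a::unital_cstar_algebra"
  shows "(norm x)\<^sup>2 \<le> norm (star x * x + star y * y)"
proof (rule dense_ge)
  define z where "z = star x * x + star y * y"
  fix N assume N: "norm (star x * x + star y * y) < N"
  hence N0: "N > 0" using norm_ge_zero order_le_less_trans by blast
  have "star ((1 / N) *\<^sub>R z) = (1 / N) *\<^sub>R z"
    by (simp add: z_def star_scaleR star_add star_mult star_star)
  moreover have "norm ((1 / N) *\<^sub>R z) < 1" using N N0 by (simp add: z_def)
  ultimately obtain q where q: "star q = q" "q * q = 1 - (1 / N) *\<^sub>R z"
    using square_root_one_minus by metis
  obtain t where t: "star t = t" "t * t = star y * y"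
    using star_mult_self_square[of y] by metis
  have "norm_positive ((sqrt N *\<^sub>R q) * (sqrt N *\<^sub>R q) + t * t)"
    by (intro norm_positive_add norm_positive_square) (simp_all add: star_scaleR q t)
  also have "(sqrt N *\<^sub>R q) * (sqrt N *\<^sub>R q) + t * t = N *\<^sub>R 1 - star x * x"
    using N0 by (simp add: q t z_def scaleR_right_diff_distrib)
  finally obtain s where s: "star s = s" "s * s = N *\<^sub>R 1 - star x * x"
    by (rule norm_positive_imp_square)
  obtain r where r: "star r = r" "r * r = star x * x"
      "\<And>c. star x * x * c = c * (star x * x) \<Longrightarrow> r * c = c * r"
    using star_mult_self_square[of x] by metis
  have xs: "star x * x = N *\<^sub>R 1 - s * s" by (simp add: s(2))
  have "r * s = s * r"
    by (rule r(3)) (simp add: xs left_diff_distrib right_diff_distrib mult.assoc)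
  hence "(norm r)\<^sup>2 \<le> N"
    by (intro norm_le_of_sum_of_squares[of r s]) (use r(1,2) s N0 in auto)
  moreover have "(norm r)\<^sup>2 = (norm x)\<^sup>2"
    using norm_star_mult_self[of r] norm_star_mult_self[of x] r(1,2) by simp
  ultimately show "(norm x)\<^sup>2 \<le> N" by simp
qed

theorem norm_le_norm_sum_of_positives:
  fixes x y :: "'a::cstar_algebra"
  shows "(norm x)\<^sup>2 \<le> norm (star x * x + star y * y)"
  using norm_le_norm_sum_unital[of "multiplier_of x" "multiplier_of y"]
  by (simp flip: multiplier_of_star multiplier_of_mult multiplier_of_add)

section \<open>Fourier coefficients for an action of the circle\<close>

lemma bounded_bilinear_scaleC: "bounded_bilinear ((*\<^sub>C) :: complex \<Rightarrow> 'a::cstar_algebra \<Rightarrow> 'a)"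
proof
  show "\<exists>K. \<forall>a b. norm (a *\<^sub>C b :: 'a) \<le> norm a * norm b * K"
    by (intro exI[of _ 1]) (simp add: norm_scaleC)
qed (simp_all add: scaleC_add_left scaleC_add_right scaleR_scaleC scaleC_scaleC mult.commute
    scaleR_conv_of_real)

lemma continuous_on_scaleC [continuous_intros]:
  fixes f :: "'b::topological_space \<Rightarrow> complex" and g :: "'b \<Rightarrow> 'a::cstar_algebra"
  shows "continuous_on S f \<Longrightarrow> continuous_on S g \<Longrightarrow> continuous_on S (\<lambda>x. f x *\<^sub>C g x)"
  by (rule bounded_bilinear.continuous_on[OF bounded_bilinear_scaleC])

lemma complex_subspace_sum:
  assumes "complex_subspace V" "\<And>i. i \<in> I \<Longrightarrow> f i \<in> V"
  shows "(\<Sum>i\<in>I. f i) \<in> V"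
  using assms(2)
  by (induction I rule: infinite_finite_induct) (auto intro: complex_subspaceD[OF assms(1)])

text \<open>Riemann sums stay in the subspace.\<close>

lemma integral_mem_closed_subspace:
  fixes g :: "real \<Rightarrow> 'a::cstar_algebra"
  assumes V: "complex_subspace V" "closed V" and g: "\<And>t. t \<in> {a..b} \<Longrightarrow> g t \<in> V"
  shows "integral {a..b} g \<in> V"
proof (cases "g integrable_on {a..b}")
  case True
  have "\<exists>y\<in>V. dist y (integral {a..b} g) < e" if e: "e > 0" for e
  proof -
    obtain \<gamma> where \<gamma>: "gauge \<gamma>"
      "\<forall>\<D>. \<D> tagged_division_of {a..b} \<and> \<gamma> fine \<D> \<longrightarrow>
        norm ((\<Sum>(x, k)\<in>\<D>. measure lborel k *\<^sub>R g x) - integral {a..b} g) < e"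
      using has_integral_real[THEN iffD1, THEN spec, THEN mp, OF integrable_integral[OF True] e]
      by (elim exE conjE)
    obtain \<D> where \<D>: "\<D> tagged_division_of {a..b}" "\<gamma> fine \<D>"
      using fine_division_exists_real[OF \<gamma>(1)] by blast
    have "(\<Sum>(x, k)\<in>\<D>. measure lborel k *\<^sub>R g x) \<in> V"
      using \<D>(1) by (intro complex_subspace_sum[OF V(1)])
        (auto intro!: complex_subspaceD(5)[OF V(1)] g dest: tag_in_interval)
    moreover have "norm ((\<Sum>(x, k)\<in>\<D>. measure lborel k *\<^sub>R g x) - integral {a..b} g) < e"
      using \<gamma>(2) \<D> by simp
    ultimately show ?thesis unfolding dist_norm by (rule bexI[rotated])
  qed
  thus ?thesis using V(2) by (metis closed_approachable)
next
  case False
  thus ?thesis using complex_subspaceD(1)[OF V(1)] by (simp add: not_integrable_integral)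
qed

lemma integral_period:
  fixes g :: "real \<Rightarrow> 'a::banach"
  assumes g: "continuous_on UNIV g" "\<And>t. g (t + 1) = g t" and s: "0 \<le> s" "s \<le> 1"
  shows "integral {a + s..a + 1 + s} g = integral {a..a + 1} g"
proof -
  have int: "g integrable_on {c..d}" for c d
    by (intro integrable_continuous_interval continuous_on_subset[OF g(1)]) simp
  have "integral {a..a + s} g = integral {a + 1..a + 1 + s} g"
    using integral_shift_Icc_real[of a "a + s" g 1] g(2) by (simp add: o_def add_ac)
  moreover have "integral {a..a + s} g + integral {a + s..a + 1} g = integral {a..a + 1} g"
    by (rule Henstock_Kurzweil_Integration.integral_combine) (use s int in auto)
  moreover have "integral {a + s..a + 1} g + integral {a + 1..a + 1 + s} g = integral {a + s..a + 1 + s} g"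
    by (rule Henstock_Kurzweil_Integration.integral_combine) (use s int in auto)
  ultimately show ?thesis by (simp add: add.commute)
qed

lemma unit_circle_cis:
  assumes "z \<in> unit_circle"
  obtains s where "0 \<le> s" "s \<le> 1" "z = cis (2 * pi * s)"
proof -
  define s where "s = Arg2pi z / (2 * pi)"
  have "0 \<le> s" "s \<le> 1" using Arg2pi[of z] by (auto simp: s_def divide_le_eq)
  moreover have "of_real (cmod z) * exp (\<i> * of_real (Arg2pi z)) = z"
    using Arg2pi[of z] unfolding is_Arg_def by simp
  hence "z = cis (2 * pi * s)" using assms by (simp add: s_def cis_conv_exp)
  ultimately show ?thesis by (rule that)
qed

text \<open>
  The interval is centred at \<open>0\<close>, so that a neighbourhood of the neutral element is an interval
  as well.
\<close>

definition fourier_coefficient ::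
    "(complex \<Rightarrow> 'a::cstar_algebra \<Rightarrow> 'a) \<Rightarrow> int \<Rightarrow> 'a \<Rightarrow> 'a" where
  "fourier_coefficient \<alpha> n x =
     integral {-1/2..1/2} (\<lambda>t. cis (- (of_int n * (2 * pi * t))) *\<^sub>C \<alpha> (cis (2 * pi * t)) x)"

context
  fixes \<alpha> :: "complex \<Rightarrow> 'a::cstar_algebra \<Rightarrow> 'a"
  assumes act: "circle_action \<alpha>"
begin

lemma action_automorphism: "z \<in> unit_circle \<Longrightarrow> star_automorphism (\<alpha> z)"
  using act by (auto simp: circle_action_def)

lemma
  assumes "z \<in> unit_circle"
  shows action_add: "\<alpha> z (x + y) = \<alpha> z x + \<alpha> z y"
    and action_scaleC: "\<alpha> z (c *\<^sub>C x) = c *\<^sub>C \<alpha> z x"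
    and action_mult: "\<alpha> z (x * y) = \<alpha> z x * \<alpha> z y"
    and action_star: "\<alpha> z (star x) = star (\<alpha> z x)"
    and norm_action_le: "norm (\<alpha> z x) \<le> norm x"
  using action_automorphism[OF assms]
  by (auto simp: star_automorphism_def intro: norm_star_automorphism_le[OF action_automorphism[OF assms]])

lemma bounded_linear_action: "z \<in> unit_circle \<Longrightarrow> bounded_linear (\<alpha> z)"
  by (rule bounded_linear_intro[where K = 1])
     (simp_all add: action_add scaleR_scaleC action_scaleC norm_action_le)

lemma action_compose: "z \<in> unit_circle \<Longrightarrow> w \<in> unit_circle \<Longrightarrow> \<alpha> z (\<alpha> w x) = \<alpha> (z * w) x"
  using act by (auto simp: circle_action_def)

lemma action_one: "\<alpha> 1 x = x"
proof -
  have "inj (\<alpha> 1)" using action_automorphism[of 1] by (auto simp: star_automorphism_def bij_def)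
  moreover have "\<alpha> 1 (\<alpha> 1 x) = \<alpha> 1 x" by (simp add: action_compose)
  ultimately show ?thesis by (auto dest: injD)
qed

lemma continuous_on_action: "continuous_on S (\<lambda>t. \<alpha> (cis (2 * pi * t)) x)"
proof (rule continuous_on_compose2[of unit_circle "\<lambda>z. \<alpha> z x" S "\<lambda>t. cis (2 * pi * t)"])
  show "continuous_on unit_circle (\<lambda>z. \<alpha> z x)" using act by (auto simp: circle_action_def)
  show "continuous_on S (\<lambda>t. cis (2 * pi * t))" by (intro continuous_intros)
qed auto

lemma integrable_action:
  assumes "continuous_on UNIV f"
  shows "(\<lambda>t. f t *\<^sub>C \<alpha> (cis (2 * pi * t)) x) integrable_on {a..b}"
  by (intro integrable_continuous_interval continuous_on_scaleC continuous_on_action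
      continuous_on_subset[OF assms]) simp

lemma integrable_fourier:
  "(\<lambda>t. cis (- (of_int n * (2 * pi * t))) *\<^sub>C \<alpha> (cis (2 * pi * t)) x) integrable_on {a..b}"
  by (rule integrable_action) (intro continuous_intros)

lemma fourier_coefficient_add:
  "fourier_coefficient \<alpha> n (x + y) = fourier_coefficient \<alpha> n x + fourier_coefficient \<alpha> n y"
  unfolding fourier_coefficient_def
  by (simp add: action_add scaleC_add_right integral_add integrable_fourier)

lemma fourier_coefficient_scaleC:
  "fourier_coefficient \<alpha> n (c *\<^sub>C x) = c *\<^sub>C fourier_coefficient \<alpha> n x"
proof -
  have "fourier_coefficient \<alpha> n (c *\<^sub>C x) = integral {-1/2..1/2} ((*\<^sub>C) c \<circ>
      (\<lambda>t. cis (- (of_int n * (2 * pi * t))) *\<^sub>C \<alpha> (cis (2 * pi * t)) x))"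
    by (simp add: fourier_coefficient_def o_def action_scaleC scaleC_scaleC mult.commute)
  also have "\<dots> = c *\<^sub>C fourier_coefficient \<alpha> n x"
    unfolding fourier_coefficient_def
    by (rule integral_linear[OF integrable_fourier bounded_linear_scaleC])
  finally show ?thesis .
qed

lemma norm_fourier_coefficient_le: "norm (fourier_coefficient \<alpha> n x) \<le> norm x"
proof -
  have "norm (fourier_coefficient \<alpha> n x) \<le> integral {-1/2..1/2::real} (\<lambda>t. norm x)"
    unfolding fourier_coefficient_def
    by (intro integral_norm_bound_integral integrable_fourier)
       (auto simp: norm_scaleC norm_action_le)
  thus ?thesis by simp
qed

lemma bounded_linear_fourier_coefficient: "bounded_linear (fourier_coefficient \<alpha> n)"
  by (rule bounded_linear_intro[where K = 1])
     (simp_all add: fourier_coefficient_add scaleR_scaleC fourier_coefficient_scaleC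
       norm_fourier_coefficient_le)

lemma fourier_coefficient_mult_fixed:
  assumes y: "y \<in> fixed_points \<alpha> UNIV"
  shows "fourier_coefficient \<alpha> n (x * y) = fourier_coefficient \<alpha> n x * y"
proof -
  have "\<alpha> (cis t) y = y" for t using y by (auto simp: spectral_subspace_def)
  hence "fourier_coefficient \<alpha> n (x * y) = integral {-1/2..1/2} ((\<lambda>z. z * y) \<circ>
      (\<lambda>t. cis (- (of_int n * (2 * pi * t))) *\<^sub>C \<alpha> (cis (2 * pi * t)) x))"
    by (simp add: fourier_coefficient_def o_def action_mult mult_scaleC_left)
  also have "\<dots> = fourier_coefficient \<alpha> n x * y"
    unfolding fourier_coefficient_def
    by (rule integral_linear[OF integrable_fourier bounded_linear_mult_left])
  finally show ?thesis .
qed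

lemma fourier_coefficient_mem:
  assumes "complex_subspace B" "closed B" "invariant \<alpha> B" "x \<in> B"
  shows "fourier_coefficient \<alpha> n x \<in> B"
  unfolding fourier_coefficient_def
  by (intro integral_mem_closed_subspace complex_subspaceD(3)[OF assms(1)] assms)
     (use assms(3,4) in \<open>force simp: invariant_def\<close>)

text \<open>The action of \<open>w\<close> translates the periodic integrand.\<close>

lemma action_fourier_coefficient:
  assumes w: "w \<in> unit_circle"
  shows "\<alpha> w (fourier_coefficient \<alpha> n x) = (w powi n) *\<^sub>C fourier_coefficient \<alpha> n x"
proof -
  obtain s where s: "0 \<le> s" "s \<le> 1" "w = cis (2 * pi * s)" using unit_circle_cis[OF w] .
  define g where "g t = cis (- (of_int n * (2 * pi * t))) *\<^sub>C \<alpha> (cis (2 * pi * t)) x" for t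
  have g_int: "g integrable_on {a..b}" for a b
    unfolding g_def by (rule integrable_fourier)
  have g_cont: "continuous_on UNIV g"
    unfolding g_def by (intro continuous_intros continuous_on_action)
  have per: "g (t + 1) = g t" for t
  proof -
    have "cis (2 * pi * (t + 1)) = cis (2 * pi * t)"
      by (simp add: distrib_left flip: cis_mult)
    moreover have "cis (- (of_int n * (2 * pi * (t + 1)))) = cis (- (of_int n * (2 * pi * t)))"
    proof -
      have "- (of_int n * (2 * pi * (t + 1))) = - (of_int n * (2 * pi * t)) + 2 * pi * of_int (- n)"
        by (simp add: algebra_simps)
      hence "cis (- (of_int n * (2 * pi * (t + 1))))
          = cis (- (of_int n * (2 * pi * t))) * cis (2 * pi * of_int (- n))"
        by (simp only: cis_mult)
      thus ?thesis using cis_multiple_2pi[of "of_int (- n)"] by (simp only: Ints_of_int mult_1_right)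
    qed
    ultimately show ?thesis by (simp only: g_def)
  qed
  have "\<alpha> w (fourier_coefficient \<alpha> n x) = integral {-1/2..1/2} (\<alpha> w \<circ> g)"
    unfolding fourier_coefficient_def g_def[symmetric]
    by (rule integral_linear[symmetric, OF g_int bounded_linear_action[OF w]])
  also have "\<alpha> w \<circ> g = (*\<^sub>C) (w powi n) \<circ> (g \<circ> (+) s)"
  proof
    fix t
    have "w * cis (2 * pi * t) = cis (2 * pi * (s + t))"
      by (simp add: s(3) cis_mult distrib_left)
    moreover have "w powi n * cis (- (of_int n * (2 * pi * (s + t)))) = cis (- (of_int n * (2 * pi * t)))"
      by (simp add: s(3) cis_power_int cis_mult algebra_simps)
    ultimately show "(\<alpha> w \<circ> g) t = ((*\<^sub>C) (w powi n) \<circ> (g \<circ> (+) s)) t"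
      using w by (simp add: g_def action_scaleC action_compose scaleC_scaleC)
  qed
  also have "integral {-1/2..1/2} \<dots> = (w powi n) *\<^sub>C integral {-1/2..1/2} (g \<circ> (+) s)"
  proof (rule integral_linear[OF _ bounded_linear_scaleC])
    show "(g \<circ> (+) s) integrable_on {-1/2..1/2}"
      by (intro integrable_continuous_interval continuous_on_compose continuous_intros
          continuous_on_subset[OF g_cont]) auto
  qed
  also have "integral {-1/2..1/2} (g \<circ> (+) s) = integral {-1/2..-1/2 + 1} g"
    using integral_period[OF g_cont per s(1,2), of "-1/2"] integral_shift_Icc_real[of "-1/2" "1/2" g s]
    by simp
  also have "\<dots> = fourier_coefficient \<alpha> n x"
    by (simp add: fourier_coefficient_def g_def[abs_def])
  finally show ?thesis .
qed

lemma fourier_coefficient_mem_spectral: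
  assumes "complex_subspace B" "closed B" "invariant \<alpha> B" "x \<in> B"
  shows "fourier_coefficient \<alpha> n x \<in> spectral_subspace \<alpha> B n"
  using fourier_coefficient_mem[OF assms] action_fourier_coefficient
  by (simp add: spectral_subspace_def)

lemma fourier_coefficient_spectral:
  assumes x: "x \<in> spectral_subspace \<alpha> B n"
  shows "fourier_coefficient \<alpha> n x = x"
proof -
  have "cis (- (of_int n * (2 * pi * t))) *\<^sub>C \<alpha> (cis (2 * pi * t)) x = x" for t
    using x by (simp add: spectral_subspace_def cis_power_int scaleC_scaleC cis_mult)
  thus ?thesis by (simp add: fourier_coefficient_def)
qed

text \<open>
  The element \<open>x\<close> is approximated by averages of its orbit. The kernel \<open>cos (\<pi> t)\<^bsup>2N\<^esup>\<close> is a trigonometric polynomial of period 1 by the binomial theorem,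
  and after normalisation it concentrates at \<open>0\<close>: off the interval of radius \<open>d\<close> it is at most
  \<open>cos (\<pi> d)\<^bsup>2N\<^esup>\<close>, while its integral is at least \<open>d cos (\<pi> d / 2)\<^bsup>2N\<^esup>\<close>.
\<close>

lemma mem_closed_subspace_of_fourier_coefficients:
  assumes V: "complex_subspace V" "closed V" and x: "\<And>n. fourier_coefficient \<alpha> n x \<in> V"
  shows "x \<in> V"
proof -
  define K where "K N t = cos (pi * t) ^ (2 * N)" for N :: nat and t :: real
  define c where "c N = integral {-1/2..1/2} (K N)" for N
  define S where "S N = integral {-1/2..1/2} (\<lambda>t. of_real (K N t) *\<^sub>C \<alpha> (cis (2 * pi * t)) x)" for N
  have K_cont: "continuous_on A (K N)" for A N unfolding K_def by (intro continuous_intros)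
  have K_int: "K N integrable_on {a..b}" for N a b by (intro integrable_continuous_interval K_cont)
  have K0: "0 \<le> K N t" for N t by (simp add: K_def power_mult)
  have S_mem: "S N \<in> V" for N
  proof -
    define b where "b k = complex_of_real (real (2 * N choose k) / 4 ^ N)" for k
    have expand: "of_real (K N t) = (\<Sum>k\<le>2 * N. b k * cis (- (of_int (int N - int k) * (2 * pi * t))))"
      for t
    proof -
      have "complex_of_real (cos (pi * t)) = (cis (pi * t) + cis (- (pi * t))) / 2"
        by (simp add: complex_eq_iff)
      hence "complex_of_real (K N t) = (cis (pi * t) + cis (- (pi * t))) ^ (2 * N) / 2 ^ (2 * N)"
        by (simp only: K_def of_real_power power_divide)
      also have "\<dots> = (cis (pi * t) + cis (- (pi * t))) ^ (2 * N) / 4 ^ N"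
        by (simp add: power_mult)
      also have "(cis (pi * t) + cis (- (pi * t))) ^ (2 * N)
          = (\<Sum>k\<le>2 * N. of_nat (2 * N choose k) * cis (pi * t) ^ k * cis (- (pi * t)) ^ (2 * N - k))"
        by (rule binomial_ring)
      also have "\<dots> = (\<Sum>k\<le>2 * N. of_nat (2 * N choose k) * cis (- (of_int (int N - int k) * (2 * pi * t))))"
      proof (rule sum.cong)
        fix k assume "k \<in> {..2 * N}"
        hence "real (2 * N - k) = 2 * real N - real k" by simp
        hence "cis (pi * t) ^ k * cis (- (pi * t)) ^ (2 * N - k) = cis (- (of_int (int N - int k) * (2 * pi * t)))"
          by (simp add: Complex.DeMoivre cis_mult algebra_simps)
        thus "of_nat (2 * N choose k) * cis (pi * t) ^ k * cis (- (pi * t)) ^ (2 * N - k)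
            = of_nat (2 * N choose k) * cis (- (of_int (int N - int k) * (2 * pi * t)))"
          by (simp add: mult.assoc)
      qed simp
      finally show ?thesis by (simp add: b_def sum_divide_distrib)
    qed
    have "S N = integral {-1/2..1/2} (\<lambda>t. \<Sum>k\<le>2 * N. b k *\<^sub>C
        (cis (- (of_int (int N - int k) * (2 * pi * t))) *\<^sub>C \<alpha> (cis (2 * pi * t)) x))"
      unfolding S_def expand
      by (simp only: bounded_bilinear.sum_left[OF bounded_bilinear_scaleC] scaleC_scaleC)
    also have "\<dots> = (\<Sum>k\<le>2 * N. integral {-1/2..1/2} (\<lambda>t. b k *\<^sub>C
        (cis (- (of_int (int N - int k) * (2 * pi * t))) *\<^sub>C \<alpha> (cis (2 * pi * t)) x)))"
      unfolding scaleC_scaleC by (intro integral_sum integrable_action continuous_intros) auto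
    also have "\<dots> = (\<Sum>k\<le>2 * N. b k *\<^sub>C fourier_coefficient \<alpha> (int N - int k) x)"
    proof (rule sum.cong)
      fix k
      show "integral {-1/2..1/2} (\<lambda>t. b k *\<^sub>C
          (cis (- (of_int (int N - int k) * (2 * pi * t))) *\<^sub>C \<alpha> (cis (2 * pi * t)) x))
          = b k *\<^sub>C fourier_coefficient \<alpha> (int N - int k) x"
        unfolding fourier_coefficient_def
        using integral_linear[OF integrable_fourier[of "int N - int k" x "-1/2" "1/2"]
            bounded_linear_scaleC[of "b k"]] by (simp add: o_def)
    qed simp
    finally show ?thesis
      by (simp only:) (intro complex_subspace_sum[OF V(1)] complex_subspaceD(3)[OF V(1)] x)
  qed
  have "\<exists>y\<in>V. dist y x < e" if e: "e > 0" for e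
  proof -
    have "continuous_on UNIV (\<lambda>t. \<alpha> (cis (2 * pi * t)) x)" by (rule continuous_on_action)
    hence "\<forall>e>0. \<exists>d>0. \<forall>t. dist t 0 < d \<longrightarrow> dist (\<alpha> (cis (2 * pi * t)) x) (\<alpha> (cis (2 * pi * 0)) x) < e"
      unfolding continuous_on_iff by (metis UNIV_I)
    then obtain d' where d': "d' > 0"
        "\<And>t. dist t 0 < d' \<Longrightarrow> dist (\<alpha> (cis (2 * pi * t)) x) (\<alpha> (cis (2 * pi * 0)) x) < e / 2"
      using e by (meson half_gt_zero)
    define d where "d = min d' (1/4)"
    have d: "d > 0" "d \<le> 1/4" "\<And>t. \<bar>t\<bar> < d \<Longrightarrow> norm (\<alpha> (cis (2 * pi * t)) x - x) < e / 2"
      using d' by (auto simp: d_def dist_norm action_one)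
    define q r where "q = (cos (pi * d))\<^sup>2" and "r = (cos (pi * d / 2))\<^sup>2"
    have cos_mono: "cos (pi * s) \<le> cos (pi * t)" "0 \<le> cos (pi * s)" if "0 \<le> t" "t \<le> s" "s \<le> 1/2" for s t
    proof -
      have *: "0 \<le> pi * t" "pi * t \<le> pi * s" "pi * s \<le> pi * (1/2)"
        using that by (auto intro!: mult_left_mono)
      show "cos (pi * s) \<le> cos (pi * t)"
        by (rule cos_monotone_0_pi_le) (use * pi_gt_zero in linarith)+
      show "0 \<le> cos (pi * s)"
        by (rule cos_ge_zero) (use * pi_gt_zero in linarith)+
    qed
    have "cos (pi * d) < cos (pi * (d / 2))"
      by (rule cos_monotone_0_pi) (use d in auto)
    hence qr: "0 \<le> q" "q < r" "0 < r"
      using cos_mono(2)[of 0 d] d by (auto simp: q_def r_def power_strict_mono)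
    have K_far: "K N t \<le> q ^ N" if "d \<le> \<bar>t\<bar>" "\<bar>t\<bar> \<le> 1/2" for N t
    proof -
      have "(cos (pi * \<bar>t\<bar>))\<^sup>2 \<le> q" unfolding q_def
        using cos_mono[of d "\<bar>t\<bar>"] that d by (intro power_mono) auto
      moreover have "cos (pi * \<bar>t\<bar>) = cos (pi * t)" by (simp add: abs_if)
      ultimately show ?thesis by (simp add: K_def power_mult power_mono)
    qed
    have K_near: "r ^ N \<le> K N t" if "\<bar>t\<bar> \<le> d / 2" for N t
    proof -
      have "r \<le> (cos (pi * \<bar>t\<bar>))\<^sup>2" unfolding r_def
        using cos_mono[of "\<bar>t\<bar>" "d / 2"] cos_mono(2)[of 0 "d / 2"] that d by (intro power_mono) auto
      moreover have "cos (pi * \<bar>t\<bar>) = cos (pi * t)" by (simp add: abs_if)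
      ultimately show ?thesis using qr by (simp add: K_def power_mult power_mono)
    qed
    have c_ge: "d * r ^ N \<le> c N" for N
    proof -
      have "d * r ^ N = integral {-d/2..d/2} (\<lambda>t. r ^ N)" using d by simp
      also have "\<dots> \<le> integral {-d/2..d/2} (K N)"
        by (intro integral_le K_int K_near) (auto simp: abs_le_iff)
      also have "\<dots> \<le> c N" unfolding c_def
        by (intro integral_subset_le K_int) (use d K0 in auto)
      finally show ?thesis .
    qed
    have c_pos: "c N > 0" for N using c_ge[of N] d qr by (smt (verit) mult_pos_pos zero_less_power)
    have bound: "norm (S N - c N *\<^sub>R x) \<le> c N * (e / 2) + 2 * norm x * q ^ N" for N
    proof -
      have "c N *\<^sub>R x = integral {-1/2..1/2} (\<lambda>t. of_real (K N t) *\<^sub>C x)"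
        using integral_linear[OF K_int bounded_linear_scaleR_left[of x], of "-1/2" "1/2" N]
        by (simp add: c_def o_def scaleR_scaleC)
      moreover have "(\<lambda>t. of_real (K N t) *\<^sub>C x) integrable_on {-1/2..1/2}"
        by (intro integrable_continuous_interval continuous_intros K_cont)
      ultimately have "S N - c N *\<^sub>R x
          = integral {-1/2..1/2} (\<lambda>t. of_real (K N t) *\<^sub>C (\<alpha> (cis (2 * pi * t)) x - x))"
        unfolding S_def scaleC_diff_right
        by (subst integral_diff) (auto intro!: integrable_action continuous_intros K_cont)
      also have "norm \<dots> \<le> integral {-1/2..1/2} (\<lambda>t. K N t * (e / 2) + 2 * norm x * q ^ N)"
      proof (rule integral_norm_bound_integral)
        show "(\<lambda>t. of_real (K N t) *\<^sub>C (\<alpha> (cis (2 * pi * t)) x - x)) integrable_on {-1/2..1/2}"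
          by (intro integrable_continuous_interval continuous_intros K_cont continuous_on_action)
        show "(\<lambda>t. K N t * (e / 2) + 2 * norm x * q ^ N) integrable_on {-1/2..1/2}"
          by (intro integrable_continuous_interval continuous_intros K_cont)
        fix t :: real assume t: "t \<in> {-1/2..1/2}"
        show "norm (of_real (K N t) *\<^sub>C (\<alpha> (cis (2 * pi * t)) x - x)) \<le> K N t * (e / 2) + 2 * norm x * q ^ N"
        proof (cases "\<bar>t\<bar> < d")
          case True
          have "K N t * norm (\<alpha> (cis (2 * pi * t)) x - x) \<le> K N t * (e / 2)"
            using d(3)[OF True] K0 by (intro mult_left_mono) auto
          moreover have "0 \<le> 2 * norm x * q ^ N" using qr by simp
          ultimately show ?thesis using K0[of N t] by (simp add: norm_scaleC)
        next
          case False
          have "norm (\<alpha> (cis (2 * pi * t)) x - x) \<le> norm x + norm x"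
            by (intro norm_triangle_le_diff add_mono norm_action_le) auto
          hence "K N t * norm (\<alpha> (cis (2 * pi * t)) x - x) \<le> q ^ N * (2 * norm x)"
            using K_far[of t N] False t K0[of N t] qr by (intro mult_mono) auto
          moreover have "0 \<le> K N t * (e / 2)" using K0[of N t] e by simp
          ultimately show ?thesis using K0[of N t] by (simp add: norm_scaleC mult_ac)
        qed
      qed
      also have "\<dots> = c N * (e / 2) + 2 * norm x * q ^ N"
      proof -
        have "integral {-1/2..1/2} (\<lambda>t. K N t * (e / 2)) = c N * (e / 2)"
          unfolding c_def by (rule integral_mult_left)
        moreover have "integral {-1/2..1/2} (\<lambda>t. K N t * (e / 2) + 2 * norm x * q ^ N)
            = integral {-1/2..1/2} (\<lambda>t. K N t * (e / 2)) + integral {-1/2..1/2::real} (\<lambda>t. 2 * norm x * q ^ N)"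
          by (intro integral_add integrable_continuous_interval continuous_intros K_cont)
        ultimately show ?thesis by simp
      qed
      finally show ?thesis .
    qed
    have "(\<lambda>N. (2 * norm x / d) * (q / r) ^ N) \<longlonglongrightarrow> (2 * norm x / d) * 0"
      using qr by (intro tendsto_intros LIMSEQ_power_zero) auto
    hence "\<forall>\<^sub>F N in sequentially. (2 * norm x / d) * (q / r) ^ N < e / 2"
      using e by (intro order_tendstoD(2)) auto
    then obtain N where N: "(2 * norm x / d) * (q / r) ^ N < e / 2"
      by (auto simp: eventually_sequentially)
    have "norm ((1 / c N) *\<^sub>R S N - x) = norm (S N - c N *\<^sub>R x) / c N"
    proof -
      have "(1 / c N) *\<^sub>R S N - x = (1 / c N) *\<^sub>R (S N - c N *\<^sub>R x)"
        using c_pos[of N] by (simp add: scaleR_right_diff_distrib)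
      thus ?thesis using c_pos[of N] by simp
    qed
    also have "\<dots> \<le> (c N * (e / 2) + 2 * norm x * q ^ N) / c N"
      using bound[of N] c_pos[of N] by (intro divide_right_mono) auto
    also have "\<dots> = e / 2 + 2 * norm x * q ^ N / c N"
      using c_pos[of N] by (simp add: add_divide_distrib)
    also have "\<dots> \<le> e / 2 + 2 * norm x * q ^ N / (d * r ^ N)"
      using c_ge[of N] d qr by (intro add_left_mono divide_left_mono) (auto intro!: mult_pos_pos c_pos)
    also have "\<dots> = e / 2 + (2 * norm x / d) * (q / r) ^ N" by (simp add: power_divide)
    also have "\<dots> < e" using N by simp
    finally have "dist ((1 / c N) *\<^sub>R S N) x < e" by (simp add: dist_norm)
    moreover have "(1 / c N) *\<^sub>R S N \<in> V" by (intro complex_subspaceD(5)[OF V(1)] S_mem)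
    ultimately show ?thesis by blast
  qed
  thus ?thesis using V(2) by (metis closed_approachable)
qed

end

section \<open>Closed products of subspaces\<close>

definition closed_subspace :: "'a::cstar_algebra set \<Rightarrow> bool" where
  "closed_subspace V \<longleftrightarrow> complex_subspace V \<and> closed V"

lemma closed_subspaceD:
  assumes "closed_subspace V"
  shows "complex_subspace V" "closed V"
  using assms by (auto simp: closed_subspace_def)

lemma closed_subspace_cstar_subalgebra: "cstar_subalgebra B \<Longrightarrow> closed_subspace B"
  by (auto simp: closed_subspace_def cstar_subalgebra_def)

lemma closed_subspace_zero: "closed_subspace {0}"
  by (auto simp: closed_subspace_def complex_subspace_def)

lemma closed_subspace_closure:
  assumes V: "complex_subspace V"
  shows "closed_subspace (closure V)"
proof -
  have add: "x + y \<in> closure V" if xy: "x \<in> closure V" "y \<in> closure V" for x y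
  proof -
    obtain f g where "\<forall>n. f n \<in> V" "f \<longlonglongrightarrow> x" "\<forall>n. g n \<in> V" "g \<longlonglongrightarrow> y"
      using xy unfolding closure_sequential by blast
    thus ?thesis unfolding closure_sequential
      by (intro exI[of _ "\<lambda>n. f n + g n"]) (auto intro: tendsto_add complex_subspaceD(2)[OF V])
  qed
  have scale: "c *\<^sub>C x \<in> closure V" if x: "x \<in> closure V" for c x
  proof -
    obtain f where "\<forall>n. f n \<in> V" "f \<longlonglongrightarrow> x" using x unfolding closure_sequential by blast
    thus ?thesis unfolding closure_sequential
      by (intro exI[of _ "\<lambda>n. c *\<^sub>C f n"])
         (auto intro: bounded_linear.tendsto[OF bounded_linear_scaleC] complex_subspaceD(3)[OF V])
  qed
  have "0 \<in> closure V" using complex_subspaceD(1)[OF V] closure_subset by blast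
  with add scale show ?thesis by (simp add: closed_subspace_def complex_subspace_def)
qed

lemma closed_subspace_vimage:
  assumes Z: "closed_subspace Z" and f: "bounded_linear f"
    and \<sigma>: "\<And>c x. f (c *\<^sub>C x) = \<sigma> c *\<^sub>C f x"
  shows "closed_subspace {x. f x \<in> Z}"
proof -
  note ZD = complex_subspaceD[OF closed_subspaceD(1)[OF Z]]
  have "closed (f -` Z)"
    by (intro closed_vimage closed_subspaceD(2)[OF Z] linear_continuous_on f)
  moreover have "f (x + y) = f x + f y" for x y using f by (simp add: linear_simps)
  moreover have "f 0 = 0" using f by (simp add: linear_simps)
  ultimately show ?thesis using ZD(1-3)
    by (simp add: closed_subspace_def complex_subspace_def vimage_def \<sigma>)
qed

lemma closed_subspace_vimage_mult_left: "closed_subspace Z \<Longrightarrow> closed_subspace {x. a * x \<in> Z}"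
  by (rule closed_subspace_vimage[where \<sigma> = "\<lambda>c. c"]) (auto intro: bounded_linear_mult_right simp: mult_scaleC_right)

lemma closed_subspace_vimage_mult_right: "closed_subspace Z \<Longrightarrow> closed_subspace {x. x * a \<in> Z}"
  by (rule closed_subspace_vimage[where \<sigma> = "\<lambda>c. c"]) (auto intro: bounded_linear_mult_left simp: mult_scaleC_left)

lemma closed_subspace_vimage_star: "closed_subspace Z \<Longrightarrow> closed_subspace {x. star x \<in> Z}"
  by (rule closed_subspace_vimage[where \<sigma> = cnj]) (auto intro: bounded_linear_star simp: star_scaleC)

lemma closed_product_mem: "x \<in> X \<Longrightarrow> y \<in> Y \<Longrightarrow> x * y \<in> closed_product X Y"
  unfolding closed_product_def
  by (rule subsetD[OF closure_subset], intro CollectI exI[of _ "1::nat"] exI[of _ "\<lambda>_. x"] exI[of _ "\<lambda>_. y"])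
     simp

lemma closed_product_least:
  assumes Z: "closed_subspace Z" and "\<And>x y. x \<in> X \<Longrightarrow> y \<in> Y \<Longrightarrow> x * y \<in> Z"
  shows "closed_product X Y \<subseteq> Z"
  unfolding closed_product_def
  by (intro closure_minimal closed_subspaceD(2)[OF Z])
     (use assms(2) in \<open>auto intro!: complex_subspace_sum[OF closed_subspaceD(1)[OF Z]]\<close>)

lemma closed_closed_product: "closed (closed_product X Y)"
  by (simp add: closed_product_def)

lemma closed_subspace_closed_product:
  assumes X: "complex_subspace X"
  shows "closed_subspace (closed_product X Y)"
proof -
  let ?S = "{\<Sum>i<k. x i * y i |(k::nat) x y. \<forall>i<k. x i \<in> X \<and> y i \<in> Y}"
  have "complex_subspace ?S"
    unfolding complex_subspace_def
  proof (intro conjI ballI allI)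
    show "0 \<in> ?S" by (intro CollectI exI[of _ "0::nat"]) simp
  next
    fix a b assume "a \<in> ?S" "b \<in> ?S"
    then obtain k l x y x' y' where a: "a = (\<Sum>i<(k::nat). x i * y i)" "\<forall>i<k. x i \<in> X \<and> y i \<in> Y"
      and b: "b = (\<Sum>i<(l::nat). x' i * y' i)" "\<forall>i<l. x' i \<in> X \<and> y' i \<in> Y" by blast
    let ?x = "\<lambda>i. if i < k then x i else x' (i - k)" and ?y = "\<lambda>i. if i < k then y i else y' (i - k)"
    have "(\<Sum>i<k + l. ?x i * ?y i) = (\<Sum>i<k. ?x i * ?y i) + (\<Sum>i\<in>{k..<k + l}. ?x i * ?y i)"
      by (subst sum.union_disjoint[symmetric]) (auto intro: sum.cong)
    also have "(\<Sum>i\<in>{k..<k + l}. ?x i * ?y i) = (\<Sum>i<l. x' i * y' i)"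
      by (rule sum.reindex_bij_witness[of _ "\<lambda>i. i + k" "\<lambda>i. i - k"]) auto
    finally have "a + b = (\<Sum>i<k + l. ?x i * ?y i)" by (simp add: a b)
    moreover have "\<forall>i<k + l. ?x i \<in> X \<and> ?y i \<in> Y" using a(2) b(2) by auto
    ultimately show "a + b \<in> ?S"
      by (intro CollectI exI[of _ "k + l"] exI[of _ ?x] exI[of _ ?y] conjI)
  next
    fix c a assume "a \<in> ?S"
    then obtain k x y where a: "a = (\<Sum>i<(k::nat). x i * y i)" "\<forall>i<k. x i \<in> X \<and> y i \<in> Y" by blast
    have "c *\<^sub>C a = (\<Sum>i<k. (c *\<^sub>C x i) * y i)"
      by (simp add: a bounded_bilinear.sum_right[OF bounded_bilinear_scaleC] mult_scaleC_left)
    moreover have "\<forall>i<k. c *\<^sub>C x i \<in> X \<and> y i \<in> Y" using a(2) complex_subspaceD(3)[OF X] by auto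
    ultimately show "c *\<^sub>C a \<in> ?S" by (intro CollectI exI[of _ k] exI[of _ "\<lambda>i. c *\<^sub>C x i"] exI[of _ y]) auto
  qed
  thus ?thesis unfolding closed_product_def by (rule closed_subspace_closure)
qed

lemma closed_product_mono: "X \<subseteq> X' \<Longrightarrow> Y \<subseteq> Y' \<Longrightarrow> closed_product X Y \<subseteq> closed_product X' Y'"
  unfolding closed_product_def by (rule closure_mono) blast

text \<open>
  Membership of a product in a closed subspace is a closed linear condition on each factor, so it
  suffices to check it on generators. This also underlies most of the later computations.
\<close>

lemma closed_product_assoc:
  assumes X: "complex_subspace X" and Y: "complex_subspace Y"
  shows "closed_product (closed_product X Y) Z = closed_product X (closed_product Y Z)"
proof (rule antisym)
  have L: "closed_subspace (closed_product (closed_product X Y) Z)"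
    by (intro closed_subspace_closed_product closed_subspaceD(1)[OF closed_subspace_closed_product[OF X]])
  have R: "closed_subspace (closed_product X (closed_product Y Z))"
    by (intro closed_subspace_closed_product X)
  show "closed_product (closed_product X Y) Z \<subseteq> closed_product X (closed_product Y Z)"
  proof (rule closed_product_least[OF R])
    fix w z assume w: "w \<in> closed_product X Y" and z: "z \<in> Z"
    have "closed_product X Y \<subseteq> {w. w * z \<in> closed_product X (closed_product Y Z)}"
      using z by (intro closed_product_least closed_subspace_vimage_mult_right R)
                 (auto simp: mult.assoc intro!: closed_product_mem)
    thus "w * z \<in> closed_product X (closed_product Y Z)" using w by blast
  qed
  show "closed_product X (closed_product Y Z) \<subseteq> closed_product (closed_product X Y) Z"
  proof (rule closed_product_least[OF L])
    fix x w assume x: "x \<in> X" and w: "w \<in> closed_product Y Z"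
    have "closed_product Y Z \<subseteq> {w. x * w \<in> closed_product (closed_product X Y) Z}"
      using x by (intro closed_product_least closed_subspace_vimage_mult_left L)
                 (auto simp flip: mult.assoc intro!: closed_product_mem)
    thus "x * w \<in> closed_product (closed_product X Y) Z" using w by blast
  qed
qed

lemma star_closed_product:
  assumes "w \<in> closed_product X Y" and Y': "complex_subspace Y'"
    and "\<And>y. y \<in> Y \<Longrightarrow> star y \<in> Y'" "\<And>x. x \<in> X \<Longrightarrow> star x \<in> X'"
  shows "star w \<in> closed_product Y' X'"
proof -
  have "closed_product X Y \<subseteq> {w. star w \<in> closed_product Y' X'}"
    using assms(3,4)
    by (intro closed_product_least closed_subspace_vimage_star closed_subspace_closed_product Y')
       (auto simp: star_mult intro!: closed_product_mem)
  thus ?thesis using assms(1) by blast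
qed

lemma closed_product_zero_iff:
  assumes "complex_subspace X"
  shows "closed_product X Y \<subseteq> {0} \<longleftrightarrow> (\<forall>x\<in>X. \<forall>y\<in>Y. x * y = 0)"
  using closed_product_least[OF closed_subspace_zero, of X Y] closed_product_mem[of _ X _ Y] by blast

lemma mem_closed_product_right:
  assumes B: "cstar_subalgebra B" and x: "x \<in> X" "star x * x \<in> B"
  shows "x \<in> closed_product X B"
proof -
  have "\<exists>y\<in>closed_product X B. dist y x < e" if e: "e > 0" for e
  proof -
    obtain u where "u \<in> B" "norm (x - x * u) < e"
      using approximate_right_unit[OF B x(2) e] by metis
    thus ?thesis using closed_product_mem[OF x(1)] by (intro bexI[of _ "x * u"]) (auto simp: dist_norm norm_minus_commute)
  qed
  thus ?thesis by (metis closed_approachable closed_closed_product)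
qed

lemma mem_closed_product_left:
  assumes B: "cstar_subalgebra B" and x: "x \<in> X" "x * star x \<in> B"
  shows "x \<in> closed_product B X"
proof -
  have "star x \<in> closed_product {star x} B"
    by (rule mem_closed_product_right[OF B]) (use x in \<open>auto simp: star_star\<close>)
  hence "star (star x) \<in> closed_product B X"
    by (rule star_closed_product) (use x cstar_subalgebraD[OF B] in \<open>auto simp: star_star\<close>)
  thus ?thesis by (simp add: star_star)
qed

lemma closed_product_cstar_subalgebra_self:
  assumes "cstar_subalgebra B"
  shows "closed_product B B = B"
proof (rule antisym)
  note BD = cstar_subalgebraD[OF assms]
  show "closed_product B B \<subseteq> B"
    by (intro closed_product_least closed_subspace_cstar_subalgebra assms BD)
  show "B \<subseteq> closed_product B B"
    using mem_closed_product_right[OF assms] BD by blast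
qed

lemma closed_idealD:
  assumes "closed_ideal I B"
  shows "I \<subseteq> B" "complex_subspace I" "closed I" "\<And>b x. b \<in> B \<Longrightarrow> x \<in> I \<Longrightarrow> b * x \<in> I"
    "\<And>b x. b \<in> B \<Longrightarrow> x \<in> I \<Longrightarrow> x * b \<in> I" "closed_subspace I"
  using assms by (auto simp: closed_ideal_def closed_subspace_def)

text \<open>
  Self-adjointness is the point. An element \<open>x\<close> of the ideal has \<open>star x\<close> as a limit of
  products \<open>star x * u\<close>, where \<open>u\<close> is built from \<open>x * star x\<close> and lies in the ideal.
\<close>

lemma closed_ideal_imp_cstar_subalgebra:
  assumes B: "cstar_subalgebra B" and I: "closed_ideal I B"
  shows "cstar_subalgebra I"
proof -
  note BD = cstar_subalgebraD[OF B] and ID = closed_idealD[OF I]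
  define K where "K = I \<inter> {z. star z \<in> I}"
  have K: "cstar_subalgebra K"
    using ID(1-5) closed_subspaceD[OF closed_subspace_vimage_star[OF ID(6)]]
    by (auto simp: K_def cstar_subalgebra_def complex_subspace_def star_add star_scaleC star_mult star_star)
  have "star x \<in> I" if x: "x \<in> I" for x
  proof -
    have xB: "star x \<in> B" using x ID(1) BD(4) by blast
    have "x * star x \<in> K" using ID(5)[OF xB x] by (simp add: K_def star_mult star_star)
    hence "star x \<in> closed_product {star x} K"
      by (intro mem_closed_product_right[OF K]) (simp_all add: star_star)
    moreover have "closed_product {star x} K \<subseteq> I"
      by (rule closed_product_least[OF ID(6)]) (use xB ID(4) in \<open>auto simp: K_def\<close>)
    ultimately show ?thesis by blast
  qed
  thus ?thesis using ID(1-5) by (auto simp: cstar_subalgebra_def)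
qed

section \<open>Hereditary subalgebras\<close>

text \<open>
  For a C*-subalgebra \<open>I\<close> of \<open>B\<close>, the smallest hereditary subalgebra of \<open>B\<close> that contains it,
  as the intersection of a closed left ideal with its adjoint.
\<close>

definition hereditary_hull :: "'a::cstar_algebra set \<Rightarrow> 'a set \<Rightarrow> 'a set" where
  "hereditary_hull B I = {x \<in> closed_product B I. star x \<in> closed_product B I}"

text \<open>
  One approximate unit for several elements: if \<open>u\<close> serves the first ones and \<open>v\<close> serves
  \<open>y - y * u\<close> for the next element \<open>y\<close>, then \<open>1 - (1 - u) (1 - v)\<close> serves all of them.
\<close>

lemma approximate_right_unit_finite:
  fixes y :: "nat \<Rightarrow> 'a::cstar_algebra"
  assumes I: "cstar_subalgebra I" and e: "e > 0"
  shows "(\<forall>i<k. y i \<in> I) \<Longrightarrow>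
    \<exists>u\<in>I. (\<forall>i<k. norm (y i - y i * u) < e) \<and> (\<forall>z. norm (z - z * u) \<le> norm z)"
proof (induction k)
  case 0
  thus ?case using complex_subspaceD(1)[OF cstar_subalgebraD(1)[OF I]] by (intro bexI[of _ 0]) auto
next
  case (Suc k)
  note ID = cstar_subalgebraD[OF I] and IV = complex_subspaceD[OF cstar_subalgebraD(1)[OF I]]
  obtain u where u: "u \<in> I" "\<And>i. i < k \<Longrightarrow> norm (y i - y i * u) < e" "\<And>z. norm (z - z * u) \<le> norm z"
    using Suc by (metis less_Suc_eq)
  define x where "x = y k - y k * u"
  have "x \<in> I" using Suc.prems u(1) ID(3) IV(4) by (simp add: x_def)
  hence "star x * x \<in> I" by (intro ID)
  then obtain v where v: "v \<in> I" "norm (x - x * v) < e" "\<And>z. norm (z - z * v) \<le> norm z"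
    using approximate_right_unit[OF I _ e] by metis
  define w where "w = u + v - u * v"
  have w: "z - z * w = (z - z * u) - (z - z * u) * v" for z
    by (simp add: w_def algebra_simps)
  have "norm (z - z * w) \<le> norm (z - z * u)" for z unfolding w by (rule v(3))
  hence "norm (z - z * w) \<le> norm z" "i < k \<Longrightarrow> norm (y i - y i * w) < e" for z i
    using u(2,3) by (meson order_trans order_le_less_trans)+
  moreover have "norm (y k - y k * w) < e" unfolding w using v(2) by (simp add: x_def)
  moreover have "w \<in> I" unfolding w_def by (intro IV ID u v)
  ultimately show ?case by (auto simp: less_Suc_eq)
qed

lemma approximate_right_unit_closed_product:
  assumes I: "cstar_subalgebra I" and d: "d \<in> closed_product B I" and e: "e > 0"
  obtains u where "u \<in> I" "norm (d - d * u) < e" "\<And>z. norm (z - z * u) \<le> norm z"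
proof -
  have "e / 3 > 0" using e by simp
  from d[unfolded closed_product_def closure_approachable, rule_format, OF this]
  obtain d' where d': "dist d' d < e / 3"
    and "d' \<in> {\<Sum>i<k. x i * y i |(k::nat) x y. \<forall>i<k. x i \<in> B \<and> y i \<in> I}" by blast
  then obtain k x y where xy: "d' = (\<Sum>i<(k::nat). x i * y i)" "\<forall>i<k. x i \<in> B \<and> y i \<in> I" by blast
  define M where "M = (\<Sum>i<k. norm (x i)) + 1"
  have M: "M > 0" by (auto simp: M_def intro!: add_nonneg_pos sum_nonneg)
  obtain u where u: "u \<in> I" "\<And>i. i < k \<Longrightarrow> norm (y i - y i * u) < e / (3 * M)" "\<And>z. norm (z - z * u) \<le> norm z"
    using approximate_right_unit_finite[OF I, of "e / (3 * M)" k y] xy(2) e M by auto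
  have "d' - d' * u = (\<Sum>i<k. x i * (y i - y i * u))"
    by (simp add: xy(1) sum_distrib_right sum_subtractf right_diff_distrib mult.assoc)
  also have "norm \<dots> \<le> (\<Sum>i<k. norm (x i) * (e / (3 * M)))"
    using u(2) by (intro sum_norm_le order_trans[OF norm_mult_ineq] mult_left_mono) (auto intro: less_imp_le)
  also have "\<dots> = (\<Sum>i<k. norm (x i)) * (e / (3 * M))" by (simp only: sum_distrib_right)
  also have "\<dots> \<le> M * (e / (3 * M))" using e M by (intro mult_right_mono) (auto simp: M_def)
  also have "\<dots> = e / 3" using M by simp
  finally have 1: "norm (d' - d' * u) \<le> e / 3" .
  have 2: "norm ((d - d') - (d - d') * u) \<le> norm (d - d')" by (rule u(3))
  have "norm (d - d') < e / 3" using d' by (simp add: dist_norm norm_minus_commute)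
  moreover have "d - d * u = (d' - d' * u) + ((d - d') - (d - d') * u)" by (simp add: algebra_simps)
  hence "norm (d - d * u) \<le> norm (d' - d' * u) + norm ((d - d') - (d - d') * u)"
    by (simp only: norm_triangle_ineq)
  ultimately have "norm (d - d * u) < e" using 1 2 e by linarith
  thus ?thesis using that u by blast
qed

lemma closed_product_left_ideal:
  assumes "cstar_subalgebra B" "b \<in> B" "x \<in> closed_product B I"
  shows "b * x \<in> closed_product B I"
proof -
  note BD = cstar_subalgebraD[OF assms(1)]
  have "closed_product B I \<subseteq> {x. b * x \<in> closed_product B I}"
    using assms(2) BD(3)
    by (intro closed_product_least closed_subspace_vimage_mult_left closed_subspace_closed_product BD)
       (auto simp flip: mult.assoc intro!: closed_product_mem)
  thus ?thesis using assms(3) by blast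
qed

lemma closed_product_subset:
  assumes "cstar_subalgebra B" "X \<subseteq> B" "Y \<subseteq> B"
  shows "closed_product X Y \<subseteq> B"
  using assms closed_product_mono[of X B Y B] closed_product_cstar_subalgebra_self by blast

text \<open>
  If \<open>star b * b\<close> is below \<open>d\<close> and \<open>d\<close> is in the closed left ideal \<open>L\<close>, then so is \<open>b\<close>: with an
  approximate unit \<open>u\<close> for \<open>d\<close>, the norm of \<open>b * (1 - u)\<close> is controlled by that of
  \<open>star (1 - u) * d * (1 - u)\<close>.
\<close>

lemma hereditary_hull:
  assumes B: "cstar_subalgebra B" and I: "cstar_subalgebra I" "I \<subseteq> B"
  shows "hereditary_subalgebra (hereditary_hull B I) B"
proof -
  note BD = cstar_subalgebraD[OF B]
  let ?L = "closed_product B I"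
  have LB: "?L \<subseteq> B" by (rule closed_product_subset[OF B _ I(2)]) simp
  have L: "closed_subspace ?L" by (rule closed_subspace_closed_product[OF BD(1)])
  note LD = closed_subspaceD[OF L] closed_subspaceD[OF closed_subspace_vimage_star[OF L]]
  have hull: "hereditary_hull B I = ?L \<inter> {x. star x \<in> ?L}" by (auto simp: hereditary_hull_def)
  have cstar: "cstar_subalgebra (hereditary_hull B I)"
    unfolding cstar_subalgebra_def
  proof (intro conjI ballI)
    show "complex_subspace (hereditary_hull B I)"
      using LD(1,3) unfolding hull complex_subspace_def by blast
    show "closed (hereditary_hull B I)" unfolding hull by (intro closed_Int LD)
    show "x * y \<in> hereditary_hull B I" if "x \<in> hereditary_hull B I" "y \<in> hereditary_hull B I" for x y
      using that LB BD(4) closed_product_left_ideal[OF B, of _ _ I]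
      by (auto simp: hull star_mult)
    show "star x \<in> hereditary_hull B I" if "x \<in> hereditary_hull B I" for x
      using that by (simp add: hull star_star)
  qed
  have her: "a \<in> hereditary_hull B I"
    if a: "a \<in> positive_elements B" and d: "d \<in> positive_elements (hereditary_hull B I)"
      and da: "d - a \<in> positive_elements B" for a d
  proof -
    obtain b c where b: "b \<in> B" "a = star b * b" and c: "c \<in> B" "d - a = star c * c"
      using a da by (auto simp: positive_elements_def)
    have d_eq: "d = star b * b + star c * c" using b(2) c(2) by (simp add: algebra_simps)
    have dL: "d \<in> ?L" using d cstar_subalgebraD(3,4)[OF cstar] by (auto simp: positive_elements_def hull)
    have "\<exists>y\<in>?L. dist y b < e" if e: "e > 0" for e
    proof -
      obtain u where u: "u \<in> I" "norm (d - d * u) < e\<^sup>2" "\<And>z. norm (z - z * u) \<le> norm z"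
        using approximate_right_unit_closed_product[OF I(1) dL, of "e\<^sup>2"] e by auto
      (* both sides of d are multiplied by 1 - u, and the left factor is a contraction *)
      let ?b = "b - b * u" and ?c = "c - c * u" and ?d = "d - d * u"
      have "star ?b * ?b + star ?c * ?c = ?d - star u * ?d"
        by (simp add: d_eq star_diff star_mult algebra_simps)
      moreover have "norm (w - star u * w) = norm (star w - star w * u)" for w
        using norm_star[of "w - star u * w"] by (simp add: star_diff star_mult star_star del: norm_star)
      ultimately have "(norm ?b)\<^sup>2 \<le> norm ?d"
        using norm_le_norm_sum_of_positives[of ?b ?c] u(3)[of "star ?d"]
        unfolding norm_star by (simp only:)
      hence "norm ?b < e" using u(2) e by (simp add: power2_less_imp_less)
      thus ?thesis using closed_product_mem[OF b(1) u(1)]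
        by (intro bexI[of _ "b * u"]) (auto simp: dist_norm norm_minus_commute)
    qed
    hence "b \<in> ?L" using LD(2) by (metis closed_approachable)
    hence "a \<in> ?L" using closed_product_left_ideal[OF B BD(4)[OF b(1)]] by (simp add: b(2))
    thus ?thesis by (simp add: hull b(2) star_mult star_star)
  qed
  have "hereditary_hull B I \<subseteq> B" using LB by (auto simp: hull)
  with cstar her show ?thesis by (auto simp: hereditary_subalgebra_def)
qed

lemma polarization:
  fixes F :: "'a::cstar_algebra \<Rightarrow> 'a \<Rightarrow> 'a"
  assumes add: "\<And>x y z. F (x + y) z = F x z + F y z" "\<And>x y z. F z (x + y) = F z x + F z y"
    and scale: "\<And>c x y. F (c *\<^sub>C x) y = cnj c *\<^sub>C F x y" "\<And>c x y. F x (c *\<^sub>C y) = c *\<^sub>C F x y"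
  shows "4 *\<^sub>C F x y = F (y + x) (y + x) + (-1) *\<^sub>C F (y + (-1) *\<^sub>C x) (y + (-1) *\<^sub>C x)
    + \<i> *\<^sub>C F (y + \<i> *\<^sub>C x) (y + \<i> *\<^sub>C x) + (-\<i>) *\<^sub>C F (y + (-\<i>) *\<^sub>C x) (y + (-\<i>) *\<^sub>C x)"
proof -
  have "4 *\<^sub>C F x y = (1 + 1 + 1 + 1) *\<^sub>C F x y" by simp
  also have "\<dots> = F x y + F x y + F x y + F x y" by (simp only: scaleC_add_left scaleC_one)
  finally show ?thesis
    by (simp only: add scale) (simp add: scaleC_add_right scaleC_diff_right scaleC_scaleC scaleC_minus1 scaleC_minus_left scaleC_minus_right)
qed

lemma mem_of_polarization:
  fixes F :: "'a::cstar_algebra \<Rightarrow> 'a \<Rightarrow> 'a"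
  assumes V: "complex_subspace V" and X: "complex_subspace X"
    and F: "\<And>x y z. F (x + y) z = F x z + F y z" "\<And>x y z. F z (x + y) = F z x + F z y"
      "\<And>c x y. F (c *\<^sub>C x) y = cnj c *\<^sub>C F x y" "\<And>c x y. F x (c *\<^sub>C y) = c *\<^sub>C F x y"
    and diag: "\<And>x. x \<in> X \<Longrightarrow> F x x \<in> V" and xy: "x \<in> X" "y \<in> X"
  shows "F x y \<in> V"
proof -
  note VD = complex_subspaceD[OF V] and XD = complex_subspaceD[OF X]
  have "4 *\<^sub>C F x y \<in> V"
    by (subst polarization[of F, OF F]) (intro VD(2,3) diag XD(2,3) xy)
  hence "(1/4) *\<^sub>C 4 *\<^sub>C F x y \<in> V" by (rule VD(3))
  thus ?thesis by (simp add: scaleC_scaleC)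
qed

text \<open>
  For \<open>norm c < 1\<close> the element \<open>star d * (1 - star c * c) * d\<close> is positive, so
  \<open>star d * star c * c * d\<close> lies below \<open>star d * d\<close>. Polarization in \<open>c\<close> and then in \<open>d\<close> gives
  the general case, as products are dense in \<open>B\<close>.
\<close>

lemma hereditary_sandwich:
  assumes B: "cstar_subalgebra B" and D: "hereditary_subalgebra D B"
    and d: "d \<in> D" "e \<in> D" and c: "c \<in> B"
  shows "d * c * e \<in> D"
proof -
  note BD = cstar_subalgebraD[OF B]
  have Dc: "cstar_subalgebra D" and DB: "D \<subseteq> B" and
    her: "\<And>a d. a \<in> positive_elements B \<Longrightarrow> d \<in> positive_elements D \<Longrightarrow> d - a \<in> positive_elements B \<Longrightarrow> a \<in> D"
    using D by (auto simp: hereditary_subalgebra_def)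
  note DD = cstar_subalgebraD[OF Dc]
  note DV = complex_subspaceD[OF DD(1)]
  have sq1: "star (c * d) * (c * d) \<in> D" if c: "c \<in> B" "norm c < 1" and d: "d \<in> D" for c d
  proof -
    have "norm (star c * c) < 1"
      using c(2) by (simp add: norm_star_mult_self abs_square_less_1)
    then obtain r where r: "r \<in> B" "star r = r" "r + r - r * r = star c * c"
      using quasi_square_root[OF B BD(3)[OF BD(4)[OF c(1)] c(1)]] by (metis star_mult star_star)
    have "star d * d - star (c * d) * (c * d) = star d * d - star d * (r + r - r * r) * d"
      by (simp add: r(3) star_mult mult.assoc)
    also have "\<dots> = star (d - r * d) * (d - r * d)"
      by (simp add: star_diff star_mult r(2) algebra_simps)
    finally have eq: "star d * d - star (c * d) * (c * d) = star (d - r * d) * (d - r * d)" .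
    have dB: "d \<in> B" using d DB by blast
    have "d - r * d \<in> B" by (intro complex_subspaceD(4)[OF BD(1)] BD r dB)
    moreover have "c * d \<in> B" by (intro BD c dB)
    ultimately show ?thesis using d
      by (intro her[where d = "star d * d"]) (auto simp: positive_elements_def eq)
  qed
  have sq: "star (c * d) * (c * d) \<in> D" if c: "c \<in> B" and d: "d \<in> D" for c d
  proof -
    define t where "t = norm c + 1"
    have t: "t > 0" "norm c < t" by (auto simp: t_def add_nonneg_pos)
    have "t *\<^sub>R ((1 / t) *\<^sub>R c) = c" using t by simp
    have "star (((1 / t) *\<^sub>R c) * (t *\<^sub>R d)) * (((1 / t) *\<^sub>R c) * (t *\<^sub>R d)) \<in> D"
      using t by (intro sq1 complex_subspaceD(5)[OF BD(1)] DV c d) auto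
    thus ?thesis using t by simp
  qed
  have mid: "star x * star b * c * x \<in> D" if "b \<in> B" "c \<in> B" "x \<in> D" for b c x
    by (rule mem_of_polarization[where F = "\<lambda>b c. star x * star b * c * x", OF DD(1) BD(1)])
       (use sq that in \<open>auto simp: star_add star_scaleC star_mult mult_scaleC_left mult_scaleC_right
          distrib_left distrib_right mult.assoc\<close>)
  have mid': "star x * c * x \<in> D" if c: "c \<in> B" and x: "x \<in> D" for c x
  proof -
    have "B \<subseteq> closed_product B B" by (simp add: closed_product_cstar_subalgebra_self[OF B])
    also have "closed_product B B \<subseteq> {c. star x * (c * x) \<in> D}"
    proof (rule closed_product_least)
      have "closed_subspace {c. c \<in> {w. star x * w \<in> D}}"
        using closed_subspace_vimage_mult_left[OF closed_subspace_cstar_subalgebra[OF Dc]] by simp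
      thus "closed_subspace {c. star x * (c * x) \<in> D}"
        using closed_subspace_vimage_mult_right[of "{w. star x * w \<in> D}" x] by simp
      show "b * c \<in> {c. star x * (c * x) \<in> D}" if "b \<in> B" "c \<in> B" for b c
        using mid[OF BD(4)[OF that(1)] that(2) x] by (simp add: star_star mult.assoc)
    qed
    finally show ?thesis using c by (auto simp: mult.assoc)
  qed
  have "star (star d) * c * e \<in> D"
    by (rule mem_of_polarization[where F = "\<lambda>x y. star x * c * y", OF DD(1) DD(1)])
       (use mid' c d DD(4) in \<open>auto simp: star_add star_scaleC mult_scaleC_left mult_scaleC_right
          distrib_left distrib_right\<close>)
  thus ?thesis by (simp add: star_star)
qed

section \<open>Spectral subspaces\<close>

lemma spectral_subspace_subset: "spectral_subspace \<alpha> D n \<subseteq> D"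
  by (auto simp: spectral_subspace_def)

lemma fixed_points_subset_UNIV: "fixed_points \<alpha> B \<subseteq> fixed_points \<alpha> UNIV"
  by (auto simp: spectral_subspace_def)

context
  fixes \<alpha> :: "complex \<Rightarrow> 'a::cstar_algebra \<Rightarrow> 'a"
  assumes act: "circle_action \<alpha>"
begin

lemma closed_subspace_spectral:
  assumes D: "closed_subspace D"
  shows "closed_subspace (spectral_subspace \<alpha> D n)"
proof -
  have "spectral_subspace \<alpha> D n = D \<inter> (\<Inter>z\<in>unit_circle. {x. \<alpha> z x = (z powi n) *\<^sub>C x})"
    by (auto simp: spectral_subspace_def)
  moreover have "closed {x. \<alpha> z x = (z powi n) *\<^sub>C x}" if "z \<in> unit_circle" for z
    by (intro closed_Collect_eq linear_continuous_on bounded_linear_action[OF act that] bounded_linear_scaleC)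
  ultimately have "closed (spectral_subspace \<alpha> D n)"
    using closed_subspaceD(2)[OF D] by (auto intro!: closed_Int closed_INT)
  moreover have "\<alpha> z 0 = 0" if "z \<in> unit_circle" for z
    using bounded_linear_action[OF act that] by (simp add: linear_simps)
  hence "complex_subspace (spectral_subspace \<alpha> D n)"
    using complex_subspaceD(1-3)[OF closed_subspaceD(1)[OF D]]
    unfolding complex_subspace_def spectral_subspace_def
    by (auto simp: action_add[OF act] action_scaleC[OF act] scaleC_add_right scaleC_scaleC mult.commute)
  ultimately show ?thesis by (simp add: closed_subspace_def)
qed

lemma spectral_subspace_mult:
  assumes "cstar_subalgebra D" "x \<in> spectral_subspace \<alpha> D m" "y \<in> spectral_subspace \<alpha> D n"
  shows "x * y \<in> spectral_subspace \<alpha> D (m + n)"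
proof -
  have "z powi m * z powi n = z powi (m + n)" if "z \<in> unit_circle" for z :: complex
    using that by (intro power_int_add[symmetric]) auto
  thus ?thesis
    using assms cstar_subalgebraD(3)[OF assms(1)]
    by (auto simp: spectral_subspace_def action_mult[OF act] mult_scaleC_left mult_scaleC_right
        scaleC_scaleC mult.commute)
qed

lemma spectral_subspace_star:
  assumes "cstar_subalgebra D" "x \<in> spectral_subspace \<alpha> D n"
  shows "star x \<in> spectral_subspace \<alpha> D (- n)"
proof -
  have "cnj (z powi n) = z powi (- n)" if z: "z \<in> unit_circle" for z :: complex
  proof -
    obtain s where "z = cis (2 * pi * s)" using unit_circle_cis[OF z] .
    thus ?thesis by (simp add: cis_power_int cis_cnj)
  qed
  hence "\<alpha> z (star x) = (z powi (- n)) *\<^sub>C star x" if "z \<in> unit_circle" for z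
    using assms(2) that by (simp add: spectral_subspace_def action_star[OF act] star_scaleC)
  moreover have "star x \<in> D" using assms spectral_subspace_subset cstar_subalgebraD(4) by blast
  ultimately show ?thesis by (simp add: spectral_subspace_def)
qed

lemma star_image_spectral:
  assumes "cstar_subalgebra D"
  shows "star ` spectral_subspace \<alpha> D n = spectral_subspace \<alpha> D (- n)"
proof (rule antisym)
  show "star ` spectral_subspace \<alpha> D n \<subseteq> spectral_subspace \<alpha> D (- n)"
    using spectral_subspace_star[OF assms] by blast
  show "spectral_subspace \<alpha> D (- n) \<subseteq> star ` spectral_subspace \<alpha> D n"
    using spectral_subspace_star[OF assms, of _ "- n"] by (metis image_iff minus_minus star_star subsetI)
qed

lemma cstar_subalgebra_fixed_points:
  assumes D: "cstar_subalgebra D"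
  shows "cstar_subalgebra (fixed_points \<alpha> D)"
  unfolding cstar_subalgebra_def
  using closed_subspaceD[OF closed_subspace_spectral[OF closed_subspace_cstar_subalgebra[OF D]]]
    spectral_subspace_mult[OF D, of _ 0 _ 0] spectral_subspace_star[OF D, of _ 0] by auto

lemma spectral_subspaces_disjoint:
  assumes "x \<in> spectral_subspace \<alpha> D m" "x \<in> spectral_subspace \<alpha> D' n" "m \<noteq> n"
  shows "x = 0"
proof -
  define z where "z = cis (pi / of_int (m - n))"
  have z: "z \<in> unit_circle" by (simp add: z_def)
  have "z powi (m - n) = -1" using assms(3) by (simp add: z_def cis_power_int cis_pi)
  moreover have "z \<noteq> 0" by (simp add: z_def)
  ultimately have "z powi m / z powi n = - 1" by (simp add: power_int_diff)
  hence "z powi m = - (z powi n)" using \<open>z \<noteq> 0\<close> by (simp add: divide_eq_eq)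
  moreover have "(z powi m) *\<^sub>C x = (z powi n) *\<^sub>C x"
    using assms(1,2) z by (auto simp: spectral_subspace_def)
  ultimately have "(z powi n) *\<^sub>C x = - ((z powi n) *\<^sub>C x)" by (simp add: scaleC_minus_left)
  hence "(z powi n) *\<^sub>C x = 0" by (simp add: eq_neg_iff_add_eq_0 flip: scaleR_2)
  hence "cmod (z powi n) * norm x = 0" by (metis norm_scaleC norm_zero)
  thus ?thesis by (auto simp: z_def)
qed

lemma fourier_coefficient_other:
  assumes x: "x \<in> spectral_subspace \<alpha> D m" and ne: "m \<noteq> n"
  shows "fourier_coefficient \<alpha> n x = 0"
proof -
  let ?S = "spectral_subspace \<alpha> UNIV m"
  have S: "closed_subspace ?S"
    by (intro closed_subspace_spectral closed_subspace_cstar_subalgebra cstar_subalgebra_UNIV)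
  have "invariant \<alpha> ?S"
    using complex_subspaceD(3)[OF closed_subspaceD(1)[OF S]]
    by (auto simp: invariant_def) (auto simp: spectral_subspace_def)
  moreover have "x \<in> ?S" using x by (auto simp: spectral_subspace_def)
  ultimately have "fourier_coefficient \<alpha> n x \<in> spectral_subspace \<alpha> ?S n"
    by (intro fourier_coefficient_mem_spectral[OF act] closed_subspaceD[OF S])
  thus ?thesis
    using spectral_subspaces_disjoint[of _ UNIV m ?S n] spectral_subspace_subset[of \<alpha> ?S n] ne by blast
qed

lemma subset_of_spectral_subspaces:
  assumes "closed_subspace B" "invariant \<alpha> B" "closed_subspace V" "\<And>n. spectral_subspace \<alpha> B n \<subseteq> V"
  shows "B \<subseteq> V"
proof
  fix x assume "x \<in> B"
  hence "fourier_coefficient \<alpha> n x \<in> spectral_subspace \<alpha> B n" for n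
    by (rule fourier_coefficient_mem_spectral[OF act closed_subspaceD[OF assms(1)] assms(2)])
  hence "fourier_coefficient \<alpha> n x \<in> V" for n using assms(4)[of n] by blast
  thus "x \<in> V" by (rule mem_closed_subspace_of_fourier_coefficients[OF act closed_subspaceD[OF assms(3)]])
qed

text \<open>
  If \<open>x\<close> is in the spectral subspace of degree \<open>n\<close>, then \<open>star x * x\<close> is a fixed point; and the
  spectral subspaces span a dense subspace.
\<close>

lemma fixed_points_nonzero:
  assumes B: "cstar_subalgebra B" and "invariant \<alpha> B" "B \<noteq> {0}"
  shows "fixed_points \<alpha> B \<noteq> {0}"
proof
  assume 0: "fixed_points \<alpha> B = {0}"
  have "spectral_subspace \<alpha> B n \<subseteq> {0}" for n
  proof
    fix x assume x: "x \<in> spectral_subspace \<alpha> B n"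
    have "star x * x \<in> spectral_subspace \<alpha> B (- n + n)"
      by (intro spectral_subspace_mult spectral_subspace_star B x)
    thus "x \<in> {0}" using 0 by simp
  qed
  hence "B \<subseteq> {0}"
    by (rule subset_of_spectral_subspaces[OF closed_subspace_cstar_subalgebra[OF B] assms(2)
          closed_subspace_zero])
  thus False using assms(3) complex_subspaceD(1)[OF cstar_subalgebraD(1)[OF B]] by blast
qed

lemma closed_product_fourier_coefficient:
  assumes B: "cstar_subalgebra B" "invariant \<alpha> B" and I: "I \<subseteq> fixed_points \<alpha> UNIV"
    and x: "x \<in> closed_product B I"
  shows "fourier_coefficient \<alpha> n x \<in> closed_product (spectral_subspace \<alpha> B n) I"
proof -
  note BC = closed_subspace_cstar_subalgebra[OF B(1)]
  note BCD = closed_subspaceD[OF BC]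
  have "closed_product B I \<subseteq> {x. fourier_coefficient \<alpha> n x \<in> closed_product (spectral_subspace \<alpha> B n) I}"
  proof (rule closed_product_least)
    show "closed_subspace {x. fourier_coefficient \<alpha> n x \<in> closed_product (spectral_subspace \<alpha> B n) I}"
      by (rule closed_subspace_vimage[where \<sigma> = "\<lambda>c. c"])
         (intro closed_subspace_closed_product closed_subspaceD(1)[OF closed_subspace_spectral] BC
           bounded_linear_fourier_coefficient[OF act] fourier_coefficient_scaleC[OF act])+
    fix b y assume b: "b \<in> B" and y: "y \<in> I"
    have "fourier_coefficient \<alpha> n (b * y) = fourier_coefficient \<alpha> n b * y"
      using y I by (intro fourier_coefficient_mult_fixed[OF act]) blast
    moreover have "fourier_coefficient \<alpha> n b \<in> spectral_subspace \<alpha> B n"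
      by (intro fourier_coefficient_mem_spectral[OF act] BCD B b)
    ultimately show "b * y \<in> {x. fourier_coefficient \<alpha> n x \<in> closed_product (spectral_subspace \<alpha> B n) I}"
      using y by (simp add: closed_product_mem)
  qed
  thus ?thesis using x by blast
qed

lemma spectral_subspace_hereditary_hull_subset:
  assumes B: "cstar_subalgebra B" "invariant \<alpha> B" and I: "I \<subseteq> fixed_points \<alpha> UNIV"
  shows "spectral_subspace \<alpha> (hereditary_hull B I) n \<subseteq> closed_product (spectral_subspace \<alpha> B n) I"
proof
  fix x assume x: "x \<in> spectral_subspace \<alpha> (hereditary_hull B I) n"
  hence "x \<in> closed_product B I" by (auto simp: spectral_subspace_def hereditary_hull_def)
  from closed_product_fourier_coefficient[OF B I this, of n]
  show "x \<in> closed_product (spectral_subspace \<alpha> B n) I"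
    by (simp add: fourier_coefficient_spectral[OF act x])
qed

lemma invariant_closed_product:
  assumes B: "complex_subspace B" "invariant \<alpha> B" and I: "I \<subseteq> fixed_points \<alpha> UNIV"
    and z: "z \<in> unit_circle" and x: "x \<in> closed_product B I"
  shows "\<alpha> z x \<in> closed_product B I"
proof -
  have "closed_product B I \<subseteq> {x. \<alpha> z x \<in> closed_product B I}"
  proof (rule closed_product_least)
    show "closed_subspace {x. \<alpha> z x \<in> closed_product B I}"
      by (rule closed_subspace_vimage[where \<sigma> = "\<lambda>c. c"])
         (intro closed_subspace_closed_product bounded_linear_action[OF act] action_scaleC[OF act] z B)+
    fix b y assume b: "b \<in> B" and y: "y \<in> I"
    have "\<alpha> z y = y" using y I z by (auto simp: spectral_subspace_def)
    moreover have "\<alpha> z b \<in> B" using b B(2) z unfolding invariant_def by blast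
    ultimately show "b * y \<in> {x. \<alpha> z x \<in> closed_product B I}"
      using y z by (simp add: action_mult[OF act] closed_product_mem)
  qed
  thus ?thesis using x by blast
qed

lemma hereditary_hull_of_ideal:
  assumes B: "cstar_subalgebra B" "invariant \<alpha> B" and I: "closed_ideal I (fixed_points \<alpha> B)" "I \<noteq> {0}"
  shows "fixed_points \<alpha> (hereditary_hull B I) = I"
    and "hereditary_hull B I \<in> invariant_hereditary \<alpha> B"
proof -
  note ID = closed_idealD[OF I(1)] and BD = cstar_subalgebraD[OF B(1)]
  have Ic: "cstar_subalgebra I"
    by (rule closed_ideal_imp_cstar_subalgebra[OF cstar_subalgebra_fixed_points[OF B(1)] I(1)])
  note IcD = cstar_subalgebraD[OF Ic]
  have IU: "I \<subseteq> fixed_points \<alpha> UNIV" using ID(1) fixed_points_subset_UNIV by blast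
  have IB: "I \<subseteq> B" using ID(1) spectral_subspace_subset by blast
  have "I \<subseteq> closed_product I I" by (simp add: closed_product_cstar_subalgebra_self[OF Ic])
  also have "\<dots> \<subseteq> closed_product B I" by (rule closed_product_mono[OF IB]) simp
  finally have I_hull: "I \<subseteq> hereditary_hull B I" using IcD(4) by (auto simp: hereditary_hull_def)
  show "fixed_points \<alpha> (hereditary_hull B I) = I"
  proof (rule antisym)
    have "fixed_points \<alpha> (hereditary_hull B I) \<subseteq> closed_product (fixed_points \<alpha> B) I"
      by (rule spectral_subspace_hereditary_hull_subset[OF B IU])
    also have "\<dots> \<subseteq> I" by (intro closed_product_least ID)
    finally show "fixed_points \<alpha> (hereditary_hull B I) \<subseteq> I" .
    show "I \<subseteq> fixed_points \<alpha> (hereditary_hull B I)"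
      using I_hull ID(1) by (auto simp: spectral_subspace_def)
  qed
  have "invariant \<alpha> (hereditary_hull B I)"
    using invariant_closed_product[OF BD(1) B(2) IU]
    by (auto simp: invariant_def hereditary_hull_def simp flip: action_star[OF act])
  moreover have "hereditary_hull B I \<noteq> {0}" using I_hull I(2) complex_subspaceD(1)[OF ID(2)] by blast
  ultimately show "hereditary_hull B I \<in> invariant_hereditary \<alpha> B"
    using hereditary_hull[OF B(1) Ic IB] by (simp add: invariant_hereditary_def)
qed

lemma closed_product_spectral_ideal:
  assumes D: "cstar_subalgebra D"
  shows "closed_ideal (closed_product (spectral_subspace \<alpha> D n) (spectral_subspace \<alpha> D (- n))) (fixed_points \<alpha> D)"
proof -
  let ?S = "spectral_subspace \<alpha> D" and ?J = "closed_product (spectral_subspace \<alpha> D n) (spectral_subspace \<alpha> D (- n))"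
  have S: "closed_subspace (?S k)" for k
    by (intro closed_subspace_spectral closed_subspace_cstar_subalgebra D)
  have J: "closed_subspace ?J" by (intro closed_subspace_closed_product closed_subspaceD(1)[OF S])
  have "?J \<subseteq> ?S 0"
    using spectral_subspace_mult[OF D, of _ n _ "- n"] by (intro closed_product_least S) simp
  moreover have "b * x \<in> ?J" if b: "b \<in> ?S 0" and x: "x \<in> ?J" for b x
  proof -
    have "?J \<subseteq> {x. b * x \<in> ?J}"
      using spectral_subspace_mult[OF D b, of _ n]
      by (intro closed_product_least closed_subspace_vimage_mult_left J)
         (auto simp flip: mult.assoc intro!: closed_product_mem)
    thus ?thesis using x by blast
  qed
  moreover have "x * b \<in> ?J" if b: "b \<in> ?S 0" and x: "x \<in> ?J" for b x
  proof -
    have "?J \<subseteq> {x. x * b \<in> ?J}"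
      using spectral_subspace_mult[OF D _ b, of _ "- n"]
      by (intro closed_product_least closed_subspace_vimage_mult_right J)
         (auto simp: mult.assoc intro!: closed_product_mem)
    thus ?thesis using x by blast
  qed
  ultimately show ?thesis using closed_subspaceD[OF J] unfolding closed_ideal_def by blast
qed

text \<open>An approximate unit for \<open>x\<close> can be built from \<open>x * star x\<close>.\<close>

lemma spectral_subspace_factor_left:
  assumes D: "cstar_subalgebra D"
  shows "spectral_subspace \<alpha> D n =
    closed_product (closed_product (spectral_subspace \<alpha> D n) (spectral_subspace \<alpha> D (- n))) (spectral_subspace \<alpha> D n)"
    (is "?S n = closed_product ?J (?S n)")
proof (rule antisym)
  have J: "closed_ideal ?J (?S 0)" by (rule closed_product_spectral_ideal[OF D])
  show "closed_product ?J (?S n) \<subseteq> ?S n"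
    using closed_idealD(1)[OF J] spectral_subspace_mult[OF D, of _ 0 _ n]
    by (intro closed_product_least closed_subspace_spectral closed_subspace_cstar_subalgebra D) auto
  show "?S n \<subseteq> closed_product ?J (?S n)"
  proof
    fix x assume x: "x \<in> ?S n"
    have "x * star x \<in> ?J" by (intro closed_product_mem x spectral_subspace_star[OF D])
    thus "x \<in> closed_product ?J (?S n)"
      by (intro mem_closed_product_left[OF closed_ideal_imp_cstar_subalgebra[OF cstar_subalgebra_fixed_points[OF D] J]] x)
  qed
qed

lemma spectral_subspace_factor_right:
  assumes D: "cstar_subalgebra D"
  shows "spectral_subspace \<alpha> D n =
    closed_product (spectral_subspace \<alpha> D n) (closed_product (spectral_subspace \<alpha> D (- n)) (spectral_subspace \<alpha> D n))"
  by (subst (1) spectral_subspace_factor_left[OF D])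
     (intro closed_product_assoc closed_subspaceD(1)[OF closed_subspace_spectral] closed_subspace_cstar_subalgebra D)

lemma arveson_spectrum_iff:
  assumes D: "cstar_subalgebra D"
  shows "n \<in> arveson_spectrum \<alpha> D \<longleftrightarrow> (\<exists>x\<in>spectral_subspace \<alpha> D n. x \<noteq> 0)"
proof -
  have "0 \<in> spectral_subspace \<alpha> D n"
    by (intro complex_subspaceD(1) closed_subspaceD(1) closed_subspace_spectral closed_subspace_cstar_subalgebra D)
  thus ?thesis by (auto simp: arveson_spectrum_def)
qed

lemma uminus_mem_arveson_spectrum:
  assumes D: "cstar_subalgebra D" and n: "n \<in> arveson_spectrum \<alpha> D"
  shows "- n \<in> arveson_spectrum \<alpha> D"
proof -
  obtain x where x: "x \<in> spectral_subspace \<alpha> D n" "x \<noteq> 0"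
    using n by (auto simp: arveson_spectrum_iff[OF D])
  moreover from x(2) have "star x \<noteq> 0" by (metis star_star star_zero)
  ultimately show ?thesis using spectral_subspace_star[OF D] by (auto simp: arveson_spectrum_iff[OF D])
qed

end

section \<open>Simplicity of the fixed point algebra\<close>

lemma closed_product_left_action:
  assumes X: "complex_subspace X" and b: "\<And>x. x \<in> X \<Longrightarrow> b * x \<in> X" and w: "w \<in> closed_product X Y"
  shows "b * w \<in> closed_product X Y"
proof -
  have "closed_product X Y \<subseteq> {w. b * w \<in> closed_product X Y}"
    by (intro closed_product_least closed_subspace_vimage_mult_left closed_subspace_closed_product X)
       (auto simp flip: mult.assoc intro!: closed_product_mem b)
  thus ?thesis using w by blast
qed

lemma closed_product_right_action:
  assumes X: "complex_subspace X" and b: "\<And>y. y \<in> Y \<Longrightarrow> y * b \<in> Y" and w: "w \<in> closed_product X Y"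
  shows "w * b \<in> closed_product X Y"
proof -
  have "closed_product X Y \<subseteq> {w. w * b \<in> closed_product X Y}"
    by (intro closed_product_least closed_subspace_vimage_mult_right closed_subspace_closed_product X)
       (auto simp: mult.assoc intro!: closed_product_mem b)
  thus ?thesis using w by blast
qed

lemma star_sandwich_eq_0:
  assumes "star d * d * star d = (0::'a::cstar_algebra)"
  shows "d = 0"
proof -
  have "star (star d * d) * (star d * d) = (star d * d * star d) * d"
    by (simp add: star_mult star_star mult.assoc)
  hence "star (star d * d) * (star d * d) = 0" using assms by simp
  thus ?thesis by (simp only: star_mult_self_eq_0_iff)
qed

lemma simple_ideal_eq:
  assumes "simple_cstar_algebra J" "closed_ideal I J" "I \<noteq> {0}"
  shows "I = J"
  using assms by (auto simp: simple_cstar_algebra_def)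

lemma closed_ideal_subset:
  assumes "closed_ideal I B" "I \<subseteq> J" "J \<subseteq> B"
  shows "closed_ideal I J"
  using assms unfolding closed_ideal_def by blast

lemma hereditary_subalgebra_refl: "cstar_subalgebra C \<Longrightarrow> hereditary_subalgebra C C"
  by (auto simp: hereditary_subalgebra_def positive_elements_def cstar_subalgebraD)

context
  fixes \<alpha> :: "complex \<Rightarrow> 'a::cstar_algebra \<Rightarrow> 'a"
  assumes act: "circle_action \<alpha>"
begin

lemma complex_subspace_spectral: "cstar_subalgebra D \<Longrightarrow> complex_subspace (spectral_subspace \<alpha> D n)"
  by (intro closed_subspaceD(1) closed_subspace_spectral[OF act] closed_subspace_cstar_subalgebra)

text \<open>
  If \<open>D\<^sub>n F D\<^sub>-\<^sub>n\<close> vanishes, then so does \<open>D\<^sub>-\<^sub>n D\<^sub>n F D\<^sub>-\<^sub>n D\<^sub>n\<close>, which contains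
  \<open>star d * d * star d\<close> for all \<open>d\<close> in \<open>F\<close>.
\<close>

lemma conjugate_nonzero:
  assumes D: "cstar_subalgebra D" and F: "cstar_subalgebra F" "F \<noteq> {0}"
    and FD: "F \<subseteq> closed_product (spectral_subspace \<alpha> D (- n)) (spectral_subspace \<alpha> D n)"
  shows "closed_product (closed_product (spectral_subspace \<alpha> D n) F) (spectral_subspace \<alpha> D (- n)) \<noteq> {0}"
    (is "?K \<noteq> {0}")
proof
  let ?S = "spectral_subspace \<alpha> D"
  assume K: "?K = {0}"
  have zero: "x * d * y = 0" if "x \<in> ?S n" "d \<in> F" "y \<in> ?S (- n)" for x d y
    using K closed_product_mem[OF closed_product_mem[OF that(1,2)] that(3)] by blast
  have zero': "a * (d * (y * y')) = 0" if a: "a \<in> F" and d: "d \<in> F" and y: "y \<in> ?S (- n)" for a d y y'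
  proof -
    have "closed_product (?S (- n)) (?S n) \<subseteq> {a. a * (d * (y * y')) \<in> {0}}"
    proof (intro closed_product_least closed_subspace_vimage_mult_right closed_subspace_zero)
      fix x' x assume "x' \<in> ?S (- n)" "x \<in> ?S n"
      hence "x' * (x * d * y) * y' = 0" using zero[OF _ d y] by simp
      thus "x' * x \<in> {a. a * (d * (y * y')) \<in> {0}}" by (simp add: mult.assoc)
    qed
    thus ?thesis using FD a by blast
  qed
  have adb: "a * d * b = 0" if a: "a \<in> F" and d: "d \<in> F" and b: "b \<in> F" for a d b
  proof -
    have "closed_product (?S (- n)) (?S n) \<subseteq> {b. (a * d) * b \<in> {0}}"
      using zero'[OF a d]
      by (intro closed_product_least closed_subspace_vimage_mult_left closed_subspace_zero)
         (simp add: mult.assoc)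
    thus ?thesis using FD b by blast
  qed
  have "d = 0" if "d \<in> F" for d
    by (rule star_sandwich_eq_0[OF adb]) (intro cstar_subalgebraD(4)[OF F(1)] that)+
  thus False using F complex_subspaceD(1)[OF cstar_subalgebraD(1)[OF F(1)]] by blast
qed

lemma conjugate_ideal:
  assumes D: "cstar_subalgebra D" and F: "F \<subseteq> fixed_points \<alpha> D"
  shows "closed_ideal (closed_product (closed_product (spectral_subspace \<alpha> D n) F) (spectral_subspace \<alpha> D (- n)))
    (fixed_points \<alpha> D)" (is "closed_ideal ?K _")
proof -
  let ?S = "spectral_subspace \<alpha> D"
  note S = complex_subspace_spectral[OF D]
  have W: "closed_subspace (closed_product (?S n) F)" by (rule closed_subspace_closed_product[OF S])
  have K: "closed_subspace ?K" by (rule closed_subspace_closed_product[OF closed_subspaceD(1)[OF W]])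
  have "closed_product (?S n) F \<subseteq> ?S n"
    using spectral_subspace_mult[OF act D, of _ n _ 0] F
    by (intro closed_product_least closed_subspace_spectral[OF act] closed_subspace_cstar_subalgebra D) auto
  hence "?K \<subseteq> closed_product (?S n) (?S (- n))" by (intro closed_product_mono) auto
  also have "\<dots> \<subseteq> ?S 0" by (rule closed_idealD(1)[OF closed_product_spectral_ideal[OF act D]])
  finally have "?K \<subseteq> ?S 0" .
  moreover have "b * x \<in> ?K" if b: "b \<in> ?S 0" and x: "x \<in> ?K" for b x
  proof (rule closed_product_left_action[OF closed_subspaceD(1)[OF W] _ x])
    fix w assume "w \<in> closed_product (?S n) F"
    thus "b * w \<in> closed_product (?S n) F"
      using spectral_subspace_mult[OF act D b, of _ n] by (intro closed_product_left_action[OF S]) auto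
  qed
  moreover have "x * b \<in> ?K" if b: "b \<in> ?S 0" and x: "x \<in> ?K" for b x
    using spectral_subspace_mult[OF act D _ b, of _ "- n"]
    by (intro closed_product_right_action[OF closed_subspaceD(1)[OF W] _ x]) auto
  ultimately show ?thesis using closed_subspaceD[OF K] unfolding closed_ideal_def by blast
qed

text \<open>
  The fixed points of a non-zero invariant ideal \<open>I\<close> are a non-zero ideal of \<open>P\<close>, hence \<open>P\<close>,
  and \<open>C\<^sub>n = P C\<^sub>n\<close> is in \<open>I\<close>.
\<close>

lemma invariantly_simple_of_simple_fixed_points:
  assumes C: "cstar_subalgebra C" "invariant \<alpha> C" and P: "simple_cstar_algebra (fixed_points \<alpha> C)"
  shows "invariantly_simple \<alpha> C"
  unfolding invariantly_simple_def
proof (intro allI impI, elim conjE)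
  fix I assume I: "closed_ideal I C" "invariant \<alpha> I" "I \<noteq> {0}"
  note ID = closed_idealD[OF I(1)]
  let ?P = "fixed_points \<alpha> C"
  have Ic: "cstar_subalgebra I" by (rule closed_ideal_imp_cstar_subalgebra[OF C(1) I(1)])
  have I0: "fixed_points \<alpha> I = I \<inter> ?P" using ID(1) by (auto simp: spectral_subspace_def)
  have Pc: "cstar_subalgebra ?P" by (rule cstar_subalgebra_fixed_points[OF act C(1)])
  have "closed_ideal (fixed_points \<alpha> I) ?P"
  proof -
    have "closed_subspace (fixed_points \<alpha> I)" by (rule closed_subspace_spectral[OF act ID(6)])
    moreover have "b * x \<in> I" "x * b \<in> I" if "b \<in> ?P" "x \<in> I" for b x
      using that ID(4,5) spectral_subspace_subset by blast+
    ultimately show ?thesis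
      using cstar_subalgebraD(3)[OF Pc] by (auto simp: closed_ideal_def closed_subspace_def I0)
  qed
  hence "fixed_points \<alpha> I = ?P"
    by (rule simple_ideal_eq[OF P]) (rule fixed_points_nonzero[OF act Ic I(2,3)])
  hence PI: "?P \<subseteq> I" using spectral_subspace_subset by blast
  have "spectral_subspace \<alpha> C n \<subseteq> I" for n
  proof -
    have "spectral_subspace \<alpha> C n \<subseteq> closed_product ?P (spectral_subspace \<alpha> C n)"
    proof
      fix x assume x: "x \<in> spectral_subspace \<alpha> C n"
      have "x * star x \<in> spectral_subspace \<alpha> C (n + - n)"
        by (intro spectral_subspace_mult[OF act C(1)] spectral_subspace_star[OF act C(1)] x)
      thus "x \<in> closed_product ?P (spectral_subspace \<alpha> C n)"
        by (intro mem_closed_product_left[OF Pc x]) simp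
    qed
    also have "\<dots> \<subseteq> I"
      using PI ID(5) spectral_subspace_subset by (intro closed_product_least[OF ID(6)]) blast
    finally show ?thesis .
  qed
  hence "C \<subseteq> I"
    by (rule subset_of_spectral_subspaces[OF act closed_subspace_cstar_subalgebra[OF C(1)] C(2) ID(6)])
  thus "I = C" using ID(1) by blast
qed

text \<open>
  If the fixed points \<open>P\<close> of \<open>C\<close> are simple and \<open>D\<close> is hereditary in \<open>C\<close>, then
  \<open>C\<^sub>n D\<^sub>0 C\<^sub>-\<^sub>n\<close> spans a non-zero ideal of \<open>P\<close>, hence all of \<open>P\<close>; so \<open>D\<^sub>0 = D\<^sub>0 P D\<^sub>0\<close> is
  spanned by \<open>(D\<^sub>0 C\<^sub>n D\<^sub>0) (D\<^sub>0 C\<^sub>-\<^sub>n D\<^sub>0)\<close>, and the two factors lie in \<open>D\<^sub>n\<close> and \<open>D\<^sub>-\<^sub>n\<close> because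
  \<open>D\<close> is hereditary.
\<close>

lemma strong_Connes_spectrum_of_simple_fixed_points:
  assumes C: "cstar_subalgebra C" "invariant \<alpha> C" and P: "simple_cstar_algebra (fixed_points \<alpha> C)"
    and full: "closed_product (spectral_subspace \<alpha> C (- n)) (spectral_subspace \<alpha> C n) = fixed_points \<alpha> C"
  shows "n \<in> strong_Connes_spectrum \<alpha> C"
  unfolding strong_Connes_spectrum_def
proof (intro CollectI ballI)
  fix D assume "D \<in> invariant_hereditary \<alpha> C"
  hence D: "D \<noteq> {0}" "invariant \<alpha> D" "hereditary_subalgebra D C" by (auto simp: invariant_hereditary_def)
  hence Dc: "cstar_subalgebra D" and DC: "D \<subseteq> C" by (auto simp: hereditary_subalgebra_def)
  let ?P = "fixed_points \<alpha> C" and ?D0 = "fixed_points \<alpha> D"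
  let ?S = "spectral_subspace \<alpha> C" and ?T = "spectral_subspace \<alpha> D"
  let ?R = "closed_product (?T n) (?T (- n))"
  let ?K = "closed_product (closed_product (?S n) ?D0) (?S (- n))"
  have D0c: "cstar_subalgebra ?D0" by (rule cstar_subalgebra_fixed_points[OF act Dc])
  have D0P: "?D0 \<subseteq> ?P" using DC by (auto simp: spectral_subspace_def)
  have D0_prod: "closed_product ?D0 ?D0 = ?D0" by (rule closed_product_cstar_subalgebra_self[OF D0c])
  have R: "closed_subspace ?R" by (intro closed_subspace_closed_product complex_subspace_spectral Dc)
  have "?K \<noteq> {0}"
    using D0P by (intro conjugate_nonzero[OF C(1) D0c fixed_points_nonzero[OF act Dc D(2,1)]]) (simp add: full)
  hence K: "?K = ?P" by (rule simple_ideal_eq[OF P conjugate_ideal[OF C(1) D0P]])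
  have T: "a * x * b \<in> ?T k" if "a \<in> ?D0" "x \<in> ?S k" "b \<in> ?D0" for a x b k
  proof -
    have "a \<in> D" "b \<in> D" "x \<in> C" using that spectral_subspace_subset by blast+
    hence "a * x * b \<in> D" by (intro hereditary_sandwich[OF C(1) D(3)])
    moreover have "a * x * b \<in> ?S (0 + k + 0)"
      using that D0P by (intro spectral_subspace_mult[OF act C(1)]) auto
    ultimately show ?thesis by (simp add: spectral_subspace_def)
  qed
  have apb: "a * (p * b) \<in> ?R" if a: "a \<in> ?D0" and b: "b \<in> ?D0" and p: "p \<in> ?P" for a b p
  proof -
    have x: "a * (x * d * z * b) \<in> ?R" if x: "x \<in> ?S n" and d: "d \<in> ?D0" and z: "z \<in> ?S (- n)" for x d z
    proof -
      have "closed_product ?D0 ?D0 \<subseteq> {d. a * x * (d * (z * b)) \<in> ?R}"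
      proof (rule closed_product_least)
        have "closed_subspace {d. d * (z * b) \<in> {w. (a * x) * w \<in> ?R}}"
          by (intro closed_subspace_vimage_mult_right closed_subspace_vimage_mult_left R)
        thus "closed_subspace {d. a * x * (d * (z * b)) \<in> ?R}" by simp
        fix d1 d2 assume "d1 \<in> ?D0" "d2 \<in> ?D0"
        hence "(a * x * d1) * (d2 * z * b) \<in> ?R" by (intro closed_product_mem T a b x z)
        thus "d1 * d2 \<in> {d. a * x * (d * (z * b)) \<in> ?R}" by (simp add: mult.assoc)
      qed
      thus ?thesis using d D0_prod by (auto simp: mult.assoc)
    qed
    have w: "a * (w * z * b) \<in> ?R" if w: "w \<in> closed_product (?S n) ?D0" and z: "z \<in> ?S (- n)" for w z
    proof -
      have "closed_product (?S n) ?D0 \<subseteq> {w. w * (z * b) \<in> {v. a * v \<in> ?R}}"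
        using x z
        by (intro closed_product_least closed_subspace_vimage_mult_right closed_subspace_vimage_mult_left R)
           (simp add: mult.assoc)
      thus ?thesis using w by (auto simp: mult.assoc)
    qed
    have "?K \<subseteq> {p. p * b \<in> {v. a * v \<in> ?R}}"
      using w by (intro closed_product_least closed_subspace_vimage_mult_right closed_subspace_vimage_mult_left R) simp
    thus ?thesis using p K by blast
  qed
  have "?D0 \<subseteq> ?R"
  proof -
    have "closed_product ?D0 ?D0 \<subseteq> ?R"
    proof (rule closed_product_least[OF R])
      fix a d assume a: "a \<in> ?D0" and d: "d \<in> ?D0"
      have "closed_product ?D0 ?D0 \<subseteq> {d. a * d \<in> ?R}"
        using apb[OF a] D0P by (intro closed_product_least closed_subspace_vimage_mult_left R) blast
      thus "a * d \<in> ?R" using d D0_prod by blast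
    qed
    thus ?thesis by (simp add: D0_prod)
  qed
  moreover have "?R \<subseteq> ?D0" by (rule closed_idealD(1)[OF closed_product_spectral_ideal[OF act Dc]])
  ultimately show "closed_product (?T n) (star ` ?T n) = ?D0"
    by (simp add: star_image_spectral[OF act Dc])
qed

lemma strong_Connes_spectrum_subset:
  assumes C: "C \<in> invariant_hereditary \<alpha> B" and n: "n \<in> strong_Connes_spectrum \<alpha> C"
  shows "closed_product (spectral_subspace \<alpha> C n) (spectral_subspace \<alpha> C (- n)) = fixed_points \<alpha> C"
    and "n \<in> arveson_spectrum \<alpha> C"
proof -
  have Cc: "C \<noteq> {0}" "invariant \<alpha> C" "cstar_subalgebra C"
    using C by (auto simp: invariant_hereditary_def hereditary_subalgebra_def)
  hence "C \<in> invariant_hereditary \<alpha> C"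
    by (simp add: invariant_hereditary_def hereditary_subalgebra_refl)
  with n have "closed_product (spectral_subspace \<alpha> C n) (star ` spectral_subspace \<alpha> C n) = fixed_points \<alpha> C"
    unfolding strong_Connes_spectrum_def by blast
  thus eq: "closed_product (spectral_subspace \<alpha> C n) (spectral_subspace \<alpha> C (- n)) = fixed_points \<alpha> C"
    by (simp only: star_image_spectral[OF act Cc(3)])
  have "fixed_points \<alpha> C \<noteq> {0}" by (rule fixed_points_nonzero[OF act Cc(3,2,1)])
  moreover have "0 \<in> fixed_points \<alpha> C" by (rule complex_subspaceD(1)[OF complex_subspace_spectral[OF Cc(3)]])
  ultimately have "\<not> fixed_points \<alpha> C \<subseteq> {0}" by blast
  hence "\<exists>x\<in>spectral_subspace \<alpha> C n. x \<noteq> 0"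
    unfolding eq[symmetric] closed_product_zero_iff[OF complex_subspace_spectral[OF Cc(3)]] by force
  thus "n \<in> arveson_spectrum \<alpha> C" by (simp add: arveson_spectrum_iff[OF act Cc(3)])
qed

section \<open>From a common simple ideal to a hereditary subalgebra\<close>

lemma exists_positive_spectrum:
  assumes "arveson_spectrum \<alpha> UNIV \<noteq> {0}" "0 \<in> arveson_spectrum \<alpha> UNIV"
  shows "\<exists>n\<in>arveson_spectrum \<alpha> UNIV. n \<ge> 1"
proof -
  obtain m where m: "m \<in> arveson_spectrum \<alpha> UNIV" "m \<noteq> 0" using assms by blast
  moreover have "- m \<in> arveson_spectrum \<alpha> UNIV"
    by (rule uminus_mem_arveson_spectrum[OF act cstar_subalgebra_UNIV m(1)])
  moreover have "m \<ge> 1 \<or> - m \<ge> 1" using m(2) by linarith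
  ultimately show ?thesis by blast
qed

context
  fixes A :: "int \<Rightarrow> 'a set" and sp :: "int set" and J :: "'a set"
  defines "A n \<equiv> spectral_subspace \<alpha> UNIV n" and "sp \<equiv> arveson_spectrum \<alpha> UNIV"
  assumes J: "closed_ideal J (A 0)" "J \<noteq> {0}" "simple_cstar_algebra J"
    and range: "\<And>n. n \<in> sp \<Longrightarrow> n \<ge> 1 \<Longrightarrow> closed_product (A n) (A (- n)) = J"
begin

lemma A_subspace: "complex_subspace (A n)" "closed_subspace (A n)"
  unfolding A_def
  by (intro complex_subspace_spectral closed_subspace_spectral[OF act]
      closed_subspace_cstar_subalgebra cstar_subalgebra_UNIV)+

lemma A_mult: "x \<in> A m \<Longrightarrow> y \<in> A n \<Longrightarrow> x * y \<in> A (m + n)"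
  unfolding A_def by (rule spectral_subspace_mult[OF act cstar_subalgebra_UNIV])

lemma A_star: "x \<in> A n \<Longrightarrow> star x \<in> A (- n)"
  unfolding A_def by (rule spectral_subspace_star[OF act cstar_subalgebra_UNIV])

lemma closed_product_A: "closed_product (A m) (A n) \<subseteq> A (m + n)"
  by (intro closed_product_least A_subspace A_mult)

lemma A_ideal: "closed_ideal (closed_product (A n) (A (- n))) (A 0)"
  unfolding A_def by (rule closed_product_spectral_ideal[OF act cstar_subalgebra_UNIV])

lemma sp_iff: "n \<in> sp \<longleftrightarrow> (\<exists>x\<in>A n. x \<noteq> 0)"
  unfolding sp_def A_def by (rule arveson_spectrum_iff[OF act cstar_subalgebra_UNIV])

lemma J_cstar: "cstar_subalgebra J"
  using J(3) by (simp add: simple_cstar_algebra_def)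

lemma J_A_eq: "n \<in> sp \<Longrightarrow> n \<ge> 1 \<Longrightarrow> closed_product J (A n) = A n"
  using spectral_subspace_factor_left[OF act cstar_subalgebra_UNIV, of n]
  by (simp add: range A_def[symmetric])

text \<open>
  Subtracting one positive element of the spectrum from a larger one, as
  \<open>A\<^sub>m = J A\<^sub>m = A\<^sub>n (A\<^sub>-\<^sub>n A\<^sub>m)\<close>.
\<close>

lemma spectrum_diff:
  assumes n: "n \<in> sp" "n \<ge> 1" and m: "m \<in> sp" "m > n"
  shows "A m \<subseteq> closed_product (A n) (A (m - n))" and "m - n \<in> sp"
proof -
  have "A m = closed_product (closed_product (A n) (A (- n))) (A m)"
    using J_A_eq[OF m(1)] m n by (simp add: range)
  also have "\<dots> = closed_product (A n) (closed_product (A (- n)) (A m))"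
    by (intro closed_product_assoc A_subspace)
  also have "\<dots> \<subseteq> closed_product (A n) (A (m - n))"
    using closed_product_A[of "- n" m] by (intro closed_product_mono) auto
  finally show sub: "A m \<subseteq> closed_product (A n) (A (m - n))" .
  show "m - n \<in> sp"
  proof (rule ccontr)
    assume "m - n \<notin> sp"
    hence "closed_product (A n) (A (m - n)) \<subseteq> {0}"
      by (subst closed_product_zero_iff[OF A_subspace(1)]) (auto simp: sp_iff)
    thus False using sub m(1) by (auto simp: sp_iff)
  qed
qed

text \<open>
  Let \<open>n < m\<close> be positive elements of the spectrum. Since
  \<open>A\<^sub>m = A\<^sub>n A\<^sub>m\<^sub>-\<^sub>n = A\<^sub>n (A\<^sub>-\<^sub>n A\<^sub>n) J A\<^sub>m\<^sub>-\<^sub>n\<close> is not zero, the ideals \<open>A\<^sub>-\<^sub>n A\<^sub>n\<close> and \<open>J\<close>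
  are not orthogonal, and their product is all of \<open>J\<close>. With only one positive element in the
  spectrum they may be orthogonal, and this is the reason for the exceptional case of a
  spectrum with three elements.
\<close>

lemma right_ideal_contains_J:
  assumes n: "n \<in> sp" "n \<ge> 1" and m: "m \<in> sp" "m > n"
  shows "J \<subseteq> closed_product (A (- n)) (A n)" (is "J \<subseteq> ?L")
proof -
  have L: "closed_ideal ?L (A 0)" using A_ideal[of "- n"] by simp
  note LD = closed_idealD[OF L] and JD = closed_idealD[OF J(1)]
  have Q_ideal: "closed_ideal (closed_product ?L J) J"
  proof -
    have Q: "closed_subspace (closed_product ?L J)" by (rule closed_subspace_closed_product[OF LD(2)])
    have "closed_product ?L J \<subseteq> J" using LD(1) JD(4) by (intro closed_product_least JD(6)) blast
    moreover have "b * x \<in> closed_product ?L J" if "b \<in> J" "x \<in> closed_product ?L J" for b x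
      using that LD(4) JD(1) by (intro closed_product_left_action[OF LD(2)]) blast+
    moreover have "x * b \<in> closed_product ?L J" if "b \<in> J" "x \<in> closed_product ?L J" for b x
      using that JD(1,5) by (intro closed_product_right_action[OF LD(2)]) blast+
    ultimately show ?thesis using closed_subspaceD[OF Q] unfolding closed_ideal_def by blast
  qed
  have "closed_product ?L J \<noteq> {0}"
  proof
    assume "closed_product ?L J = {0}"
    hence zero: "a * b = 0" if "a \<in> ?L" "b \<in> J" for a b using closed_product_mem[OF that] by blast
    have 1: "x * a * y = 0" if "x \<in> A n" "a \<in> ?L" "y \<in> A (m - n)" for x a y
    proof -
      have "closed_product J (A (m - n)) \<subseteq> {y. (x * a) * y \<in> {0}}"
      proof (intro closed_product_least closed_subspace_vimage_mult_left closed_subspace_zero)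
        fix b y assume "b \<in> J" "y \<in> A (m - n)"
        hence "x * (a * b) * y = 0" using zero that(2) by simp
        thus "b * y \<in> {y. (x * a) * y \<in> {0}}" by (simp add: mult.assoc)
      qed
      thus ?thesis using J_A_eq[OF spectrum_diff(2)[OF n m]] m that(3) by auto
    qed
    have 2: "x * y = 0" if x: "x \<in> A n" and y: "y \<in> A (m - n)" for x y
    proof -
      have "closed_product (A n) ?L \<subseteq> {x. x * y \<in> {0}}"
        using 1 y by (intro closed_product_least closed_subspace_vimage_mult_right closed_subspace_zero) auto
      moreover have "A n = closed_product (A n) ?L"
        unfolding A_def by (rule spectral_subspace_factor_right[OF act cstar_subalgebra_UNIV])
      ultimately show ?thesis using x by auto
    qed
    have "closed_product (A n) (A (m - n)) \<subseteq> {0}"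
      using 2 by (simp add: closed_product_zero_iff[OF A_subspace(1)])
    thus False using spectrum_diff(1)[OF n m] m(1) by (auto simp: sp_iff)
  qed
  hence "J = closed_product ?L J" using simple_ideal_eq[OF J(3) Q_ideal] by simp
  also have "\<dots> \<subseteq> ?L" using JD(1) LD(5) by (intro closed_product_least LD(6)) blast
  finally show ?thesis .
qed

text \<open>
  Since \<open>A\<^sub>n J A\<^sub>-\<^sub>n\<close> is a non-zero ideal of \<open>J\<close>, it is \<open>J\<close>. So \<open>A\<^sub>n = J A\<^sub>n\<close> is
  \<open>A\<^sub>n J (A\<^sub>-\<^sub>n A\<^sub>n)\<close>, and \<open>J\<close> absorbs the last factor.
\<close>

lemma A_right_J:
  assumes n: "n \<in> sp" "n \<ge> 1" and JL: "J \<subseteq> closed_product (A (- n)) (A n)"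
  shows "A n \<subseteq> closed_product (A n) J"
proof -
  note JD = closed_idealD[OF J(1)]
  let ?W = "closed_product (A n) J"
  let ?K = "closed_product ?W (A (- n))"
  have W: "closed_subspace ?W" by (rule closed_subspace_closed_product[OF A_subspace(1)])
  have K: "closed_ideal ?K (A 0)"
    using conjugate_ideal[OF cstar_subalgebra_UNIV, of J n] JD(1) by (simp add: A_def)
  have "?W \<subseteq> A n"
    using A_mult[of _ n _ 0] JD(1) by (intro closed_product_least A_subspace) auto
  hence "?K \<subseteq> closed_product (A n) (A (- n))" by (rule closed_product_mono) simp
  hence "closed_ideal ?K J" using JD(1) by (intro closed_ideal_subset[OF K]) (simp_all add: range[OF n])
  moreover have "?K \<noteq> {0}"
    using conjugate_nonzero[OF cstar_subalgebra_UNIV J_cstar J(2), of n] JL by (simp add: A_def)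
  ultimately have KJ: "?K = J" by (rule simple_ideal_eq[OF J(3)])
  have "A n = closed_product ?K (A n)" using J_A_eq[OF n] by (simp add: KJ)
  also have "\<dots> \<subseteq> ?W"
  proof (rule closed_product_least[OF W])
    fix k y assume k: "k \<in> ?K" and y: "y \<in> A n"
    have "?K \<subseteq> {k. k * y \<in> ?W}"
    proof (intro closed_product_least closed_subspace_vimage_mult_right W)
      fix w z assume w: "w \<in> ?W" and z: "z \<in> A (- n)"
      have "z * y \<in> A 0" using A_mult[OF z y] by simp
      hence "w * (z * y) \<in> ?W" using JD(5) by (intro closed_product_right_action[OF A_subspace(1) _ w])
      thus "w * z \<in> {k. k * y \<in> ?W}" by (simp add: mult.assoc)
    qed
    thus "k * y \<in> ?W" using k by blast
  qed
  finally show ?thesis .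
qed

lemma A_right_J_all:
  assumes n: "n \<in> sp" "n \<ge> 1" "\<And>k. k \<in> sp \<Longrightarrow> k \<ge> 1 \<Longrightarrow> n \<le> k"
    and JL: "J \<subseteq> closed_product (A (- n)) (A n)" and m: "m \<in> sp" "m \<ge> 1"
  shows "A m \<subseteq> closed_product (A m) J"
  using m
proof (induction "nat m" arbitrary: m rule: less_induct)
  case less
  show ?case
  proof (cases "m = n")
    case True
    thus ?thesis using A_right_J[OF n(1,2) JL] by simp
  next
    case False
    hence mn: "m > n" using n(3)[of m] less.prems by simp
    note d = spectrum_diff[OF n(1,2) less.prems(1) mn]
    have "nat (m - n) < nat m" "m - n \<ge> 1" using n(2) mn by auto
    hence IH: "A (m - n) \<subseteq> closed_product (A (m - n)) J" using less.hyps d(2) by blast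
    have "A m \<subseteq> closed_product (A n) (A (m - n))" by (rule d(1))
    also have "\<dots> \<subseteq> closed_product (A n) (closed_product (A (m - n)) J)"
      by (rule closed_product_mono[OF subset_refl IH])
    also have "\<dots> = closed_product (closed_product (A n) (A (m - n))) J"
      by (intro closed_product_assoc[symmetric] A_subspace)
    also have "\<dots> \<subseteq> closed_product (A m) J"
      using closed_product_A[of n "m - n"] by (intro closed_product_mono) auto
    finally show ?thesis .
  qed
qed

lemma right_ideal_eq:
  assumes m: "m \<in> sp" and r: "A m \<subseteq> closed_product (A m) J"
  shows "closed_product (A (- m)) (A m) = J"
proof -
  note JD = closed_idealD[OF J(1)]
  let ?L = "closed_product (A (- m)) (A m)"
  have L: "closed_ideal ?L (A 0)" using A_ideal[of "- m"] by simp
  have LJ: "?L \<subseteq> J"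
  proof (rule closed_product_least[OF JD(6)])
    fix x y assume x: "x \<in> A (- m)" and y: "y \<in> A m"
    have "closed_product (A m) J \<subseteq> {y. x * y \<in> J}"
    proof (intro closed_product_least closed_subspace_vimage_mult_left JD(6))
      fix y j assume "y \<in> A m" "j \<in> J"
      thus "y * j \<in> {y. x * y \<in> J}"
        using JD(4)[of "x * y" j] A_mult[OF x, of y m] by (simp add: mult.assoc)
    qed
    thus "x * y \<in> J" using y r by blast
  qed
  obtain x where x: "x \<in> A m" "x \<noteq> 0" using m by (auto simp: sp_iff)
  have "star x * x \<in> ?L" by (intro closed_product_mem A_star x)
  moreover have "star x * x \<noteq> 0" using x(2) by simp
  ultimately have "?L \<noteq> {0}" by blast
  thus ?thesis by (intro simple_ideal_eq[OF J(3)] closed_ideal_subset[OF L LJ] JD(1))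
qed

lemma exists_hereditary_of_two_positive_degrees:
  assumes n: "n \<in> sp" "n \<ge> 1" "\<And>k. k \<in> sp \<Longrightarrow> k \<ge> 1 \<Longrightarrow> n \<le> k" and m: "m \<in> sp" "m > n"
  shows "\<exists>C\<in>invariant_hereditary \<alpha> UNIV.
    (\<forall>n\<in>sp. n \<noteq> 0 \<longrightarrow> A n = spectral_subspace \<alpha> C n) \<and> invariantly_simple \<alpha> C \<and>
    arveson_spectrum \<alpha> C = strong_Connes_spectrum \<alpha> C"
proof -
  note JD = closed_idealD[OF J(1)]
  define C where "C = hereditary_hull UNIV J"
  have inv: "invariant \<alpha> UNIV" by (simp add: invariant_def)
  have JA: "closed_ideal J (fixed_points \<alpha> UNIV)" using J(1) by (simp add: A_def)
  have C0: "fixed_points \<alpha> C = J" and CI: "C \<in> invariant_hereditary \<alpha> UNIV"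
    unfolding C_def using hereditary_hull_of_ideal[OF act cstar_subalgebra_UNIV inv JA J(2)] by auto
  have Cc: "cstar_subalgebra C" "invariant \<alpha> C"
    using CI by (auto simp: invariant_hereditary_def hereditary_subalgebra_def)
  have rJ: "A k \<subseteq> closed_product (A k) J" if "k \<in> sp" "k \<ge> 1" for k
    by (rule A_right_J_all[OF n right_ideal_contains_J[OF n(1,2) m] that])
  have pos: "A k \<subseteq> C" if k: "k \<in> sp" "k \<ge> 1" for k
  proof
    fix x assume x: "x \<in> A k"
    have "x \<in> closed_product UNIV J" using rJ[OF k] x closed_product_mono[of "A k" UNIV J J] by blast
    moreover have "x \<in> closed_product J (A k)" using x J_A_eq[OF k] by simp
    hence "star x \<in> closed_product UNIV J"
      by (rule star_closed_product)
         (auto intro: cstar_subalgebraD(1)[OF cstar_subalgebra_UNIV] cstar_subalgebraD(4)[OF J_cstar])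
    ultimately show "x \<in> C" by (simp add: C_def hereditary_hull_def)
  qed
  have sp_minus: "- k \<in> sp" if "k \<in> sp" for k
    using uminus_mem_arveson_spectrum[OF act cstar_subalgebra_UNIV] that unfolding sp_def by blast
  have AC: "A k \<subseteq> C" if k: "k \<in> sp" "k \<noteq> 0" for k
  proof (cases "k \<ge> 1")
    case True
    thus ?thesis using pos k by blast
  next
    case False
    hence "A (- k) \<subseteq> C" using k by (intro pos sp_minus) auto
    thus ?thesis using A_star[of _ k] cstar_subalgebraD(4)[OF Cc(1)] by (metis star_star subset_iff)
  qed
  have A_eq: "A k = spectral_subspace \<alpha> C k" if "k \<in> sp" "k \<noteq> 0" for k
    using AC[OF that] by (auto simp: A_def spectral_subspace_def)
  have P: "simple_cstar_algebra (fixed_points \<alpha> C)" using J(3) by (simp add: C0)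
  have full: "closed_product (A (- k)) (A k) = J" if k: "k \<in> sp" "k \<noteq> 0" for k
  proof (cases "k \<ge> 1")
    case True
    thus ?thesis using k by (intro right_ideal_eq rJ)
  next
    case False
    thus ?thesis using range[of "- k"] sp_minus[OF k(1)] k(2) by simp
  qed
  have "k \<in> strong_Connes_spectrum \<alpha> C" if k: "k \<in> arveson_spectrum \<alpha> C" for k
  proof (rule strong_Connes_spectrum_of_simple_fixed_points[OF Cc P])
    show "closed_product (spectral_subspace \<alpha> C (- k)) (spectral_subspace \<alpha> C k) = fixed_points \<alpha> C"
    proof (cases "k = 0")
      case True
      thus ?thesis
        using closed_product_cstar_subalgebra_self[OF cstar_subalgebra_fixed_points[OF act Cc(1)]] by simp
    next
      case False
      have "spectral_subspace \<alpha> C k \<subseteq> A k" by (auto simp: A_def spectral_subspace_def)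
      hence "k \<in> sp" using k by (auto simp: sp_iff arveson_spectrum_iff[OF act Cc(1)])
      thus ?thesis using full[of k] A_eq[of k] A_eq[of "- k"] sp_minus False C0 by simp
    qed
  qed
  hence "arveson_spectrum \<alpha> C = strong_Connes_spectrum \<alpha> C"
    using strong_Connes_spectrum_subset(2)[OF CI] by blast
  thus ?thesis using CI A_eq invariantly_simple_of_simple_fixed_points[OF Cc P] by blast
qed

end

section \<open>From strong Connes spectrum to simplicity\<close>

text \<open>
  Let \<open>I\<close> be a non-zero ideal of the fixed points and \<open>D\<close> its hereditary hull. Then
  \<open>I = D\<^sub>0 = D\<^sub>m D\<^sub>-\<^sub>m\<close>, and this is in \<open>C\<^sub>m I C\<^sub>-\<^sub>m\<close>. With \<open>- m\<close> for \<open>m\<close> this gives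
  \<open>C\<^sub>m I C\<^sub>-\<^sub>m \<subseteq> I\<close>. Hence the degree 0 part of the ideal of \<open>C\<close> that \<open>I\<close> generates
  is no larger than \<open>I\<close>, but that ideal is \<open>C\<close>.
\<close>

lemma simple_fixed_points:
  assumes C: "C \<in> invariant_hereditary \<alpha> B" and simple: "invariantly_simple \<alpha> C"
    and spec: "arveson_spectrum \<alpha> C = strong_Connes_spectrum \<alpha> C"
  shows "simple_cstar_algebra (fixed_points \<alpha> C)"
proof -
  have Cc: "cstar_subalgebra C" "invariant \<alpha> C" "C \<noteq> {0}"
    using C by (auto simp: invariant_hereditary_def hereditary_subalgebra_def)
  let ?S = "spectral_subspace \<alpha> C" and ?P = "fixed_points \<alpha> C"
  note CD = cstar_subalgebraD[OF Cc(1)]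
  have Pc: "cstar_subalgebra ?P" by (rule cstar_subalgebra_fixed_points[OF act Cc(1)])
  have "I = ?P" if I: "closed_ideal I ?P" "I \<noteq> {0}" for I
  proof -
    note ID = closed_idealD[OF I(1)]
    have IC: "I \<subseteq> C" using ID(1) spectral_subspace_subset by blast
    have Ic: "cstar_subalgebra I" by (rule closed_ideal_imp_cstar_subalgebra[OF Pc I(1)])
    define D where "D = hereditary_hull C I"
    have D0: "fixed_points \<alpha> D = I" and DI: "D \<in> invariant_hereditary \<alpha> C"
      unfolding D_def using hereditary_hull_of_ideal[OF act Cc(1,2) I] by auto
    have Dc: "cstar_subalgebra D" and DC: "D \<subseteq> C"
      using DI by (auto simp: invariant_hereditary_def hereditary_subalgebra_def)
    have I_sub: "I \<subseteq> closed_product (closed_product (?S m) I) (?S (- m))"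
      if m: "m \<in> arveson_spectrum \<alpha> C" for m
    proof -
      have "closed_product (spectral_subspace \<alpha> D m) (star ` spectral_subspace \<alpha> D m) = fixed_points \<alpha> D"
        using m DI unfolding spec strong_Connes_spectrum_def by blast
      hence "I = closed_product (spectral_subspace \<alpha> D m) (spectral_subspace \<alpha> D (- m))"
        by (simp only: star_image_spectral[OF act Dc] D0)
      also have "\<dots> \<subseteq> closed_product (closed_product (?S m) I) (?S (- m))"
      proof (rule closed_product_mono)
        show "spectral_subspace \<alpha> D m \<subseteq> closed_product (?S m) I"
          unfolding D_def
          by (rule spectral_subspace_hereditary_hull_subset[OF act Cc(1,2)])
             (use ID(1) fixed_points_subset_UNIV in blast)
        show "spectral_subspace \<alpha> D (- m) \<subseteq> ?S (- m)" using DC by (auto simp: spectral_subspace_def)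
      qed
      finally show ?thesis .
    qed
    have conj: "x * y * z \<in> I" if x: "x \<in> ?S m" and y: "y \<in> I" and z: "z \<in> ?S (- m)" for m x y z
    proof (cases "x = 0")
      case True
      thus ?thesis using complex_subspaceD(1)[OF ID(2)] by simp
    next
      case False
      hence "m \<in> arveson_spectrum \<alpha> C" using x by (auto simp: arveson_spectrum_iff[OF act Cc(1)])
      hence "- m \<in> arveson_spectrum \<alpha> C" by (rule uminus_mem_arveson_spectrum[OF act Cc(1)])
      hence y': "y \<in> closed_product (closed_product (?S (- m)) I) (?S m)" using I_sub[of "- m"] y by auto
      have V: "closed_subspace {y. y * v \<in> {w. x * w \<in> I}}" for v
        by (intro closed_subspace_vimage_mult_right closed_subspace_vimage_mult_left ID(6))
      have w: "x * (w * (v * z)) \<in> I" if w: "w \<in> closed_product (?S (- m)) I" and v: "v \<in> ?S m" for w v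
      proof -
        have vz: "v * z \<in> ?P" using spectral_subspace_mult[OF act Cc(1) v z] by simp
        have "closed_product (?S (- m)) I \<subseteq> {w. w * (v * z) \<in> {w. x * w \<in> I}}"
        proof (rule closed_product_least[OF V])
          fix u i assume u: "u \<in> ?S (- m)" and i: "i \<in> I"
          have "x * u \<in> ?P" using spectral_subspace_mult[OF act Cc(1) x u] by simp
          hence "(x * u) * (i * (v * z)) \<in> I" by (intro ID(4,5) i vz)
          thus "u * i \<in> {w. w * (v * z) \<in> {w. x * w \<in> I}}" by (simp add: mult.assoc)
        qed
        thus ?thesis using w by blast
      qed
      have "closed_product (closed_product (?S (- m)) I) (?S m) \<subseteq> {y. y * z \<in> {w. x * w \<in> I}}"
        using w by (intro closed_product_least V) (simp add: mult.assoc)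
      thus ?thesis using y' by (auto simp: mult.assoc)
    qed
    let ?W = "closed_product C I"
    define K where "K = closed_product ?W C"
    have W: "closed_subspace ?W" by (rule closed_subspace_closed_product[OF CD(1)])
    have K: "closed_subspace K" unfolding K_def by (rule closed_subspace_closed_product[OF closed_subspaceD(1)[OF W]])
    have WC: "?W \<subseteq> C" by (rule closed_product_subset[OF Cc(1) _ IC]) simp
    have "K = C"
    proof -
      have KC: "K \<subseteq> C" unfolding K_def by (rule closed_product_subset[OF Cc(1) WC]) simp
      moreover have "b * x \<in> K" if "b \<in> C" "x \<in> K" for b x
        using that closed_product_left_ideal[OF Cc(1)] unfolding K_def
        by (intro closed_product_left_action[OF closed_subspaceD(1)[OF W]]) auto
      moreover have "x * b \<in> K" if "b \<in> C" "x \<in> K" for b x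
        using that CD(3) unfolding K_def
        by (intro closed_product_right_action[OF closed_subspaceD(1)[OF W]]) auto
      ultimately have "closed_ideal K C" using closed_subspaceD[OF K] unfolding closed_ideal_def by blast
      moreover have "invariant \<alpha> K"
        unfolding invariant_def
      proof (intro ballI)
        fix z :: complex assume z: "z \<in> unit_circle"
        have "K \<subseteq> {x. \<alpha> z x \<in> K}"
          unfolding K_def
        proof (rule closed_product_least)
          show "closed_subspace {x. \<alpha> z x \<in> closed_product ?W C}"
            by (rule closed_subspace_vimage[where \<sigma> = "\<lambda>c. c"])
               (use K in \<open>simp add: K_def\<close>, intro bounded_linear_action[OF act z] action_scaleC[OF act z])+
          fix w c assume w: "w \<in> ?W" and c: "c \<in> C"
          have "\<alpha> z w \<in> ?W"
            by (rule invariant_closed_product[OF act CD(1) Cc(2) _ z w])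
               (use ID(1) fixed_points_subset_UNIV in blast)
          moreover have "\<alpha> z c \<in> C" using c z Cc(2) unfolding invariant_def by blast
          ultimately show "w * c \<in> {x. \<alpha> z x \<in> closed_product ?W C}"
            using z by (simp add: action_mult[OF act] closed_product_mem)
        qed
        thus "\<alpha> z ` K \<subseteq> K" by blast
      qed
      moreover have "K \<noteq> {0}"
      proof -
        have "I = closed_product (closed_product I I) I"
          by (simp add: closed_product_cstar_subalgebra_self[OF Ic])
        also have "\<dots> \<subseteq> K" unfolding K_def by (intro closed_product_mono IC subset_refl)
        finally show ?thesis using I(2) complex_subspaceD(1)[OF ID(2)] by blast
      qed
      ultimately show ?thesis using simple unfolding invariantly_simple_def by blast
    qed
    let ?E = "fourier_coefficient \<alpha> 0"
    have VE: "closed_subspace {x. ?E x \<in> I}"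
      by (rule closed_subspace_vimage[where \<sigma> = "\<lambda>c. c"])
         (intro ID(6) bounded_linear_fourier_coefficient[OF act] fourier_coefficient_scaleC[OF act])+
    note Csub = subset_of_spectral_subspaces[OF act closed_subspace_cstar_subalgebra[OF Cc(1)] Cc(2)]
    have E1: "?E (x * y * c) \<in> I" if x: "x \<in> ?S m" and y: "y \<in> I" and c: "c \<in> C" for m x y c
    proof -
      have "C \<subseteq> {c. (x * y) * c \<in> {w. ?E w \<in> I}}"
      proof (rule Csub)
        show "closed_subspace {c. (x * y) * c \<in> {w. ?E w \<in> I}}" by (intro closed_subspace_vimage_mult_left VE)
        show "?S k \<subseteq> {c. (x * y) * c \<in> {w. ?E w \<in> I}}" for k
        proof
          fix z assume z: "z \<in> ?S k"
          have xyz: "x * y * z \<in> ?S (m + 0 + k)"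
            using x y z ID(1) by (intro spectral_subspace_mult[OF act Cc(1)]) auto
          have "?E (x * y * z) \<in> I"
          proof (cases "k = - m")
            case True
            have "?E (x * y * z) = x * y * z"
              by (rule fourier_coefficient_spectral[OF act]) (use xyz True in simp)
            thus ?thesis using conj[OF x y] z True by simp
          next
            case False
            have "?E (x * y * z) = 0"
              by (rule fourier_coefficient_other[OF act xyz]) (use False in simp)
            thus ?thesis using complex_subspaceD(1)[OF ID(2)] by simp
          qed
          thus "z \<in> {c. (x * y) * c \<in> {w. ?E w \<in> I}}" by simp
        qed
      qed
      thus ?thesis using c by blast
    qed
    have E2: "?E (b * y * c) \<in> I" if b: "b \<in> C" and y: "y \<in> I" and c: "c \<in> C" for b y c
    proof -
      have "C \<subseteq> {b. b * (y * c) \<in> {w. ?E w \<in> I}}"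
        using E1[OF _ y c] by (intro Csub closed_subspace_vimage_mult_right VE) (auto simp: mult.assoc)
      thus ?thesis using b by (auto simp: mult.assoc)
    qed
    have E3: "?E (w * c) \<in> I" if w: "w \<in> ?W" and c: "c \<in> C" for w c
    proof -
      have "?W \<subseteq> {w. w * c \<in> {w. ?E w \<in> I}}"
        using E2 c by (intro closed_product_least closed_subspace_vimage_mult_right VE) simp
      thus ?thesis using w by blast
    qed
    have "K \<subseteq> {w. ?E w \<in> I}" unfolding K_def using E3 by (intro closed_product_least VE) simp
    hence "?E p \<in> I" if "p \<in> ?P" for p using that spectral_subspace_subset \<open>K = C\<close> by blast
    hence "?P \<subseteq> I" by (metis fourier_coefficient_spectral[OF act] subsetI)
    thus "I = ?P" using ID(1) by blast
  qed
  thus ?thesis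
    using Pc fixed_points_nonzero[OF act Cc] unfolding simple_cstar_algebra_def by blast
qed

end

section \<open>The equivalence\<close>

theorem proposition12:
  fixes \<alpha> :: "complex \<Rightarrow> 'a::cstar_algebra \<Rightarrow> 'a"
  assumes "circle_action \<alpha>"
    and "arveson_spectrum \<alpha> UNIV \<noteq> {0}"
  shows
    "((\<exists>J. closed_ideal J (fixed_points \<alpha> UNIV) \<and> J \<noteq> {0} \<and> simple_cstar_algebra J \<and>
        (\<forall>n\<in>arveson_spectrum \<alpha> UNIV. n \<ge> 1 \<longrightarrow>
           closed_product (spectral_subspace \<alpha> UNIV n) (spectral_subspace \<alpha> UNIV (- n)) = J))
     \<longleftrightarrow>
     (\<exists>n0::int. n0 > 0 \<and> arveson_spectrum \<alpha> UNIV = {- n0, 0, n0} \<and>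
        closed_product (spectral_subspace \<alpha> UNIV n0) (spectral_subspace \<alpha> UNIV (- n0))
          \<subseteq> fixed_points \<alpha> UNIV \<and>
        simple_cstar_algebra
          (closed_product (spectral_subspace \<alpha> UNIV n0) (spectral_subspace \<alpha> UNIV (- n0))))
     \<or>
     (\<exists>C\<in>invariant_hereditary \<alpha> UNIV.
        (\<forall>n\<in>arveson_spectrum \<alpha> UNIV. n \<noteq> 0 \<longrightarrow>
           spectral_subspace \<alpha> UNIV n = spectral_subspace \<alpha> C n) \<and>
        invariantly_simple \<alpha> C \<and>
        arveson_spectrum \<alpha> C = strong_Connes_spectrum \<alpha> C))
     \<and>
     (\<forall>C\<in>invariant_hereditary \<alpha> UNIV.
        (\<forall>n\<in>arveson_spectrum \<alpha> UNIV. n \<noteq> 0 \<longrightarrow>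
           spectral_subspace \<alpha> UNIV n = spectral_subspace \<alpha> C n) \<longrightarrow>
        arveson_spectrum \<alpha> UNIV = arveson_spectrum \<alpha> C)"
    (is "(?i \<longleftrightarrow> ?ii1 \<or> ?ii2) \<and> ?eq")
proof (intro conjI iffI)
  note act = assms(1) and U = cstar_subalgebra_UNIV
  let ?A = "spectral_subspace \<alpha> UNIV" and ?sp = "arveson_spectrum \<alpha> UNIV"
  note sp_iff = arveson_spectrum_iff[OF act U]
  show eq: ?eq
  proof (intro ballI impI)
    fix C assume C: "C \<in> invariant_hereditary \<alpha> UNIV"
      and CA: "\<forall>n\<in>?sp. n \<noteq> 0 \<longrightarrow> ?A n = spectral_subspace \<alpha> C n"
    have Cc: "cstar_subalgebra C" "invariant \<alpha> C" "C \<noteq> {0}"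
      using C by (auto simp: invariant_hereditary_def hereditary_subalgebra_def)
    have sub: "spectral_subspace \<alpha> C n \<subseteq> ?A n" for n by (auto simp: spectral_subspace_def)
    have 0: "0 \<in> arveson_spectrum \<alpha> C"
      using fixed_points_nonzero[OF act Cc] by (simp add: arveson_spectrum_def)
    show "?sp = arveson_spectrum \<alpha> C"
    proof (rule antisym)
      show "arveson_spectrum \<alpha> C \<subseteq> ?sp"
        using sub unfolding arveson_spectrum_iff[OF act Cc(1)] sp_iff subset_iff by blast
      show "?sp \<subseteq> arveson_spectrum \<alpha> C"
      proof
        fix n assume n: "n \<in> ?sp"
        show "n \<in> arveson_spectrum \<alpha> C"
          using 0 CA n by (cases "n = 0") (auto simp: arveson_spectrum_def)
      qed
    qed
  qed
  show "?ii1 \<or> ?ii2" if i: ?i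
  proof -
    obtain J where J: "closed_ideal J (?A 0)" "J \<noteq> {0}" "simple_cstar_algebra J"
      and range: "\<And>n. n \<in> ?sp \<Longrightarrow> n \<ge> 1 \<Longrightarrow> closed_product (?A n) (?A (- n)) = J"
      using i by blast
    have 0: "0 \<in> ?sp"
      using J(2) closed_idealD(1,2)[OF J(1)] complex_subspaceD(1) by (auto simp: sp_iff)
    have "\<exists>k. int k \<in> ?sp \<and> int k \<ge> 1"
      using exists_positive_spectrum[OF act assms(2) 0] by (metis nat_0_le order_trans zero_le_one)
    then obtain k where k: "int k \<in> ?sp" "int k \<ge> 1"
      and least: "\<And>l. int l \<in> ?sp \<Longrightarrow> int l \<ge> 1 \<Longrightarrow> k \<le> l"
      using exists_least_iff[of "\<lambda>k. int k \<in> ?sp \<and> int k \<ge> 1"] by (metis not_le)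
    define n where "n = int k"
    have n: "n \<in> ?sp" "n \<ge> 1" using k by (auto simp: n_def)
    have n_least: "n \<le> m" if "m \<in> ?sp" "m \<ge> 1" for m
      using least[of "nat m"] that by (simp add: n_def)
    show ?thesis
    proof (cases "\<exists>m\<in>?sp. m > n")
      case True
      thus ?thesis
        using exists_hereditary_of_two_positive_degrees[OF act J range n n_least] by blast
    next
      case False
      have "m = n" if "m \<in> ?sp" "m \<ge> 1" for m using False n_least that by force
      moreover have minus: "- m \<in> ?sp" if "m \<in> ?sp" for m by (rule uminus_mem_arveson_spectrum[OF act U that])
      ultimately have "m \<in> {- n, 0, n}" if "m \<in> ?sp" for m
        using that by (cases "m \<ge> 1"; cases "- m \<ge> 1") force+
      hence "?sp = {- n, 0, n}" using 0 n(1) minus[OF n(1)] by blast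
      moreover have "closed_product (?A n) (?A (- n)) \<subseteq> ?A 0"
        using range[OF n] closed_idealD(1)[OF J(1)] by simp
      ultimately have ?ii1 using n range[OF n] J(3) by (intro exI[of _ n]) simp
      thus ?thesis by blast
    qed
  qed
  show ?i if "?ii1 \<or> ?ii2"
    using that
  proof
    assume ?ii1
    then obtain n0 where n0: "n0 > 0" "?sp = {- n0, 0, n0}"
      "simple_cstar_algebra (closed_product (?A n0) (?A (- n0)))" by blast
    show ?i
    proof (intro exI conjI)
      show "closed_ideal (closed_product (?A n0) (?A (- n0))) (?A 0)"
        by (rule closed_product_spectral_ideal[OF act U])
      show "closed_product (?A n0) (?A (- n0)) \<noteq> {0}" using n0(3) by (simp add: simple_cstar_algebra_def)
    qed (use n0 in auto)
  next
    assume ?ii2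
    then obtain C where C: "C \<in> invariant_hereditary \<alpha> UNIV"
      and CA: "\<forall>n\<in>?sp. n \<noteq> 0 \<longrightarrow> ?A n = spectral_subspace \<alpha> C n"
      and simple: "invariantly_simple \<alpha> C"
      and spec: "arveson_spectrum \<alpha> C = strong_Connes_spectrum \<alpha> C"
      by (elim bexE conjE)
    have sp_C: "?sp = arveson_spectrum \<alpha> C" by (rule eq[THEN bspec, THEN mp, OF C CA])
    let ?P = "fixed_points \<alpha> C"
    have P: "simple_cstar_algebra ?P" by (rule simple_fixed_points[OF act C simple spec])
    have P0: "?P \<noteq> {0}" using P by (simp add: simple_cstar_algebra_def)
    have minus: "- m \<in> ?sp" if "m \<in> ?sp" for m by (rule uminus_mem_arveson_spectrum[OF act U that])
    have range: "closed_product (?A n) (?A (- n)) = ?P" if n: "n \<in> ?sp" "n \<ge> 1" for n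
    proof -
      have "?A n = spectral_subspace \<alpha> C n" "?A (- n) = spectral_subspace \<alpha> C (- n)"
        using CA n minus[OF n(1)] by auto
      thus ?thesis using strong_Connes_spectrum_subset(1)[OF act C] n(1) sp_C spec by simp
    qed
    have "0 \<in> ?sp" using P0 sp_C by (simp add: arveson_spectrum_def)
    then obtain n where n: "n \<in> ?sp" "n \<ge> 1" using exists_positive_spectrum[OF act assms(2)] by blast
    have "closed_ideal ?P (?A 0)"
      using closed_product_spectral_ideal[OF act U, of n] by (simp add: range[OF n])
    thus ?i using P P0 range by blast
  qed
qed

end
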